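(* Let $n\ge3$. Every horizontal direction $E\in V_1$ of the model filiform group $\mathbb{E}_n$ with $\omega(E)=1$, except for possibly $\pm X_2$, is deformable. Moreover, for each such $E$ the parameters $C_E,N_E,\Delta_E$ in the definition of deformability can be chosen so that every $\tilde E\in V_1$ with $\omega(\tilde E)=1$ sufficiently close to $E$ is also deformable with the same parameters $C_{\tilde E}=C_E$, $N_{\tilde E}=N_E$, $\Delta_{\tilde E}(\eta)=\Delta_E(\eta)$.
   Context: For $n\ge2$, the model filiform group $\mathbb{E}_n$ is the Carnot group (simply connected stratified nilpotent Lie group) of step $n-1$ whose Lie algebra has a basis $X_1,\dots,X_n$ with only non-vanishing bracket relations $[X_i,X_1]=X_{i+1}$ for $1<i<n$, with stratification $V_1=\mathrm{Span}\{X_1,X_2\}$ (the horizontal layer) and $V_i=\mathrm{Span}\{X_{i+1}\}$ for $1<i<n$. Elements of the Lie algebra are regarded as left-invariant vector fields. Identify $\mathbb{E}_n$ with $\mathbb{R}^n$ by $(x_1,\dots,x_n)\leftrightarrow\exp(x_1X_1+\cdots+x_nX_n)$ (the identity is $0$). $\omega$ is the inner product norm on $V_1$ making $X_1,X_2$ orthonormal; $p(x)=(x_1,x_2)$ for $x\in\mathbb{E}_n$, and $p(E)=(a_1,a_2)$ for $E=a_1X_1+a_2X_2$; then $\exp(E)=E(0)=(p(E),0)$. $\langle\cdot,\cdot\rangle$ is the Euclidean inner product in coordinates. Dilations: $\delta_\lambda(\exp(\sum_iY_i))=\exp(\sum_i\lambda^iY_i)$ for $\lambda>0$, $Y_i\in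 V_i$. An absolutely continuous curve $\gamma:[a,b]\to\mathbb{E}_n$ is horizontal if $\gamma'(t)=u_1(t)X_1(\gamma(t))+u_2(t)X_2(\gamma(t))$ for a.e. $t$ with $u_1,u_2\in L^1[a,b]$; its length is $\int_a^b|u|$. The Carnot-Carathéodory distance $d(x,y)$ is the infimum of lengths of horizontal curves joining $x$ to $y$; $d(x)=d(x,0)$. $\mathrm{Lip}_{\mathbb{G}}$ is the Lipschitz constant with respect to $d$ (with $\mathbb{G}=\mathbb{E}_n$). Horizontal lines are curves $t\mapsto q\exp(tV)$ with $q\in\mathbb{G}$, $V\in V_1$. A curve is formed by joining at most $N$ horizontal lines if its domain can be divided into at most $N$ consecutive intervals on each of which it coincides with a horizontal line. $E\in V_1$ with $\omega(E)=1$ is deformable, with parameters $C_E$ (a positive constant), $N_E$ (a positive integer) and $\Delta_E:(0,\infty)\to(0,\infty)$, if for every $0<\ell<1$, $\eta\in(0,\infty)$, $0<\Delta<\Delta_E(\eta)$ and $u\in\mathbb{G}$ with $d(u)\le1$, there is a Lipschitz horizontal curve $g:\mathbb{R}\to\mathbb{G}$ formed by joining at most $N_E$ horizontal lines such that: (1) $g(t)=\exp(tE)$ for $|t|\ge \ell$; (2) $g(\zeta)=\delta_{\Delta \ell}(u)$ where $\zeta:=\langle\delta_{\Delta \ell}(u),E(0)\rangle$; (3) $\mathrm{Lip}_{\mathbb{G}}(g)\le1+\eta\Delta$; (4) $|(p\circ g)'(t)-p(E)|\le C_E\Delta$ for all but finitely many $t\in\mathbb{R}$. $E$ is deformable if such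 parameters exist. *)

theory Defs
  imports "HOL-Analysis.Analysis"
begin

section \<open>The model filiform group in exponential coordinates\<close>

text \<open>
  A vector \<open>x :: nat \<Rightarrow> real\<close> vanishing off \<open>{1..n}\<close> stands both for the Lie algebra element
  \<open>x 1 X_1 + \<dots> + x n X_n\<close> and for the group element \<open>exp (x 1 X_1 + \<dots> + x n X_n)\<close>. Under this
  identification the exponential map is the identity, and the neutral element is \<open>0\<close>.
\<close>

type_synonym vec = "nat \<Rightarrow> real"

definition filiform :: "nat \<Rightarrow> vec set" where
  "filiform n = {x. \<forall>k. k \<notin> {1..n} \<longrightarrow> x k = 0}"

definition basis_vec :: "nat \<Rightarrow> vec" where
  "basis_vec i = (\<lambda>k. if k = i then 1 else 0)"

definition vscale :: "real \<Rightarrow> vec \<Rightarrow> vec" where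
  "vscale c x = (\<lambda>k. c * x k)"

text \<open>
  The bilinear antisymmetric extension of \<open>[X_i, X_1] = X_(i+1)\<close> for \<open>1 < i < n\<close>, all other
  brackets \<open>[X_i, X_j]\<close> with \<open>i > j\<close> being \<open>0\<close>.
\<close>

definition lie_bracket :: "nat \<Rightarrow> vec \<Rightarrow> vec \<Rightarrow> vec" where
  "lie_bracket n x y =
     (\<lambda>k. if 3 \<le> k \<and> k \<le> n then x (k - 1) * y 1 - x 1 * y (k - 1) else 0)"

text \<open>\<open>[z_1, [z_2, \<dots> [z_(m-1), z_m] \<dots>]]\<close>\<close>

fun nested_bracket :: "nat \<Rightarrow> vec list \<Rightarrow> vec" where
  "nested_bracket n [] = (\<lambda>k. 0)"
| "nested_bracket n [z] = z"
| "nested_bracket n (z # w # zs) = lie_bracket n z (nested_bracket n (w # zs))"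

text \<open>
  The group law is the Baker-Campbell-Hausdorff product in Dynkin's form: the sum over all
  \<open>((r_1, s_1), \<dots>, (r_k, s_k))\<close> with \<open>k \<ge> 1\<close> and \<open>r_i + s_i > 0\<close> of
  \<open>(-1)^(k-1) / k\<close> times \<open>[x^(r_1) y^(s_1) \<dots> x^(r_k) y^(s_k)]\<close> divided by
  \<open>(\<Sum>i. r_i + s_i) * (\<Prod>i. r_i! s_i!)\<close>. The Lie algebra has step \<open>n - 1\<close>, so that brackets
  of more than \<open>n - 1\<close> entries vanish and the sum can be cut off at total degree \<open>n - 1\<close>.
\<close>

definition bch_degree :: "(nat \<times> nat) list \<Rightarrow> nat" where
  "bch_degree ps = (\<Sum>(r, s)\<leftarrow>ps. r + s)"

definition bch_indices :: "nat \<Rightarrow> (nat \<times> nat) list set" where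
  "bch_indices n = {ps. ps \<noteq> [] \<and> (0, 0) \<notin> set ps \<and> bch_degree ps \<le> n - 1}"

definition bch_coeff :: "(nat \<times> nat) list \<Rightarrow> real" where
  "bch_coeff ps = (- 1) ^ (length ps - 1) /
     (real (length ps) * real (bch_degree ps) * (\<Prod>(r, s)\<leftarrow>ps. fact r * fact s))"

definition bch_word :: "vec \<Rightarrow> vec \<Rightarrow> (nat \<times> nat) list \<Rightarrow> vec list" where
  "bch_word x y ps = concat (map (\<lambda>(r, s). replicate r x @ replicate s y) ps)"

definition gmult :: "nat \<Rightarrow> vec \<Rightarrow> vec \<Rightarrow> vec" where
  "gmult n x y = (\<lambda>k. \<Sum>ps\<in>bch_indices n. bch_coeff ps * nested_bracket n (bch_word x y ps) k)"

lemma finite_bch_indices: "finite (bch_indices n)"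
proof -
  have bnd: "length ps \<le> bch_degree ps \<and> (\<forall>(r, s)\<in>set ps. r \<le> bch_degree ps \<and> s \<le> bch_degree ps)"
    if "(0, 0) \<notin> set ps" for ps
    using that
  proof (induction ps)
    case (Cons p ps)
    obtain r s where p: "p = (r, s)" by (cases p)
    show ?case using Cons by (fastforce simp: bch_degree_def p)
  qed (simp add: bch_degree_def)
  have "bch_indices n \<subseteq> {ps. set ps \<subseteq> {..n - 1} \<times> {..n - 1} \<and> length ps \<le> n - 1}"
  proof
    fix ps assume "ps \<in> bch_indices n"
    then have "(0, 0) \<notin> set ps" "bch_degree ps \<le> n - 1" by (auto simp: bch_indices_def)
    with bnd[of ps] show "ps \<in> {ps. set ps \<subseteq> {..n - 1} \<times> {..n - 1} \<and> length ps \<le> n - 1}"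
      by fastforce
  qed
  then show ?thesis
    by (rule finite_subset) (rule finite_lists_length_le, simp)
qed

text \<open>
  The left-invariant vector field with value \<open>V\<close> at \<open>0\<close>, in coordinates: the derivative at
  \<open>t = 0\<close> of \<open>t \<mapsto> x exp(t V)\<close>.
\<close>

definition left_inv_field :: "nat \<Rightarrow> vec \<Rightarrow> vec \<Rightarrow> vec" where
  "left_inv_field n V x = (\<lambda>k. deriv (\<lambda>t. gmult n x (vscale t V) k) 0)"

definition horizontal_layer :: "nat \<Rightarrow> vec set" where
  "horizontal_layer n =
     {V \<in> filiform n. \<exists>a1 a2. V = (\<lambda>k. a1 * basis_vec 1 k + a2 * basis_vec 2 k)}"

definition hnorm :: "vec \<Rightarrow> real" where
  "hnorm V = sqrt ((V 1)\<^sup>2 + (V 2)\<^sup>2)"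

text \<open>Both the projection of group elements and that of horizontal vectors.\<close>

definition hproj :: "vec \<Rightarrow> real \<times> real" where
  "hproj x = (x 1, x 2)"

definition vinner :: "nat \<Rightarrow> vec \<Rightarrow> vec \<Rightarrow> real" where
  "vinner n x y = (\<Sum>k = 1..n. x k * y k)"

text \<open>\<open>X_1\<close> and \<open>X_2\<close> lie in layer 1, and \<open>X_k\<close> lies in layer \<open>k - 1\<close> for \<open>k \<ge> 3\<close>.\<close>

definition dilation :: "real \<Rightarrow> vec \<Rightarrow> vec" where
  "dilation r x = (\<lambda>k. r ^ (if k = 1 then 1 else k - 1) * x k)"


section \<open>Horizontal curves and the Carnot-Caratheodory distance\<close>

definition abs_cont_on :: "real \<Rightarrow> real \<Rightarrow> (real \<Rightarrow> real) \<Rightarrow> bool" where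
  "abs_cont_on a b f \<longleftrightarrow>
     (\<forall>\<epsilon>>0. \<exists>\<delta>>0. \<forall>D. finite D \<and> (\<forall>(c, d)\<in>D. a \<le> c \<and> c \<le> d \<and> d \<le> b) \<and>
        pairwise (\<lambda>p q. disjnt {fst p<..<snd p} {fst q<..<snd q}) D \<and>
        (\<Sum>(c, d)\<in>D. d - c) < \<delta> \<longrightarrow>
        (\<Sum>(c, d)\<in>D. \<bar>f d - f c\<bar>) < \<epsilon>)"

text \<open>
  \<open>\<gamma>\<close> restricted to \<open>[a, b]\<close> is a horizontal curve with controls \<open>u1\<close>, \<open>u2\<close>.
  Absolute continuity and differentiation in \<open>n\<close>-space are expressed coordinatewise.
\<close>

definition horizontal_with ::
  "nat \<Rightarrow> real \<Rightarrow> real \<Rightarrow> (real \<Rightarrow> vec) \<Rightarrow> (real \<Rightarrow> real) \<Rightarrow> (real \<Rightarrow> real) \<Rightarrow> bool" where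
  "horizontal_with n a b \<gamma> u1 u2 \<longleftrightarrow>
     (\<forall>t\<in>{a..b}. \<gamma> t \<in> filiform n) \<and>
     (\<forall>k\<in>{1..n}. abs_cont_on a b (\<lambda>t. \<gamma> t k)) \<and>
     u1 absolutely_integrable_on {a..b} \<and> u2 absolutely_integrable_on {a..b} \<and>
     (AE t in lebesgue. t \<in> {a..b} \<longrightarrow>
        (\<forall>k\<in>{1..n}. ((\<lambda>s. \<gamma> s k) has_real_derivative
           u1 t * left_inv_field n (basis_vec 1) (\<gamma> t) k +
           u2 t * left_inv_field n (basis_vec 2) (\<gamma> t) k) (at t within {a..b})))"

definition ctrl_length :: "real \<Rightarrow> real \<Rightarrow> (real \<Rightarrow> real) \<Rightarrow> (real \<Rightarrow> real) \<Rightarrow> real" where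
  "ctrl_length a b u1 u2 = integral {a..b} (\<lambda>t. sqrt ((u1 t)\<^sup>2 + (u2 t)\<^sup>2))"

text \<open>The infimum is taken in the extended reals, so it would be \<open>\<infinity>\<close> if no curve joined the points.\<close>

definition cc_dist :: "nat \<Rightarrow> vec \<Rightarrow> vec \<Rightarrow> ereal" where
  "cc_dist n x y = Inf {ereal (ctrl_length a b u1 u2) | a b \<gamma> u1 u2.
     a \<le> b \<and> horizontal_with n a b \<gamma> u1 u2 \<and> \<gamma> a = x \<and> \<gamma> b = y}"

definition cc_norm :: "nat \<Rightarrow> vec \<Rightarrow> ereal" where
  "cc_norm n x = cc_dist n x (\<lambda>k. 0)"

definition cc_lipschitz_with :: "nat \<Rightarrow> real \<Rightarrow> (real \<Rightarrow> vec) \<Rightarrow> bool" where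
  "cc_lipschitz_with n L g \<longleftrightarrow>
     0 \<le> L \<and> (\<forall>s t. cc_dist n (g s) (g t) \<le> ereal (L * \<bar>s - t\<bar>))"

text \<open>\<open>\<infinity>\<close> if \<open>g\<close> is not Lipschitz.\<close>

definition cc_Lip :: "nat \<Rightarrow> (real \<Rightarrow> vec) \<Rightarrow> ereal" where
  "cc_Lip n g = Inf {ereal L | L. cc_lipschitz_with n L g}"

text \<open>A curve defined on the whole real line is horizontal if its restriction to every compact
  interval is.\<close>

definition horizontal_curve :: "nat \<Rightarrow> (real \<Rightarrow> vec) \<Rightarrow> bool" where
  "horizontal_curve n g \<longleftrightarrow> (\<forall>a b. a < b \<longrightarrow> (\<exists>u1 u2. horizontal_with n a b g u1 u2))"

definition horizontal_line :: "nat \<Rightarrow> (real \<Rightarrow> vec) \<Rightarrow> bool" where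
  "horizontal_line n h \<longleftrightarrow>
     (\<exists>q\<in>filiform n. \<exists>V\<in>horizontal_layer n. h = (\<lambda>t. gmult n q (vscale t V)))"

text \<open>Domain \<open>\<real>\<close>. A finite partition of the line into intervals is a division into consecutive
  intervals.\<close>

definition joins_horizontal_lines :: "nat \<Rightarrow> nat \<Rightarrow> (real \<Rightarrow> vec) \<Rightarrow> bool" where
  "joins_horizontal_lines n N g \<longleftrightarrow>
     (\<exists>P. partition_on (UNIV :: real set) P \<and> finite P \<and> card P \<le> N \<and>
        (\<forall>I\<in>P. is_interval I \<and> (\<exists>h. horizontal_line n h \<and> (\<forall>t\<in>I. g t = h t))))"


section \<open>Deformability\<close>

definition deformable_with ::
  "nat \<Rightarrow> vec \<Rightarrow> real \<Rightarrow> nat \<Rightarrow> (real \<Rightarrow> real) \<Rightarrow> bool" where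
  "deformable_with n E C N \<Delta>E \<longleftrightarrow>
     E \<in> horizontal_layer n \<and> hnorm E = 1 \<and> C > 0 \<and> N > 0 \<and> (\<forall>\<eta>>0. \<Delta>E \<eta> > 0) \<and>
     (\<forall>l \<eta> \<Delta> u. 0 < l \<and> l < 1 \<and> 0 < \<eta> \<and> 0 < \<Delta> \<and> \<Delta> < \<Delta>E \<eta> \<and>
        u \<in> filiform n \<and> cc_norm n u \<le> 1 \<longrightarrow>
        (\<exists>g. (\<exists>L. cc_lipschitz_with n L g) \<and> horizontal_curve n g \<and>
           joins_horizontal_lines n N g \<and>
           (\<forall>t. \<bar>t\<bar> \<ge> l \<longrightarrow> g t = vscale t E) \<and>
           g (vinner n (dilation (\<Delta> * l) u) (left_inv_field n E (\<lambda>k. 0))) = dilation (\<Delta> * l) u \<and>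
           cc_Lip n g \<le> ereal (1 + \<eta> * \<Delta>) \<and>
           finite {t. \<not> (\<exists>D. ((\<lambda>s. hproj (g s)) has_vector_derivative D) (at t) \<and>
                            norm (D - hproj E) \<le> C * \<Delta>)}))"

definition deformable :: "nat \<Rightarrow> vec \<Rightarrow> bool" where
  "deformable n E \<longleftrightarrow> (\<exists>C N \<Delta>E. deformable_with n E C N \<Delta>E)"

end

theory Submission
  imports Defs "HOL-Computational_Algebra.Formal_Power_Series"
begin

text \<open>
  The proof perturbs the slope of a horizontal line, in coordinates in which the endpoint depends
  linearly on the perturbation. An element of the group has a first coordinate \<open>a\<close> and a component in
  the abelian ideal spanned by \<open>X_2, \<dots>, X_n\<close>. The latter is read as a power series \<open>v\<close>, with the
  variable \<open>z\<close> standing for bracketing with \<open>X_1\<close>. In the coordinates \<open>(a, p)\<close> with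
  \<open>p = v * (1 - exp (- a z)) / (a z)\<close> the group law is \<open>(a, p) (b, q) = (a + b, p + exp (- a z) q)\<close>
  (\<open>gmult_sk\<close>). Consequently a horizontal curve with planar projection \<open>(x_1, x_2)\<close> satisfies
  \<open>p_i' = x_2' (- x_1)^i / i!\<close>: once \<open>x_1\<close> is prescribed, the endpoint is an affine function of the
  slope.

  Let \<open>E = a_1 X_1 + a_2 X_2\<close> with \<open>a_1 \<noteq> 0\<close>, and describe curves by their position \<open>\<sigma> = x_1 / a_1\<close>. Adding
  a step function \<open>\<psi>(\<sigma>)\<close> to the slope of the line of direction \<open>E\<close> changes the endpoint by the
  moments of \<open>\<psi>\<close> against \<open>\<sigma>^i\<close> for \<open>i \<le> n - 2\<close>. Reaching \<open>\<delta>_(\<Delta> l) u\<close> and returning to the line are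
  conditions on these moments, and a step function with \<open>n\<close> prescribed jumps can have any moments
  (\<open>moment_weights\<close>, by Lagrange interpolation). The unit ball of the Carnot-Caratheodory norm has
  bounded coordinates (\<open>cc_ball_coordinates_bounded\<close>), so the moments needed, and with them \<open>\<psi>\<close>,
  are \<open>O(\<Delta>)\<close>.

  The parametrisation is chosen such that the component of the projection along \<open>E\<close> has speed
  exactly 1. The curve then passes each point at the time \<open>\<langle>\<cdot>, E\<rangle>\<close>, which puts it at the target at
  time \<open>\<zeta>\<close>, and its velocity deviates from \<open>E\<close> by a vector orthogonal to \<open>E\<close> of size \<open>O(\<Delta>)\<close>. By
  orthogonality the speed is \<open>1 + O(\<Delta>\<^sup>2)\<close>, which is at most \<open>1 + \<eta> \<Delta>\<close> for small \<open>\<Delta>\<close>. All constants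
  depend on \<open>E\<close> only through a lower bound for \<open>\<bar>a_1\<bar>\<close> (\<open>uniformly_deformable\<close>), which makes them
  locally uniform in \<open>E\<close>.

  Since the group law is given by Dynkin's series, the formula for it has to be extracted from that
  series first. A nested bracket of \<open>x\<close>s and \<open>y\<close>s is a scalar multiple of a shift of \<open>[x, y]\<close>, the
  scalar depending on the last two letters and on the numbers of the others
  (\<open>nested_bracket_bch_word\<close>). The sum of these scalars over all index lists is a composition of
  elementary power series in one variable, and the factor \<open>1 / degree\<close> is removed by an Euler
  derivative (\<open>bch_ser_times_phi\<close>).
\<close>

section \<open>Exponential series\<close>

text \<open>
  The series \<open>(1 - exp (- a z)) / (a z)\<close>, written such that \<open>a = 0\<close> is not an exception. On the ideal
  spanned by \<open>X_2, \<dots>, X_n\<close>, where \<open>z\<close> stands for bracketing with \<open>X_1\<close> from the right, it is the operator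
  \<open>(exp A - 1) / A\<close> with \<open>A = ad (a X_1)\<close>, which occurs in the differential of the exponential map.
\<close>

definition phi :: "real \<Rightarrow> real fps" where
  "phi a = Abs_fps (\<lambda>i. (- a) ^ i / fact (Suc i))"

lemma phi_nth_0 [simp]: "fps_nth (phi a) 0 = 1"
  by (simp add: phi_def)

lemma phi_0 [simp]: "phi 0 = 1"
  by (rule fps_ext) (simp add: phi_def power_0_left)

lemma X_phi: "fps_const a * (fps_X * phi a) = 1 - fps_exp (- a)"
proof (rule fps_ext)
  fix i show "fps_nth (fps_const a * (fps_X * phi a)) i = fps_nth (1 - fps_exp (- a)) i"
    by (cases i) (simp_all add: phi_def del: fact_Suc)
qed

lemma X_phi_deriv: "fps_X * fps_deriv (phi a) = fps_exp (- a) - phi a"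
proof (rule fps_ext)
  fix i
  have "fps_nth (fps_X * fps_deriv (phi a)) i = of_nat i * fps_nth (phi a) i"
    by (cases i) (simp_all)
  also have "\<dots> = fps_nth (fps_exp (- a) - phi a) i"
    by (simp add: phi_def divide_simps) (simp add: algebra_simps)
  finally show "fps_nth (fps_X * fps_deriv (phi a)) i = fps_nth (fps_exp (- a) - phi a) i" .
qed

text \<open>
  The series \<open>ln (1 + z) / z\<close> and \<open>(ln (1 + z) - z) / z\<^sup>2\<close>. In Dynkin's series the sum over the number of
  blocks produces them, evaluated at \<open>exp (- (a + b) z) - 1\<close>.
\<close>

definition log_ser :: "real fps" where
  "log_ser = Abs_fps (\<lambda>k. (- 1) ^ k / real (k + 1))"

definition log_ser_tail :: "real fps" where
  "log_ser_tail = Abs_fps (\<lambda>k. (- 1) ^ (k + 1) / real (k + 2))"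

lemma X_log_ser: "fps_X * log_ser = fps_ln 1"
proof (rule fps_ext)
  fix i show "fps_nth (fps_X * log_ser) i = fps_nth (fps_ln 1) i"
    by (cases i) (simp_all add: log_ser_def fps_ln_nth)
qed

lemma X_log_ser_tail: "fps_X * log_ser_tail = log_ser - 1"
proof (rule fps_ext)
  fix i show "fps_nth (fps_X * log_ser_tail) i = fps_nth (log_ser - 1) i"
    by (cases i) (simp_all add: log_ser_def log_ser_tail_def)
qed

lemma ln_compose_exp: "fps_ln 1 oo (fps_exp c - 1) = fps_const c * (fps_X :: real fps)"
proof -
  let ?Z = "fps_exp c - 1 :: real fps"
  have Z0: "fps_nth ?Z 0 = 0" by simp
  have "(inverse (1 + fps_X) oo ?Z) * ((1 + fps_X) oo ?Z) = (inverse (1 + fps_X) * (1 + fps_X :: real fps)) oo ?Z"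
    by (simp add: fps_compose_mult_distrib[OF Z0])
  also have "\<dots> = 1" by (simp add: inverse_mult_eq_1)
  finally have *: "(inverse (1 + fps_X) oo ?Z) * fps_exp c = 1"
    by (simp add: fps_compose_add_distrib fps_X_fps_compose_startby0[OF Z0])
  have "fps_deriv (fps_ln 1 oo ?Z) = fps_deriv (fps_const c * fps_X)"
    using * by (simp add: fps_compose_deriv[OF Z0] fps_ln_deriv mult.left_commute)
  then show ?thesis unfolding fps_deriv_eq_iff by simp
qed

text \<open>
  For \<open>s \<noteq> 0\<close> this is \<open>ln (1 + (exp (- s z) - 1)) = - s z\<close>, divided by
  \<open>exp (- s z) - 1 = - s z * phi s\<close>.
\<close>

lemma log_ser_exp: "(log_ser oo (fps_exp (- s) - 1)) * phi s = 1"
proof (cases "s = 0")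
  case True
  then show ?thesis by (simp add: log_ser_def)
next
  case False
  let ?Z = "fps_exp (- s) - 1 :: real fps"
  have Z0: "fps_nth ?Z 0 = 0" by simp
  have Z: "?Z = - (fps_const s * (fps_X * phi s))" by (simp add: X_phi)
  have "?Z * (log_ser oo ?Z) = (fps_X * log_ser) oo ?Z"
    by (simp add: fps_compose_mult_distrib[OF Z0] fps_X_fps_compose_startby0[OF Z0])
  also have "\<dots> = fps_const (- s) * fps_X" unfolding X_log_ser by (rule ln_compose_exp)
  finally have "(fps_const s * fps_X) * ((log_ser oo ?Z) * phi s) = (fps_const s * fps_X) * 1"
    unfolding Z by (simp add: algebra_simps flip: fps_const_neg)
  then show ?thesis using False by (subst (asm) mult_left_cancel) auto
qed

lemma log_ser_tail_exp: "(fps_const s * fps_X) * (log_ser_tail oo (fps_exp (- s) - 1)) * (phi s * phi s) = phi s - 1"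
proof -
  let ?Z = "fps_exp (- s) - 1 :: real fps"
  have Z0: "fps_nth ?Z 0 = 0" by simp
  have Z: "?Z = - (fps_const s * (fps_X * phi s))" by (simp add: X_phi)
  have "?Z * (log_ser_tail oo ?Z) = (fps_X * log_ser_tail) oo ?Z"
    by (simp add: fps_compose_mult_distrib[OF Z0] fps_X_fps_compose_startby0[OF Z0])
  also have "\<dots> = (log_ser oo ?Z) - 1" unfolding X_log_ser_tail by (simp add: fps_compose_sub_distrib)
  finally have "?Z * (log_ser_tail oo ?Z) * phi s = 1 - phi s"
    using log_ser_exp[of s] by (simp add: left_diff_distrib)
  then have "- (?Z * (log_ser_tail oo ?Z) * phi s) = phi s - 1" by simp
  moreover have "- (?Z * (log_ser_tail oo ?Z) * phi s)
      = - ((- (fps_const s * (fps_X * phi s))) * (log_ser_tail oo ?Z) * phi s)"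
    using Z by presburger
  moreover have "\<dots> = (fps_const s * fps_X) * (log_ser_tail oo ?Z) * (phi s * phi s)"
    by (simp add: mult_ac)
  ultimately show ?thesis by simp
qed

text \<open>
  The generating function of Dynkin's series without the factors \<open>1 / degree\<close>; that this is what it
  generates is \<open>dynkin_gen_nth\<close>. The first summand comes from lists whose last block has degree at
  least 2, the second from lists whose last block is a single letter, so that the last bracket
  straddles two blocks.
\<close>

definition dynkin_gen :: "real \<Rightarrow> real \<Rightarrow> real fps" where
  "dynkin_gen a b = (let Z = fps_exp (- (a + b)) - 1 in
     fps_X\<^sup>2 * phi a * (log_ser oo Z)
   + fps_X\<^sup>2 * (phi a - fps_exp (- a) * phi b) * (log_ser_tail oo Z))"

text \<open>
  This is \<open>1 - exp (- (a + b) z) = (1 - exp (- a z)) + exp (- a z) (1 - exp (- b z))\<close>, divided by \<open>z\<close>.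
\<close>

lemma phi_add:
  "fps_const (a + b) * phi (a + b) = fps_const a * phi a + fps_const b * (fps_exp (- a) * phi b)"
proof -
  have "fps_X * (fps_const (a + b) * phi (a + b)) = 1 - fps_exp (- (a + b))"
    using X_phi[of "a+b"] by (simp add: mult_ac)
  also have "\<dots> = (1 - fps_exp (- a)) + fps_exp (- a) * (1 - fps_exp (- b))"
    by (simp add: algebra_simps flip: fps_exp_add_mult)
  also have "\<dots> = fps_X * (fps_const a * phi a + fps_const b * (fps_exp (- a) * phi b))"
    unfolding X_phi[symmetric] by (simp add: algebra_simps)
  finally show ?thesis by simp
qed

text \<open>
  The series \<open>K\<close> in \<open>x y = x + y + K(ad) [x, y]\<close>, up to a shift of the exponents.
\<close>

definition bch_ser :: "real \<Rightarrow> real \<Rightarrow> real fps" where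
  "bch_ser a b = Abs_fps (\<lambda>m. fps_nth (dynkin_gen a b) m / real m)"

lemma dynkin_gen_0 [simp]: "fps_nth (dynkin_gen a b) 0 = 0"
  by (simp add: dynkin_gen_def Let_def power2_eq_square)

lemma X_deriv_bch_ser: "fps_X * fps_deriv (bch_ser a b) = dynkin_gen a b"
proof (rule fps_ext)
  fix i show "fps_nth (fps_X * fps_deriv (bch_ser a b)) i = fps_nth (dynkin_gen a b) i"
    by (cases i) (simp_all add: bch_ser_def)
qed

text \<open>
  Multiplication by \<open>b\<close> or \<open>a\<close> is harmless because only \<open>K(ad) [x, y]\<close> is of interest, and \<open>[x, y]\<close> is
  linear in \<open>a\<close> and \<open>b\<close>. It avoids division by \<open>a\<close>, \<open>b\<close> and \<open>a + b\<close>, any of which may be 0.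
\<close>

lemma dynkin_gen_times:
  fixes a b :: real
  defines "P \<equiv> phi (a + b)"
  shows "dynkin_gen a b * (P * P) * fps_const b = fps_X *
     (fps_const b * fps_X * phi a * P + (phi a - P) * (P - 1))"
   and "dynkin_gen a b * (P * P) * fps_const a = fps_X *
     (fps_const a * fps_X * phi a * P + (P - fps_exp (- a) * phi b) * (P - 1))"
proof -
  let ?Z = "fps_exp (- (a + b)) - 1 :: real fps"
  define l1 where "l1 = log_ser oo ?Z"
  define l2 where "l2 = log_ser_tail oo ?Z"
  define e where "e = fps_exp (- a) * phi b"
  define A where "A = (fps_const a :: real fps)"
  define B where "B = (fps_const b :: real fps)"
  define F where "F = phi a"
  have 1: "l1 * P = 1" unfolding l1_def P_def by (rule log_ser_exp)
  have 2: "(A + B) * fps_X * l2 * (P * P) = P - 1"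
    using log_ser_tail_exp[of "a + b"] unfolding l2_def P_def A_def B_def by simp
  have 3: "(A + B) * P = A * F + B * e"
    using phi_add[of a b] unfolding e_def P_def A_def B_def F_def by simp
  have D: "dynkin_gen a b = fps_X\<^sup>2 * F * l1 + fps_X\<^sup>2 * (F - e) * l2"
    unfolding dynkin_gen_def Let_def l1_def l2_def e_def F_def ..
  have "(fps_X\<^sup>2 * F * l1 + fps_X\<^sup>2 * (F - e) * l2) * (P * P) * B
       = fps_X * (B * fps_X * F * P + (F - P) * (P - 1))"
    using 1 2 3 by algebra
  then show "dynkin_gen a b * (P * P) * fps_const b = fps_X *
     (fps_const b * fps_X * phi a * P + (phi a - P) * (P - 1))"
    unfolding D B_def F_def .
  have "(fps_X\<^sup>2 * F * l1 + fps_X\<^sup>2 * (F - e) * l2) * (P * P) * A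
       = fps_X * (A * fps_X * F * P + (P - e) * (P - 1))"
    using 1 2 3 by algebra
  then show "dynkin_gen a b * (P * P) * fps_const a = fps_X *
     (fps_const a * fps_X * phi a * P + (P - fps_exp (- a) * phi b) * (P - 1))"
    unfolding D A_def F_def e_def .
qed

text \<open>
  Both right-hand sides are read off from the expected group law. They are verified by comparing
  the Euler derivatives \<open>z d/dz\<close> of both sides after division by \<open>phi (a + b)\<close>: on the left these are
  multiples of \<open>dynkin_gen\<close>, on the right they follow from \<open>X_phi_deriv\<close>.
\<close>

lemma bch_ser_times_phi:
  "fps_const b * bch_ser a b * phi (a + b) = fps_X * (phi a - phi (a + b))" (is ?thesis1)
  "fps_const a * bch_ser a b * phi (a + b) = fps_X * (phi (a + b) - fps_exp (- a) * phi b)" (is ?thesis2)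
proof -
  define P where "P = phi (a + b)"
  define K where "K = bch_ser a b"
  define J where "J = inverse P"
  have JP: "J * P = 1" unfolding J_def P_def by (simp add: inverse_mult_eq_1)
  have P0: "P \<noteq> 0" unfolding P_def by (metis fps_zero_nth phi_nth_0 zero_neq_one)
  \<comment> \<open>Two series agree if their Euler derivatives and constant terms do.\<close>
  have uniq: "K1 = K2" if "fps_nth K1 0 = fps_nth K2 0"
     "fps_X * fps_deriv K1 * (P * P) = fps_X * fps_deriv K2 * (P * P)" for K1 K2 :: "real fps"
    using that P0 by (simp add: fps_deriv_eq_iff)
  have XP: "fps_X * fps_deriv P = fps_exp (- (a + b)) - P" 
    unfolding P_def by (rule X_phi_deriv)
  have JD: "fps_deriv J * (P * P) = - fps_deriv P"
  proof -
    have "fps_deriv (J * P) = 0" unfolding JP by simp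
    then have "fps_deriv J * P = - (J * fps_deriv P)" by (simp add: eq_neg_iff_add_eq_0 add.commute)
    then have "fps_deriv J * P * P = - (J * P * fps_deriv P)" by (simp add: mult_ac)
    then show ?thesis unfolding JP by (simp add: mult.assoc)
  qed
  define x :: "real fps" where "x = fps_X"
  have x': "fps_deriv x = 1" by (simp add: x_def)
  have x0: "fps_nth x 0 = 0" by (simp add: x_def)
  define F where "F = phi a"
  define A where "A = (fps_const a :: real fps)"
  define B where "B = (fps_const b :: real fps)"
  define e where "e = fps_exp (- a) * phi b"
  define Ea where "Ea = (fps_exp (- a) :: real fps)"
  define Es where "Es = (fps_exp (- (a + b)) :: real fps)"
  have AX: "A * (x * F) = 1 - Ea" unfolding A_def F_def Ea_def x_def by (rule X_phi)
  have SX: "(A + B) * (x * P) = 1 - Es" using X_phi[of "a + b"] unfolding A_def B_def P_def Es_def x_def by simp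
  have F': "x * fps_deriv F = Ea - F" unfolding F_def Ea_def x_def by (rule X_phi_deriv)
  have P': "x * fps_deriv P = Es - P" using XP unfolding Es_def x_def .
  have e': "x * fps_deriv e = Es - A * x * e - e"
  proof -
    have "x * fps_deriv e = fps_exp (- a) * (x * fps_deriv (phi b)) - A * x * e"
      unfolding e_def A_def by (simp add: algebra_simps flip: fps_const_neg)
    also have "\<dots> = Es - A * x * e - e"
      unfolding x_def X_phi_deriv Es_def e_def by (simp add: algebra_simps flip: fps_exp_add_mult)
    finally show ?thesis .
  qed
  have 3: "(A + B) * P = A * F + B * e"
    using phi_add[of a b] unfolding e_def P_def A_def B_def F_def by simp
  have XK: "x * fps_deriv K = dynkin_gen a b" unfolding K_def x_def by (rule X_deriv_bch_ser)
  have DB: "x * fps_deriv K * (P * P) * B = x * (B * x * F * P + (F - P) * (P - 1))"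
    unfolding XK using dynkin_gen_times(1)[of a b] unfolding P_def B_def F_def x_def .
  have DA: "x * fps_deriv K * (P * P) * A = x * (A * x * F * P + (P - e) * (P - 1))"
    unfolding XK using dynkin_gen_times(2)[of a b] unfolding P_def A_def F_def x_def e_def .
  have "B * K = x * (F * J - 1)"
  proof (rule uniq)
    show "fps_nth (B * K) 0 = fps_nth (x * (F * J - 1)) 0"
      unfolding K_def by (simp add: bch_ser_def x0)
    have "fps_deriv (x * (F * J - 1)) = F * J - 1 + x * (fps_deriv F * J + F * fps_deriv J)"
      by (simp add: x' algebra_simps)
    then have "fps_X * fps_deriv (x * (F * J - 1)) * (P * P)
        = x * (F * J - 1 + x * (fps_deriv F * J + F * fps_deriv J)) * (P * P)" 
      unfolding x_def by (rule arg_cong)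
    also have "\<dots> = x * (B * x * F * P + (F - P) * (P - 1))"
      using AX SX F' P' JP JD by algebra
    also have "\<dots> = fps_X * fps_deriv (B * K) * (P * P)"
      unfolding DB[symmetric] by (simp add: B_def x_def mult_ac)
    finally show "fps_X * fps_deriv (B * K) * (P * P) = fps_X * fps_deriv (x * (F * J - 1)) * (P * P)" ..
  qed
  then have "B * K * P = x * (F - P)" using JP by algebra
  then show ?thesis1 unfolding B_def K_def P_def x_def F_def .
  have "A * K = x * (1 - e * J)"
  proof (rule uniq)
    show "fps_nth (A * K) 0 = fps_nth (x * (1 - e * J)) 0"
      unfolding K_def by (simp add: bch_ser_def x0)
    have "fps_deriv (x * (1 - e * J)) = 1 - e * J - x * (fps_deriv e * J + e * fps_deriv J)"
      by (simp add: x' algebra_simps)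
    then have "fps_X * fps_deriv (x * (1 - e * J)) * (P * P)
        = x * (1 - e * J - x * (fps_deriv e * J + e * fps_deriv J)) * (P * P)" 
      unfolding x_def by (rule arg_cong)
    also have "\<dots> = x * (A * x * F * P + (P - e) * (P - 1))"
      using AX SX e' P' JP JD 3 by algebra
    also have "\<dots> = fps_X * fps_deriv (A * K) * (P * P)"
      unfolding DA[symmetric] by (simp add: A_def x_def mult_ac)
    finally show "fps_X * fps_deriv (A * K) * (P * P) = fps_X * fps_deriv (x * (1 - e * J)) * (P * P)" ..
  qed
  then have "A * K * P = x * (P - e)" using JP by algebra
  then show ?thesis2 unfolding A_def K_def P_def x_def e_def .
qed

section \<open>Dynkin's series in the filiform Lie algebra\<close>

text \<open>
  The component of a vector in the ideal spanned by \<open>X_2, X_3, \<dots>\<close>, as a power series in which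
  multiplication by the variable is the map \<open>X_i \<mapsto> [X_i, X_1]\<close>. Truncation at \<open>X_n\<close> is left to
  \<open>ideal_vec\<close>.
\<close>

definition hat :: "vec \<Rightarrow> real fps" where
  "hat x = Abs_fps (\<lambda>i. x (i + 2))"

definition ideal_vec :: "nat \<Rightarrow> real fps \<Rightarrow> vec" where
  "ideal_vec n f = (\<lambda>k. if 2 \<le> k \<and> k \<le> n then fps_nth f (k - 2) else 0)"

text \<open>
  The bracket \<open>[x, y]\<close> divided by the variable.
\<close>

definition ad_series :: "vec \<Rightarrow> vec \<Rightarrow> real fps" where
  "ad_series x y = fps_const (y 1) * hat x - fps_const (x 1) * hat y"

lemma lie_bracket_ideal:
  "lie_bracket n z (vscale c (ideal_vec n f)) = vscale (- z 1 * c) (ideal_vec n (fps_X * f))"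
proof
  fix k :: nat
  have "k \<le> 1 \<or> k = 2 \<or> k = (k - 3) + 3" by linarith
  then consider "k \<le> 1" | "k = 2" | j where "k = j + 3" by blast
  then show "lie_bracket n z (vscale c (ideal_vec n f)) k = vscale (- z 1 * c) (ideal_vec n (fps_X * f)) k"
    by cases (simp_all add: lie_bracket_def vscale_def ideal_vec_def numeral_3_eq_3 numeral_2_eq_2)
qed

lemma lie_bracket_hat: "lie_bracket n x y = ideal_vec n (fps_X * ad_series x y)"
proof
  fix k :: nat
  have "k \<le> 1 \<or> k = 2 \<or> k = (k - 3) + 3" by linarith
  then consider "k \<le> 1" | "k = 2" | j where "k = j + 3" by blast
  then show "lie_bracket n x y k = ideal_vec n (fps_X * ad_series x y) k"
    by cases (simp_all add: lie_bracket_def ad_series_def hat_def ideal_vec_def numeral_3_eq_3 numeral_2_eq_2)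
qed

lemma nested_bracket_Cons: "w \<noteq> [] \<Longrightarrow> nested_bracket n (z # w) = lie_bracket n z (nested_bracket n w)"
  by (cases w) simp_all

lemma nested_bracket_replicate_append:
  assumes "w \<noteq> []" "nested_bracket n w = vscale c (ideal_vec n f)"
  shows "nested_bracket n (replicate r z @ w) = vscale ((- z 1) ^ r * c) (ideal_vec n (fps_X ^ r * f))"
proof (induction r)
  case 0 then show ?case using assms by simp
next
  case (Suc r)
  then show ?case using assms(1) 
    by (simp add: nested_bracket_Cons lie_bracket_ideal mult.assoc)
qed

lemma nested_bracket_replicate:
  assumes "2 \<le> r" shows "nested_bracket n (replicate r z) = vscale 0 (ideal_vec n f)"
proof -
  obtain j where r: "r = j + 2" using assms by (metis add.commute le_Suc_ex)
  have w: "replicate r z = replicate j z @ [z, z]" unfolding r by (simp add: replicate_app_Cons_same)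
  have "nested_bracket n [z, z] = vscale 0 (ideal_vec n f)"
    by (auto simp: lie_bracket_def vscale_def)
  from nested_bracket_replicate_append[OF _ this, of j z] show ?thesis 
    unfolding w by (simp add: vscale_def)
qed

lemma nested_bracket_replicate_snoc:
  assumes "1 \<le> r"
  shows "nested_bracket n (replicate r x @ [y]) = vscale ((- x 1) ^ (r - 1)) (ideal_vec n (fps_X ^ r * ad_series x y))"
proof -
  obtain j where r: "r = Suc j" using assms by (cases r) auto
  have w: "replicate r x @ [y] = replicate j x @ [x, y]" unfolding r by (simp add: replicate_app_Cons_same)
  have "nested_bracket n [x, y] = vscale 1 (ideal_vec n (fps_X * ad_series x y))"
    by (simp add: lie_bracket_hat) (simp add: vscale_def)
  from nested_bracket_replicate_append[OF _ this, of j x] show ?thesis 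
    unfolding w by (simp add: r mult_ac)
qed

text \<open>
  The scalar by which the nested bracket of the word of a list differs from a shift of \<open>[x, y]\<close>, where
  \<open>a\<close> and \<open>b\<close> are the first coordinates of \<open>x\<close> and \<open>y\<close>. All letters but the last two contribute a factor
  \<open>- a\<close> or \<open>- b\<close>; the last two contribute \<open>1\<close>, \<open>- 1\<close> or \<open>0\<close> according to whether they are \<open>xy\<close>, \<open>yx\<close> or
  equal. In the third equation the last two letters straddle two blocks if the rest has degree 1.
\<close>

fun word_coeff :: "real \<Rightarrow> real \<Rightarrow> (nat \<times> nat) list \<Rightarrow> real" where
  "word_coeff a b [] = 0"
| "word_coeff a b [(r, s)] = (if s = 1 \<and> 1 \<le> r then (- a) ^ (r - 1) else 0)"
| "word_coeff a b ((r, s) # q # ps) =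
     (if bch_degree (q # ps) = 1
      then if q = (0, 1) then if s = 0 \<and> 1 \<le> r then (- a) ^ (r - 1) else 0
           else if 1 \<le> s then - ((- a) ^ r * (- b) ^ (s - 1)) else 0
      else (- a) ^ r * (- b) ^ s * word_coeff a b (q # ps))"

lemma bch_degree_Nil [simp]: "bch_degree [] = 0"
  and bch_degree_Cons [simp]: "bch_degree ((r, s) # ps) = r + s + bch_degree ps"
  by (simp_all add: bch_degree_def)

lemma bch_word_Nil [simp]: "bch_word x y [] = []"
  and bch_word_Cons [simp]: "bch_word x y ((r, s) # ps) = replicate r x @ replicate s y @ bch_word x y ps"
  by (simp_all add: bch_word_def)

lemma length_bch_word: "length (bch_word x y ps) = bch_degree ps"
  by (induction ps) auto

lemma length_le_bch_degree: "(0, 0) \<notin> set ps \<Longrightarrow> length ps \<le> bch_degree ps"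
proof (induction ps)
  case (Cons p ps)
  then show ?case by (cases p) (auto; fastforce)
qed simp

lemma bch_degree_1:
  assumes "(0, 0) \<notin> set ps" "bch_degree ps = 1"
  shows "ps = [(1, 0)] \<or> ps = [(0, 1)]"
proof -
  have "length ps = 1" using length_le_bch_degree[OF assms(1)] assms(2) by (cases ps) auto
  then obtain r s where "ps = [(r, s)]" by (metis One_nat_def length_0_conv length_Suc_conv old.prod.exhaust)
  then show ?thesis using assms by auto
qed

lemma nested_bracket_bch_word_single:
  assumes "2 \<le> r + s"
  shows "nested_bracket n (replicate r x @ replicate s y)
    = vscale (if s = 1 \<and> 1 \<le> r then (- x 1) ^ (r - 1) else 0) (ideal_vec n (fps_X ^ (r + s - 1) * ad_series x y))"
proof -
  consider "s = 0" | "s = 1" "1 \<le> r" | "2 \<le> s" using assms by linarith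
  then show ?thesis
  proof cases
    case 1
    then show ?thesis using assms nested_bracket_replicate by simp
  next
    case 2
    then show ?thesis using nested_bracket_replicate_snoc[of r n x y] by simp
  next
    case 3
    then have ne: "replicate s y \<noteq> []" by auto
    from nested_bracket_replicate_append[OF ne nested_bracket_replicate[OF 3], where r = r and z = x]
    show ?thesis using 3 by (simp add: vscale_def)
  qed
qed

text \<open>
  Once a bracket has been formed, it lies in the ideal spanned by \<open>X_3, \<dots>, X_n\<close>, on which bracketing
  with \<open>z\<close> from the left is the shift times \<open>- z 1\<close>. Hence only the innermost bracket matters.
\<close>

lemma nested_bracket_bch_word:
  assumes "(0, 0) \<notin> set ps" "2 \<le> bch_degree ps"
  shows "nested_bracket n (bch_word x y ps)
    = vscale (word_coeff (x 1) (y 1) ps) (ideal_vec n (fps_X ^ (bch_degree ps - 1) * ad_series x y))"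
  using assms
proof (induction "x 1" "y 1" ps rule: word_coeff.induct)
  case 1 then show ?case by simp
next
  case (2 r s)
  then show ?case using nested_bracket_bch_word_single[of r s n x y] by simp
next
  case (3 r s q ps)
  let ?a = "x 1" and ?b = "y 1"
  have z: "(0,0) \<notin> set (q # ps)" using 3 by simp
  show ?case
  proof (cases "bch_degree (q # ps) = 1")
    case False
    have d: "2 \<le> bch_degree (q # ps)" using False length_le_bch_degree[OF z] by simp
    have ne: "bch_word x y (q # ps) \<noteq> []" using length_bch_word[of x y "q # ps"] d by auto
    have IH: "nested_bracket n (bch_word x y (q # ps))
       = vscale (word_coeff ?a ?b (q # ps)) (ideal_vec n (fps_X ^ (bch_degree (q # ps) - 1) * ad_series x y))"
      using 3(1)[OF False z d] .
    have ne2: "replicate s y @ bch_word x y (q # ps) \<noteq> []" using ne by simp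
    have e: "r + s + bch_degree (q # ps) - 1 = r + (s + (bch_degree (q # ps) - 1))" using d by simp
    have "nested_bracket n (replicate r x @ replicate s y @ bch_word x y (q # ps)) = 
      vscale ((- ?a) ^ r * ((- ?b) ^ s * word_coeff ?a ?b (q # ps)))
        (ideal_vec n (fps_X ^ (r + (s + (bch_degree (q # ps) - 1))) * ad_series x y))"
      using nested_bracket_replicate_append[OF ne2 nested_bracket_replicate_append[OF ne IH]]
      by (simp only: power_add mult.assoc)
    then show ?thesis using False e by (simp only: bch_word_Cons word_coeff.simps bch_degree_Cons if_False mult.assoc)
  next
    case True
    from bch_degree_1[OF z True] consider (x) "q = (1, 0)" "ps = []" | (y) "q = (0, 1)" "ps = []" by auto
    then show ?thesis
    proof cases
      case y
      have "replicate s y @ [y] = replicate (Suc s) y" by (simp add: replicate_append_same)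
      then have w: "bch_word x y ((r, s) # q # ps) = replicate r x @ replicate (Suc s) y" using y by simp
      have d: "2 \<le> r + Suc s" using 3(3) y by simp
      show ?thesis unfolding w nested_bracket_bch_word_single[OF d] using y by simp
    next
      case x
      show ?thesis
      proof (cases "s = 0")
        case True
        have "replicate r x @ [x] = replicate (Suc r) x" by (simp add: replicate_append_same)
        then have w: "bch_word x y ((r, s) # q # ps) = replicate (Suc r) x" using x True by simp
        have d: "2 \<le> Suc r" using 3(3) x True by simp
        show ?thesis unfolding w using x True nested_bracket_replicate[OF d] by simp
      next
        case False
        have sw: "ad_series y x = - ad_series x y" by (simp add: ad_series_def)
        have neg: "vscale c (ideal_vec n (- f)) = vscale (- c) (ideal_vec n f)" for c f
          by (auto simp: vscale_def ideal_vec_def)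
        have "nested_bracket n (replicate s y @ [x])
          = vscale (- ((- ?b) ^ (s - 1))) (ideal_vec n (fps_X ^ s * ad_series x y))"
          using False by (simp add: nested_bracket_replicate_snoc sw neg)
        from nested_bracket_replicate_append[OF _ this, of r x]
        show ?thesis using x False by (simp add: power_add mult.assoc)
      qed
    qed
  qed
qed

definition bch_lists :: "nat \<Rightarrow> nat \<Rightarrow> (nat \<times> nat) list set" where
  "bch_lists l m = {ps. length ps = l \<and> (0, 0) \<notin> set ps \<and> bch_degree ps = m}"

lemma finite_bch_lists [simp]: "finite (bch_lists l m)"
proof (rule finite_subset)
  show "bch_lists l m \<subseteq> insert [] (bch_indices (m + 1))"
    by (auto simp: bch_lists_def bch_indices_def)
  show "finite (insert [] (bch_indices (m + 1)))" by (simp add: finite_bch_indices)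
qed

lemma sum_bch_lists_Suc:
  "(\<Sum>ps\<in>bch_lists (Suc l) m. f ps) = (\<Sum>i=1..m. \<Sum>j=0..i. \<Sum>qs\<in>bch_lists l (m - i). f ((j, i - j) # qs))"
proof -
  have "(\<Sum>i=1..m. \<Sum>j=0..i. \<Sum>qs\<in>bch_lists l (m - i). f ((j, i - j) # qs))
     = (\<Sum>(i, j, qs)\<in>(SIGMA i:{1..m}. {0..i} \<times> bch_lists l (m - i)). f ((j, i - j) # qs))"
    by (simp add: sum.Sigma sum.cartesian_product)
  also have "\<dots> = (\<Sum>ps\<in>bch_lists (Suc l) m. f ps)"
    by (rule sum.reindex_bij_witness[where j = "\<lambda>(i, j, qs). (j, i - j) # qs"
          and i = "\<lambda>ps. (fst (hd ps) + snd (hd ps), fst (hd ps), tl ps)"])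
       (auto simp: bch_lists_def length_Suc_conv)
  finally show ?thesis ..
qed

definition bch_wt :: "(nat \<times> nat) list \<Rightarrow> real" where
  "bch_wt ps = (\<Prod>(r, s)\<leftarrow>ps. 1 / (fact r * fact s))"

lemma bch_wt_Nil [simp]: "bch_wt [] = 1"
  and bch_wt_Cons [simp]: "bch_wt ((r, s) # ps) = 1 / (fact r * fact s) * bch_wt ps"
  by (simp_all add: bch_wt_def)

lemma bch_coeff_wt: "bch_coeff ps = (- 1) ^ (length ps - 1) / (real (length ps) * real (bch_degree ps)) * bch_wt ps"
proof -
  have "(\<Prod>(r, s)\<leftarrow>ps. fact r * fact s) * bch_wt ps = (1::real)"
    by (induction ps) auto
  then have "bch_wt ps = 1 / (\<Prod>(r, s)\<leftarrow>ps. fact r * fact s)"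
    by (metis mult_zero_left nonzero_mult_div_cancel_left zero_neq_one)
  then show ?thesis unfolding bch_coeff_def by simp
qed

text \<open>
  The generating function, by degree, of the contributions of the index lists of length \<open>l\<close>.
\<close>

definition length_gen :: "real \<Rightarrow> real \<Rightarrow> nat \<Rightarrow> real fps" where
  "length_gen a b l = Abs_fps (\<lambda>m. \<Sum>ps\<in>bch_lists l m. bch_wt ps * word_coeff a b ps)"

lemma bch_lists_0: "bch_lists 0 m = (if m = 0 then {[]} else {})"
  by (auto simp: bch_lists_def)

lemma length_gen_1: "length_gen a b (Suc 0) = fps_X\<^sup>2 * phi a"
proof (rule fps_ext)
  fix m
  have *: "fps_nth (length_gen a b (Suc 0)) m = (\<Sum>i=1..m. \<Sum>j=0..i. \<Sum>qs\<in>bch_lists 0 (m - i). bch_wt ((j, i - j) # qs) * word_coeff a b ((j, i - j) # qs))"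
    unfolding length_gen_def fps_nth_Abs_fps by (rule sum_bch_lists_Suc)
  show "fps_nth (length_gen a b (Suc 0)) m = fps_nth (fps_X\<^sup>2 * phi a) m"
  proof (cases "m = 0")
    case True then show ?thesis unfolding * by simp
  next
    case False
    have "fps_nth (length_gen a b (Suc 0)) m = (\<Sum>i\<in>{m}. \<Sum>j=0..i. \<Sum>qs\<in>bch_lists 0 (m - i). bch_wt ((j, i - j) # qs) * word_coeff a b ((j, i - j) # qs))"
      unfolding * using False by (intro sum.mono_neutral_right) (auto simp: bch_lists_0)
    also have "\<dots> = (\<Sum>j=0..m. bch_wt [(j, m - j)] * word_coeff a b [(j, m - j)])"
      by (simp add: bch_lists_0)
    also have "\<dots> = (\<Sum>j\<in>{m - 1}. bch_wt [(j, m - j)] * word_coeff a b [(j, m - j)])"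
      using False by (intro sum.mono_neutral_right) auto
    also have "\<dots> = fps_nth (fps_X\<^sup>2 * phi a) m"
    proof -
      consider "m = 1" | j where "m = Suc (Suc j)" using False by (metis One_nat_def not0_implies_Suc)
      then show ?thesis
        by cases (simp_all add: phi_def fps_X_power_mult_nth del: fact_Suc)
    qed
    finally show ?thesis .
  qed
qed

text \<open>
  Prepending a block to a list multiplies the coefficient by powers of \<open>- a\<close> and \<open>- b\<close>, except when
  the list is a single letter; the defect is the contribution in that case.
\<close>

definition word_coeff_defect :: "real \<Rightarrow> real \<Rightarrow> nat \<times> nat \<Rightarrow> (nat \<times> nat) list \<Rightarrow> real" where
  "word_coeff_defect a b p qs = (if qs = [(0, 1)] then if snd p = 0 \<and> 1 \<le> fst p then (- a) ^ (fst p - 1) else 0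
           else if qs = [(1, 0)] then if 1 \<le> snd p then - ((- a) ^ fst p * (- b) ^ (snd p - 1)) else 0
           else 0)"

lemma word_coeff_Cons:
  assumes "qs \<in> bch_lists (Suc l) m"
  shows "word_coeff a b ((r, s) # qs) = (- a) ^ r * (- b) ^ s * word_coeff a b qs + word_coeff_defect a b (r, s) qs"
proof -
  obtain q ps where qs: "qs = q # ps" using assms by (auto simp: bch_lists_def length_Suc_conv)
  have z: "(0, 0) \<notin> set qs" using assms by (simp add: bch_lists_def)
  show ?thesis
  proof (cases "bch_degree qs = 1")
    case True
    from bch_degree_1[OF z True] show ?thesis by (auto simp: word_coeff_defect_def)
  next
    case False
    then have "qs \<noteq> [(1, 0)]" "qs \<noteq> [(0, 1)]" by auto
    then have "word_coeff_defect a b (r, s) qs = 0" by (simp only: word_coeff_defect_def if_False)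
    moreover have "word_coeff a b ((r, s) # qs) = (- a) ^ r * (- b) ^ s * word_coeff a b qs" using False qs by simp
    ultimately show ?thesis by simp
  qed
qed

lemma exp_minus_one_nth:
  "fps_nth (fps_exp (- (a + b)) - 1 :: real fps) i
    = (if i = 0 then 0 else \<Sum>j=0..i. 1 / (fact j * fact (i - j)) * ((- a) ^ j * (- b) ^ (i - j)))"
proof -
  have "fps_exp (- (a + b)) = fps_exp (- a) * (fps_exp (- b) :: real fps)"
    by (simp flip: fps_exp_add_mult)
  then show ?thesis by (simp add: fps_mult_nth mult_ac)
qed

lemma bch_lists_Suc_1: "bch_lists (Suc l) 1 = (if l = 0 then {[(1, 0)], [(0, 1)]} else {})"
proof -
  have "ps = [(1, 0)] \<or> ps = [(0, 1)]" if "ps \<in> bch_lists (Suc l) 1" for ps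
    using bch_degree_1 that unfolding bch_lists_def by blast
  then have "bch_lists (Suc l) 1 \<subseteq> {[(1, 0)], [(0, 1)]}" by blast
  moreover have "[(1, 0)] \<in> bch_lists (Suc l) 1 \<longleftrightarrow> l = 0" "[(0, 1)] \<in> bch_lists (Suc l) 1 \<longleftrightarrow> l = 0"
    by (auto simp: bch_lists_def)
  ultimately show ?thesis by auto
qed

lemma sum_word_coeff_defect:
  assumes "0 < i"
  shows "(\<Sum>j=0..i. \<Sum>qs\<in>{[(1, 0)], [(0, 1)]}. bch_wt ((j, i - j) # qs) * word_coeff_defect a b (j, i - j) qs)
    = fps_nth (fps_X\<^sup>2 * (phi a - fps_exp (- a) * phi b)) (Suc i)"
proof -
  have wt: "bch_wt [p, (1,0)] = bch_wt [p]" "bch_wt [p, (0,1)] = bch_wt [p]" for p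
    by (simp_all add: bch_wt_def)
  obtain h where i: "i = Suc h" using assms by (cases i) auto
  have "(\<Sum>j=0..i. \<Sum>qs\<in>{[(1, 0)], [(0, 1)]}. bch_wt ((j, i - j) # qs) * word_coeff_defect a b (j, i - j) qs)
      = (\<Sum>j=0..i. bch_wt [(j, i - j)] * word_coeff_defect a b (j, i - j) [(1,0)])
       + (\<Sum>j=0..i. bch_wt [(j, i - j)] * word_coeff_defect a b (j, i - j) [(0,1)])"
    by (simp add: sum.distrib wt del: bch_wt_Cons One_nat_def)
  also have "(\<Sum>j=0..i. bch_wt [(j, i - j)] * word_coeff_defect a b (j, i - j) [(0,1)])
      = (\<Sum>j\<in>{i}. bch_wt [(j, i - j)] * word_coeff_defect a b (j, i - j) [(0,1)])"
    by (intro sum.mono_neutral_right) (auto simp: word_coeff_defect_def)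
  also have "\<dots> = fps_nth (phi a) h" by (simp add: word_coeff_defect_def phi_def i del: fact_Suc)
  also have "(\<Sum>j=0..i. bch_wt [(j, i - j)] * word_coeff_defect a b (j, i - j) [(1,0)])
      = (\<Sum>j=0..h. bch_wt [(j, i - j)] * word_coeff_defect a b (j, i - j) [(1,0)])"
    by (intro sum.mono_neutral_right) (auto simp: word_coeff_defect_def i)
  also have "\<dots> = - fps_nth (fps_exp (- a) * phi b) h"
    unfolding fps_mult_nth sum_negf[symmetric]
    by (intro sum.cong refl) (simp add: word_coeff_defect_def i phi_def Suc_diff_le del: fact_Suc)
  finally show ?thesis by (simp add: i fps_X_power_mult_nth)
qed

text \<open>
  Splitting off the first block, which is summed over all pairs of exponents other than \<open>(0, 0)\<close>,
  amounts to multiplication by \<open>exp (- a z) exp (- b z) - 1\<close>.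
\<close>

lemma length_gen_Suc:
  "length_gen a b (Suc (Suc l)) = (fps_exp (- (a + b)) - 1) * length_gen a b (Suc l)
     + (if l = 0 then fps_X\<^sup>2 * (phi a - fps_exp (- a) * phi b) else 0)"
proof (rule fps_ext)
  fix m
  let ?Z = "fps_exp (- (a + b)) - 1 :: real fps" and ?R = "fps_X\<^sup>2 * (phi a - fps_exp (- a) * phi b)"
  have "fps_nth (length_gen a b (Suc (Suc l))) m
    = (\<Sum>i=1..m. \<Sum>j=0..i. \<Sum>qs\<in>bch_lists (Suc l) (m - i). bch_wt ((j, i - j) # qs) * word_coeff a b ((j, i - j) # qs))"
    unfolding length_gen_def fps_nth_Abs_fps by (rule sum_bch_lists_Suc)
  also have "\<dots> = (\<Sum>i=1..m. \<Sum>j=0..i. \<Sum>qs\<in>bch_lists (Suc l) (m - i).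
        1 / (fact j * fact (i - j)) * ((- a) ^ j * (- b) ^ (i - j)) * (bch_wt qs * word_coeff a b qs)
         + bch_wt ((j, i - j) # qs) * word_coeff_defect a b (j, i - j) qs)"
    by (intro sum.cong refl) (simp add: word_coeff_Cons algebra_simps)
  also have "\<dots> = (\<Sum>i=1..m. (\<Sum>j=0..i. 1 / (fact j * fact (i - j)) * ((- a) ^ j * (- b) ^ (i - j))) * fps_nth (length_gen a b (Suc l)) (m - i))
      + (\<Sum>i=1..m. \<Sum>j=0..i. \<Sum>qs\<in>bch_lists (Suc l) (m - i). bch_wt ((j, i - j) # qs) * word_coeff_defect a b (j, i - j) qs)"
    (is "_ = ?S1 + ?S2")
    unfolding length_gen_def fps_nth_Abs_fps sum.distrib sum_product by simp
  also have "?S1 = fps_nth (?Z * length_gen a b (Suc l)) m"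
  proof -
    have "fps_nth (?Z * V) m = (\<Sum>i=1..m. (\<Sum>j=0..i. 1 / (fact j * fact (i - j)) * ((- a) ^ j * (- b) ^ (i - j))) * fps_nth V (m - i))" for V
      unfolding fps_mult_nth exp_minus_one_nth by (intro sum.mono_neutral_cong_right) auto
    then show ?thesis ..
  qed
  also have "?S2 = fps_nth (if l = 0 then ?R else 0) m"
  proof (cases "2 \<le> m")
    case False
    have "?S2 = 0"
    proof (intro sum.neutral ballI)
      fix i j qs assume "i \<in> {1..m}" "qs \<in> bch_lists (Suc l) (m - i)"
      then have "bch_degree qs = 0" "(0,0) \<notin> set qs" "qs \<noteq> []" using False by (auto simp: bch_lists_def)
      then have False using length_le_bch_degree[of qs] by simp
      then show "bch_wt ((j, i - j) # qs) * word_coeff_defect a b (j, i - j) qs = 0" ..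
    qed
    then show ?thesis using False by (simp add: fps_X_power_mult_nth)
  next
    case True
    then obtain i where m: "m = Suc i" "0 < i" by (cases m) auto
    have "?S2 = (\<Sum>i\<in>{i}. \<Sum>j=0..i. \<Sum>qs\<in>bch_lists (Suc l) (m - i). bch_wt ((j, i - j) # qs) * word_coeff_defect a b (j, i - j) qs)"
    proof (rule sum.mono_neutral_right)
      show "\<forall>h\<in>{1..m} - {i}. (\<Sum>j=0..h. \<Sum>qs\<in>bch_lists (Suc l) (m - h). bch_wt ((j, h - j) # qs) * word_coeff_defect a b (j, h - j) qs) = 0"
      proof (intro ballI sum.neutral)
        fix h j qs assume "h \<in> {1..m} - {i}" "qs \<in> bch_lists (Suc l) (m - h)"
        then have "bch_degree qs \<noteq> 1" using m by (auto simp: bch_lists_def)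
        then have "word_coeff_defect a b (j, h - j) qs = 0" by (auto simp: word_coeff_defect_def)
        then show "bch_wt ((j, h - j) # qs) * word_coeff_defect a b (j, h - j) qs = 0" by simp
      qed
    qed (use m in auto)
    also have "\<dots> = fps_nth (if l = 0 then ?R else 0) m"
    proof (cases "l = 0")
      case True
      have "bch_lists (Suc l) (m - i) = {[(1, 0)], [(0, 1)]}" using m True bch_lists_Suc_1[of l] by simp
      then show ?thesis using sum_word_coeff_defect[OF m(2), of a b] True m(1) by simp
    next
      case False
      have "bch_lists (Suc l) (m - i) = {}" using m False bch_lists_Suc_1[of l] by simp
      then show ?thesis using False by simp
    qed
    finally show ?thesis .
  qed
  finally show "fps_nth (length_gen a b (Suc (Suc l))) m = fps_nth (?Z * length_gen a b (Suc l) + (if l = 0 then ?R else 0)) m"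
    by (simp only: fps_add_nth)
qed

lemma length_gen_closed:
  "length_gen a b (Suc l) = (fps_exp (- (a + b)) - 1) ^ l * (fps_X\<^sup>2 * phi a)
     + (if l = 0 then 0 else (fps_exp (- (a + b)) - 1) ^ (l - 1) * (fps_X\<^sup>2 * (phi a - fps_exp (- a) * phi b)))"
proof (induction l)
  case 0 show ?case by (simp add: length_gen_1)
next
  case (Suc l)
  have *: "Z * (Z ^ l * A + (if l = 0 then 0 else Z ^ (l - 1) * B)) + (if l = 0 then B else 0)
      = Z ^ Suc l * A + Z ^ l * B" for Z A B :: "real fps"
    by (cases l) (simp_all add: distrib_left mult.assoc)
  show ?case unfolding length_gen_Suc Suc by (simp only: * nat.simps if_False diff_Suc_1)
qed

lemma fps_compose_mult_nth:
  fixes A Z V :: "real fps"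
  assumes "fps_nth Z 0 = 0" "m \<le> M"
  shows "fps_nth ((A oo Z) * V) m = (\<Sum>j=0..M. fps_nth A j * fps_nth (Z ^ j * V) m)"
proof -
  have nz: "fps_nth (Z ^ j) i = 0" if "i < j" for i j
    using that assms(1) by (rule startsby_zero_power_prefix[rule_format, rotated])
  have "fps_nth (A oo Z) i = (\<Sum>j=0..M. fps_nth A j * fps_nth (Z ^ j) i)" if "i \<le> m" for i
    unfolding fps_compose_nth using that assms(2) by (intro sum.mono_neutral_left) (auto simp: nz)
  then have "fps_nth ((A oo Z) * V) m = (\<Sum>i=0..m. (\<Sum>j=0..M. fps_nth A j * fps_nth (Z ^ j) i) * fps_nth V (m - i))"
    unfolding fps_mult_nth by (intro sum.cong) auto
  also have "\<dots> = (\<Sum>j=0..M. fps_nth A j * fps_nth (Z ^ j * V) m)"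
    unfolding fps_mult_nth sum_distrib_right sum_distrib_left
    by (subst sum.swap) (simp add: mult.assoc)
  finally show ?thesis .
qed

lemma dynkin_gen_nth:
  assumes "m \<le> M"
  shows "fps_nth (dynkin_gen a b) m = (\<Sum>l=0..Suc M. (- 1) ^ l / real (l + 1) * fps_nth (length_gen a b (Suc l)) m)"
proof -
  let ?Z = "fps_exp (- (a + b)) - 1 :: real fps" and ?R = "fps_X\<^sup>2 * (phi a - fps_exp (- a) * phi b)"
  have Z0: "fps_nth ?Z 0 = 0" by simp
  have "(\<Sum>l=0..Suc M. (- 1) ^ l / real (l + 1) * fps_nth (length_gen a b (Suc l)) m)
     = (\<Sum>l=0..Suc M. (- 1) ^ l / real (l + 1) * fps_nth (?Z ^ l * (fps_X\<^sup>2 * phi a)) m)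
     + (\<Sum>l=0..Suc M. (- 1) ^ l / real (l + 1) * fps_nth (if l = 0 then 0 else ?Z ^ (l - 1) * ?R) m)"
    unfolding length_gen_closed by (simp only: fps_add_nth distrib_left sum.distrib)
  also have "(\<Sum>l=0..Suc M. (- 1) ^ l / real (l + 1) * fps_nth (?Z ^ l * (fps_X\<^sup>2 * phi a)) m)
      = fps_nth ((log_ser oo ?Z) * (fps_X\<^sup>2 * phi a)) m"
    using assms by (subst fps_compose_mult_nth[OF Z0, of m "Suc M"]) (auto simp: log_ser_def)
  also have "(\<Sum>l=0..Suc M. (- 1) ^ l / real (l + 1) * fps_nth (if l = 0 then 0 else ?Z ^ (l - 1) * ?R) m)
     = (\<Sum>l=0..M. (- 1) ^ (Suc l) / real (Suc l + 1) * fps_nth (?Z ^ l * ?R) m)"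
    by (subst sum.atLeast0_atMost_Suc_shift) simp
  also have "\<dots> = fps_nth ((log_ser_tail oo ?Z) * ?R) m"
    using assms by (subst fps_compose_mult_nth[OF Z0, of m M]) (auto simp: log_ser_tail_def add_ac)
  finally show ?thesis unfolding dynkin_gen_def Let_def by (simp add: mult_ac)
qed

section \<open>The group law in coordinates of the second kind\<close>

lemma bch_indices_decomp:
  "bch_indices n = (\<Union>(m, l)\<in>{1..n - 1} \<times> {0..n}. bch_lists (Suc l) m)"
proof (intro equalityI subsetI)
  fix ps assume ps: "ps \<in> bch_indices n"
  then have *: "ps \<noteq> []" "(0, 0) \<notin> set ps" "bch_degree ps \<le> n - 1" by (auto simp: bch_indices_def)
  have "length ps \<le> bch_degree ps" using *(2) by (rule length_le_bch_degree)
  moreover have "length ps \<ge> 1" using *(1) by (cases ps) auto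
  ultimately have "ps \<in> bch_lists (Suc (length ps - 1)) (bch_degree ps)" 
    "(bch_degree ps, length ps - 1) \<in> {1..n - 1} \<times> {0..n}"
    using * by (auto simp: bch_lists_def)
  then show "ps \<in> (\<Union>(m, l)\<in>{1..n - 1} \<times> {0..n}. bch_lists (Suc l) m)" by blast
next
  fix ps assume "ps \<in> (\<Union>(m, l)\<in>{1..n - 1} \<times> {0..n}. bch_lists (Suc l) m)"
  then show "ps \<in> bch_indices n" by (auto simp: bch_lists_def bch_indices_def)
qed

lemma bch_lists_unique: "ps \<in> bch_lists l m \<Longrightarrow> ps \<in> bch_lists l' m' \<Longrightarrow> l = l' \<and> m = m'"
  by (auto simp: bch_lists_def)

lemma sum_bch_indices:
  "(\<Sum>ps\<in>bch_indices n. f ps) = (\<Sum>m=1..n - 1. \<Sum>l=0..n. \<Sum>ps\<in>bch_lists (Suc l) m. f ps)"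
proof -
  have "(\<Sum>ps\<in>bch_indices n. f ps) = (\<Sum>(m, l)\<in>{1..n - 1} \<times> {0..n}. \<Sum>ps\<in>bch_lists (Suc l) m. f ps)"
    unfolding bch_indices_decomp
    by (subst sum.UNION_disjoint) (auto simp: split_def dest: bch_lists_unique)
  then show ?thesis by (simp add: sum.cartesian_product)
qed

lemma bch_ser_1 [simp]: "fps_nth (bch_ser a b) (Suc 0) = 0"
  by (simp add: bch_ser_def dynkin_gen_def Let_def fps_X_power_mult_nth mult.assoc)

lemma sum_bch_lists_degree_1:
  "(\<Sum>l=0..n. \<Sum>ps\<in>bch_lists (Suc l) 1. bch_coeff ps * nested_bracket n (bch_word x y ps) k) = x k + y k"
proof -
  have "(\<Sum>l=0..n. \<Sum>ps\<in>bch_lists (Suc l) 1. bch_coeff ps * nested_bracket n (bch_word x y ps) k)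
    = (\<Sum>l\<in>{0}. \<Sum>ps\<in>bch_lists (Suc l) 1. bch_coeff ps * nested_bracket n (bch_word x y ps) k)"
    by (intro sum.mono_neutral_right ballI) (auto simp: bch_lists_Suc_1 simp del: One_nat_def)
  also have "\<dots> = x k + y k" 
    by (simp add: bch_lists_Suc_1 bch_coeff_def del: One_nat_def) (simp add: bch_degree_def)
  finally show ?thesis .
qed

lemma sum_bch_lists_degree_ge_2:
  assumes "2 \<le> m" "m \<le> n - 1"
  shows "(\<Sum>l=0..n. \<Sum>ps\<in>bch_lists (Suc l) m. bch_coeff ps * nested_bracket n (bch_word x y ps) k)
    = fps_nth (bch_ser (x 1) (y 1)) m * ideal_vec n (fps_X ^ (m - 1) * ad_series x y) k"
proof -
  let ?V = "ideal_vec n (fps_X ^ (m - 1) * ad_series x y) k"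
  have "bch_coeff ps * nested_bracket n (bch_word x y ps) k
     = (- 1) ^ l / real (l + 1) * (bch_wt ps * word_coeff (x 1) (y 1) ps) * (?V / real m)" 
    if "ps \<in> bch_lists (Suc l) m" for l ps
  proof -
    have ps: "(0, 0) \<notin> set ps" "bch_degree ps = m" "length ps = Suc l" using that by (auto simp: bch_lists_def)
    then show ?thesis using assms(1)
      by (simp add: nested_bracket_bch_word bch_coeff_wt vscale_def)
  qed
  then have "(\<Sum>l=0..n. \<Sum>ps\<in>bch_lists (Suc l) m. bch_coeff ps * nested_bracket n (bch_word x y ps) k)
    = (\<Sum>l=0..n. \<Sum>ps\<in>bch_lists (Suc l) m. (- 1) ^ l / real (l + 1) * (bch_wt ps * word_coeff (x 1) (y 1) ps) * (?V / real m))"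
    by (intro sum.cong refl) blast
  also have "\<dots> = (\<Sum>l=0..n. (- 1) ^ l / real (l + 1) * fps_nth (length_gen (x 1) (y 1) (Suc l)) m) * (?V / real m)"
    unfolding length_gen_def fps_nth_Abs_fps by (simp add: sum_distrib_left sum_distrib_right mult_ac)
  also have "\<dots> = fps_nth (dynkin_gen (x 1) (y 1)) m * (?V / real m)"
    using dynkin_gen_nth[OF assms(2), of "x 1" "y 1"] assms by simp
  finally show ?thesis by (simp add: bch_ser_def)
qed

text \<open>
  In degree 1 Dynkin's series contributes \<open>x + y\<close>, in higher degrees the multiples of shifts of
  \<open>[x, y]\<close> that are collected in \<open>bch_ser\<close>.
\<close>

lemma gmult_bch_ser:
  assumes "n \<ge> 2"
  shows "gmult n x y k = x k + y k + ideal_vec n (fps_shift 1 (bch_ser (x 1) (y 1)) * ad_series x y) k"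
proof -
  let ?K = "bch_ser (x 1) (y 1)"
  have "gmult n x y k = x k + y k + (\<Sum>m=2..n - 1. fps_nth ?K m * ideal_vec n (fps_X ^ (m - 1) * ad_series x y) k)"
    unfolding gmult_def sum_bch_indices
    using assms by (simp add: sum.atLeast_Suc_atMost[of "Suc 0" "n - Suc 0"] sum_bch_lists_degree_1[unfolded One_nat_def])
       (intro sum.cong, auto simp: sum_bch_lists_degree_ge_2[unfolded One_nat_def])
  also have "(\<Sum>m=2..n - 1. fps_nth ?K m * ideal_vec n (fps_X ^ (m - 1) * ad_series x y) k)
     = ideal_vec n (fps_shift 1 ?K * ad_series x y) k"
  proof (cases "2 \<le> k \<and> k \<le> n")
    case False then show ?thesis by (auto simp: ideal_vec_def)
  next
    case True
    have z: "fps_nth (bch_ser a b) i = 0" if "Suc 0 \<le> i" "\<not> 2 \<le> i" for a b i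
    proof -
      have "i = Suc 0" using that by simp
      then show ?thesis by simp
    qed
    have "(\<Sum>m=2..n - 1. fps_nth ?K m * ideal_vec n (fps_X ^ (m - 1) * ad_series x y) k)
      = (\<Sum>m=1..k - 1. fps_nth ?K m * fps_nth (ad_series x y) (k - 2 - (m - 1)))"
      using True by (intro sum.mono_neutral_cong) (auto simp: ideal_vec_def fps_X_power_mult_nth z)
    also have "\<dots> = (\<Sum>j=0..k - 2. fps_nth ?K (j + 1) * fps_nth (ad_series x y) (k - 2 - j))"
      using True by (intro sum.reindex_bij_witness[of _ "\<lambda>j. j + 1" "\<lambda>m. m - 1"]) auto
    also have "\<dots> = ideal_vec n (fps_shift 1 ?K * ad_series x y) k"
      using True by (simp add: ideal_vec_def fps_mult_nth)
    finally show ?thesis .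
  qed
  finally show ?thesis .
qed

text \<open>
  The coordinates of the second kind other than the first: the group element \<open>x\<close> is the product of
  the exponential of this series, viewed in the ideal, and of \<open>exp (x 1 X_1)\<close>. Only the coefficients
  up to \<open>n - 2\<close> are meaningful; \<open>of_sk\<close> ignores the others.
\<close>

definition sk :: "vec \<Rightarrow> real fps" where
  "sk x = phi (x 1) * hat x"

definition of_sk :: "nat \<Rightarrow> real \<Rightarrow> real fps \<Rightarrow> vec" where
  "of_sk n a p = (\<lambda>k. if k = 1 then a else ideal_vec n (inverse (phi a) * p) k)"

lemma phi_inverse: "inverse (phi a) * phi a = 1"
  by (simp add: inverse_mult_eq_1)

lemma phi_inverse': "phi a * inverse (phi a) = 1"
  by (simp add: inverse_mult_eq_1')

lemma of_sk_1 [simp]: "of_sk n a p 1 = a" "of_sk n a p (Suc 0) = a"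
  by (simp_all add: of_sk_def)

lemma of_sk_filiform: "n \<ge> 1 \<Longrightarrow> of_sk n a p \<in> filiform n"
  by (auto simp: filiform_def of_sk_def ideal_vec_def)

lemma of_sk_sk:
  assumes "x \<in> filiform n"
  shows "of_sk n (x 1) (sk x) = x"
proof
  fix k
  have "inverse (phi (x 1)) * sk x = hat x"
    unfolding sk_def using phi_inverse[of "x 1"] by (simp flip: mult.assoc)
  moreover have "x k = 0" if "k \<noteq> 1" "\<not> (2 \<le> k \<and> k \<le> n)"
    using assms that by (auto simp: filiform_def)
  moreover have "k - 2 + 2 = k" if "2 \<le> k" using that by simp
  ultimately show "of_sk n (x 1) (sk x) k = x k"
    by (auto simp: of_sk_def ideal_vec_def hat_def)
qed

lemma fps_mult_nth_cong:
  fixes f g h :: "real fps"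
  assumes "\<And>i. i \<le> m \<Longrightarrow> fps_nth g i = fps_nth h i"
  shows "fps_nth (f * g) m = fps_nth (f * h) m"
  unfolding fps_mult_nth using assms by (intro sum.cong) auto

lemma sk_of_sk:
  assumes "i + 2 \<le> n"
  shows "fps_nth (sk (of_sk n a p)) i = fps_nth p i"
proof -
  have "fps_nth (sk (of_sk n a p)) i = fps_nth (phi a * (inverse (phi a) * p)) i"
    unfolding sk_def of_sk_1 using assms
    by (intro fps_mult_nth_cong) (auto simp: hat_def of_sk_def ideal_vec_def)
  also have "phi a * (inverse (phi a) * p) = p" 
    by (simp add: phi_inverse' flip: mult.assoc)
  finally show ?thesis .
qed

lemma of_sk_cong:
  assumes "\<And>i. i + 2 \<le> n \<Longrightarrow> fps_nth p i = fps_nth q i"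
  shows "of_sk n a p = of_sk n a q"
  using assms by (auto simp: of_sk_def ideal_vec_def fun_eq_iff intro!: fps_mult_nth_cong)

text \<open>
  With \<open>s = a + b\<close> the claim is \<open>phi s * (v + w + K * (b v - a w)) = phi a * v + exp (- a z) * phi b * w\<close>
  for the ideal components \<open>v\<close>, \<open>w\<close> of \<open>x\<close>, \<open>y\<close>. Comparing the coefficients of \<open>v\<close> and \<open>w\<close> leaves the two
  identities of \<open>bch_ser_times_phi\<close>.
\<close>

theorem gmult_sk:
  assumes "n \<ge> 2" "x \<in> filiform n" "y \<in> filiform n"
  shows "gmult n x y = of_sk n (x 1 + y 1) (sk x + fps_exp (- x 1) * sk y)"
proof -
  let ?a = "x 1" and ?b = "y 1"
  let ?P = "phi (?a + ?b)"
  define K where "K = fps_shift 1 (bch_ser ?a ?b)"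
  have K: "fps_X * K = bch_ser ?a ?b"
    unfolding K_def by (rule fps_ext) (auto simp: bch_ser_def split: nat.splits)
  have "fps_X * (fps_const ?b * K * ?P) = fps_X * (phi ?a - ?P)"
    using bch_ser_times_phi(1)[of ?b ?a] unfolding K[symmetric] by (simp add: mult_ac)
  then have 1: "fps_const ?b * K * ?P = phi ?a - ?P" by simp
  have "fps_X * (fps_const ?a * K * ?P) = fps_X * (?P - fps_exp (- ?a) * phi ?b)"
    using bch_ser_times_phi(2)[of ?a ?b] unfolding K[symmetric] by (simp add: mult_ac)
  then have 2: "fps_const ?a * K * ?P = ?P - fps_exp (- ?a) * phi ?b" by simp
  define w where "w = hat x + hat y + K * ad_series x y"
  have "?P * w = sk x + fps_exp (- ?a) * sk y"
  proof -
    have "?P * w = ?P * hat x + ?P * hat y + (fps_const ?b * K * ?P) * hat x - (fps_const ?a * K * ?P) * hat y"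
      unfolding w_def ad_series_def by (simp add: algebra_simps)
    also have "\<dots> = sk x + fps_exp (- ?a) * sk y"
      unfolding 1 2 sk_def by (simp add: algebra_simps)
    finally show ?thesis .
  qed
  moreover have "inverse ?P * (?P * w) = w" by (simp add: phi_inverse flip: mult.assoc)
  ultimately have w: "w = inverse ?P * (sk x + fps_exp (- ?a) * sk y)" by simp
  show ?thesis
  proof
    fix k :: nat
    have "k - 2 + 2 = k" if "2 \<le> k" using that by simp
    moreover have "x k = 0 \<and> y k = 0" if "k \<noteq> 1" "\<not> (2 \<le> k \<and> k \<le> n)"
      using assms that by (auto simp: filiform_def)
    ultimately show "gmult n x y k = of_sk n (?a + ?b) (sk x + fps_exp (- ?a) * sk y) k"
      unfolding of_sk_def w[symmetric] gmult_bch_ser[OF assms(1)]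
      by (auto simp: ideal_vec_def w_def hat_def K_def)
  qed
qed

text \<open>
  Up to sign these are \<open>B_i / i!\<close> with the Bernoulli numbers \<open>B_i\<close>. What matters is that the
  coefficients of \<open>inverse (phi a)\<close> are monomials in \<open>a\<close>, so that points depend polynomially on their
  coordinates of the second kind.
\<close>

definition inv_phi_coeff :: "nat \<Rightarrow> real" where
  "inv_phi_coeff i = fps_nth (inverse (phi 1)) i"

lemma inverse_phi_nth: "fps_nth (inverse (phi a)) i = inv_phi_coeff i * a ^ i"
proof -
  let ?Q = "Abs_fps (\<lambda>i. inv_phi_coeff i * a ^ i)"
  have "?Q * phi a = 1"
  proof (rule fps_ext)
    fix m
    have "fps_nth (?Q * phi a) m = (\<Sum>i=0..m. inv_phi_coeff i * a ^ i * ((- a) ^ (m - i) / fact (Suc (m - i))))"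
      by (simp add: fps_mult_nth phi_def del: fact_Suc)
    also have "\<dots> = (\<Sum>i=0..m. a ^ m * (inv_phi_coeff i * ((- 1) ^ (m - i) / fact (Suc (m - i)))))"
    proof (intro sum.cong refl)
      fix i assume "i \<in> {0..m}"
      then have "a ^ m = a ^ i * a ^ (m - i)" by (simp flip: power_add)
      moreover have "(- a) ^ (m - i) = (- 1) ^ (m - i) * a ^ (m - i)" by (rule power_minus)
      ultimately show "inv_phi_coeff i * a ^ i * ((- a) ^ (m - i) / fact (Suc (m - i)))
         = a ^ m * (inv_phi_coeff i * ((- 1) ^ (m - i) / fact (Suc (m - i))))" by simp
    qed
    also have "\<dots> = a ^ m * fps_nth (inverse (phi 1) * phi 1) m"
      by (simp add: fps_mult_nth phi_def inv_phi_coeff_def sum_distrib_left del: fact_Suc)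
    also have "\<dots> = fps_nth 1 m" unfolding phi_inverse by simp
    finally show "fps_nth (?Q * phi a) m = fps_nth 1 m" .
  qed
  then have "inverse (phi a) = ?Q" using fps_inverse_unique by (metis mult.commute)
  then show ?thesis by simp
qed

lemma of_sk_nth:
  assumes "2 \<le> k" "k \<le> n"
  shows "of_sk n a p k = (\<Sum>j=0..k - 2. inv_phi_coeff j * a ^ j * fps_nth p (k - 2 - j))"
  using assms by (simp add: of_sk_def ideal_vec_def fps_mult_nth inverse_phi_nth)

text \<open>
  The horizontal vector with controls \<open>\<alpha>\<close>, \<open>\<beta>\<close> at the point with coordinates of the second kind
  \<open>(a, p)\<close>: the derivative of \<open>of_sk\<close> in the direction in which \<open>a\<close> moves with speed \<open>\<alpha>\<close> and \<open>p\<close> with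
  speed \<open>\<beta> exp (- a z)\<close>.
\<close>

definition sk_field :: "nat \<Rightarrow> real \<Rightarrow> real fps \<Rightarrow> real \<Rightarrow> real \<Rightarrow> vec" where
  "sk_field n a p \<alpha> \<beta> = (\<lambda>k. if k = 1 then \<alpha> else if 2 \<le> k \<and> k \<le> n then
     (\<Sum>j=0..k - 2. inv_phi_coeff j * (real j * a ^ (j - 1) * \<alpha> * fps_nth p (k - 2 - j)
         + a ^ j * (\<beta> * ((- a) ^ (k - 2 - j) / fact (k - 2 - j))))) else 0)"

lemma sk_field_linear:
  "u1 * sk_field n a p 1 0 k + u2 * sk_field n a p 0 1 k = sk_field n a p u1 u2 k"
proof (cases "2 \<le> k \<and> k \<le> n")
  case True
  then show ?thesis unfolding sk_field_def by (simp add: sum_distrib_left flip: sum.distrib) (intro sum.cong refl, simp add: algebra_simps)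
qed (auto simp: sk_field_def)

lemma has_derivative_of_sk:
  assumes "(a has_real_derivative \<alpha>) (at t within S)"
    and "\<And>i. i + 2 \<le> n \<Longrightarrow> ((\<lambda>s. fps_nth (p s) i) has_real_derivative (\<beta> * ((- a t) ^ i / fact i))) (at t within S)"
  shows "((\<lambda>s. of_sk n (a s) (p s) k) has_real_derivative sk_field n (a t) (p t) \<alpha> \<beta> k) (at t within S)"
proof -
  consider "k = 1" | "2 \<le> k" "k \<le> n" | "k \<noteq> 1" "\<not> (2 \<le> k \<and> k \<le> n)" by blast
  then show ?thesis
  proof cases
    case 1 then show ?thesis using assms(1) by (simp add: sk_field_def)
  next
    case 3
    then have "(\<lambda>s. of_sk n (a s) (p s) k) = (\<lambda>s. 0)" "sk_field n (a t) (p t) \<alpha> \<beta> k = 0"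
      by (auto simp: of_sk_def ideal_vec_def sk_field_def)
    then show ?thesis by simp
  next
    case 2
    then have "i + 2 \<le> n" if "i \<in> (\<lambda>j. k - 2 - j) ` {0..k-2}" for i using that by auto
    note d = assms(2)[OF this[OF imageI]]
    have "((\<lambda>s. inv_phi_coeff j * a s ^ j * fps_nth (p s) (k - 2 - j)) has_real_derivative
       inv_phi_coeff j * (real j * a t ^ (j - 1) * \<alpha> * fps_nth (p t) (k - 2 - j)
         + a t ^ j * (\<beta> * ((- a t) ^ (k - 2 - j) / fact (k - 2 - j))))) (at t within S)" if "j \<in> {0..k-2}" for j
      by (rule derivative_eq_intros assms(1) d[OF that] refl)+ (simp add: algebra_simps)
    then have "((\<lambda>s. \<Sum>j=0..k - 2. inv_phi_coeff j * a s ^ j * fps_nth (p s) (k - 2 - j)) has_real_derivative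
       (\<Sum>j=0..k - 2. inv_phi_coeff j * (real j * a t ^ (j - 1) * \<alpha> * fps_nth (p t) (k - 2 - j)
         + a t ^ j * (\<beta> * ((- a t) ^ (k - 2 - j) / fact (k - 2 - j)))))) (at t within S)"
      by (rule DERIV_sum)
    then show ?thesis using 2 by (simp add: of_sk_nth sk_field_def)
  qed
qed

lemma vscale_filiform: "x \<in> filiform n \<Longrightarrow> vscale c x \<in> filiform n"
  by (simp add: filiform_def vscale_def)

lemma horizontal_layer_iff:
  "V \<in> horizontal_layer n \<longleftrightarrow> V \<in> filiform n \<and> (\<forall>k. k \<noteq> 1 \<longrightarrow> k \<noteq> 2 \<longrightarrow> V k = 0)"
proof
  assume "V \<in> filiform n \<and> (\<forall>k. k \<noteq> 1 \<longrightarrow> k \<noteq> 2 \<longrightarrow> V k = 0)"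
  moreover from this have "V = (\<lambda>k. V 1 * basis_vec 1 k + V 2 * basis_vec 2 k)"
    by (auto simp: basis_vec_def fun_eq_iff)
  ultimately show "V \<in> horizontal_layer n" unfolding horizontal_layer_def by blast
qed (auto simp: horizontal_layer_def basis_vec_def)

lemma sk_horizontal:
  assumes "V \<in> horizontal_layer n"
  shows "sk (vscale t V) = fps_const (t * V 2) * phi (t * V 1)"
proof -
  have "hat (vscale t V) = fps_const (t * V 2)"
    using assms unfolding horizontal_layer_iff
    by (intro fps_ext) (auto simp: hat_def vscale_def numeral_2_eq_2)
  then show ?thesis by (simp add: sk_def vscale_def mult.commute)
qed

lemma gmult_horizontal:
  assumes "n \<ge> 2" "x \<in> filiform n" "V \<in> horizontal_layer n"
  shows "gmult n x (vscale t V) = of_sk n (x 1 + t * V 1) 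
     (sk x + fps_exp (- x 1) * (fps_const (t * V 2) * phi (t * V 1)))"
proof -
  have V: "vscale t V \<in> filiform n" using assms(3) by (simp add: horizontal_layer_iff vscale_filiform)
  have "vscale t V 1 = t * V 1" by (simp add: vscale_def)
  then show ?thesis using gmult_sk[OF assms(1,2) V] by (simp only: sk_horizontal[OF assms(3)])
qed

lemma left_inv_field_basis:
  assumes "n \<ge> 2" "x \<in> filiform n"
  shows "left_inv_field n (basis_vec 1) x k = sk_field n (x 1) (sk x) 1 0 k"
    and "left_inv_field n (basis_vec 2) x k = sk_field n (x 1) (sk x) 0 1 k"
proof -
  have h: "basis_vec 1 \<in> horizontal_layer n" "basis_vec 2 \<in> horizontal_layer n"
    using assms(1) by (auto simp: horizontal_layer_iff basis_vec_def filiform_def)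
  have d: "((\<lambda>t. x 1 + t) has_real_derivative 1) (at 0)" by (auto intro!: derivative_eq_intros)
  have "((\<lambda>t. gmult n x (vscale t (basis_vec 1)) k) has_real_derivative 
      sk_field n ((\<lambda>t. x 1 + t) 0) ((\<lambda>t. sk x) 0) 1 0 k) (at 0)"
    unfolding gmult_horizontal[OF assms h(1)]
    using has_derivative_of_sk[OF d, of n "\<lambda>t. sk x" 0 k]
    by (simp add: basis_vec_def)
  then show "left_inv_field n (basis_vec 1) x k = sk_field n (x 1) (sk x) 1 0 k"
    unfolding left_inv_field_def by (simp add: DERIV_imp_deriv)
  have "((\<lambda>t. gmult n x (vscale t (basis_vec 2)) k) has_real_derivative 
      sk_field n ((\<lambda>t. x 1) 0) ((\<lambda>t. sk x + fps_exp (- x 1) * fps_const t) 0) 0 1 k) (at 0)"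
    unfolding gmult_horizontal[OF assms h(2)]
    by (rule has_derivative_of_sk[of "\<lambda>t. x 1" 0 0 UNIV n "\<lambda>t. sk x + fps_exp (- x 1) * fps_const t" 1 k,
          THEN back_subst[of "\<lambda>f. (f has_real_derivative _) _"]])
       (auto simp: basis_vec_def intro!: derivative_eq_intros)
  then show "left_inv_field n (basis_vec 2) x k = sk_field n (x 1) (sk x) 0 1 k"
    unfolding left_inv_field_def by (simp add: DERIV_imp_deriv)
qed

lemma left_inv_field_combination:
  assumes "n \<ge> 2" "x \<in> filiform n"
  shows "u1 * left_inv_field n (basis_vec 1) x k + u2 * left_inv_field n (basis_vec 2) x k
    = sk_field n (x 1) (sk x) u1 u2 k"
  unfolding left_inv_field_basis[OF assms] by (rule sk_field_linear)

lemma sk_field_of_sk: "sk_field n a (sk (of_sk n a p)) u1 u2 = sk_field n a p u1 u2"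
  by (auto simp: sk_field_def fun_eq_iff sk_of_sk)

lemma left_inv_field_0:
  assumes "n \<ge> 2" "V \<in> horizontal_layer n"
  shows "left_inv_field n V (\<lambda>k. 0) = V"
proof
  fix k
  have z: "(\<lambda>k. 0) \<in> filiform n" by (simp add: filiform_def)
  have s0: "sk (\<lambda>k. 0) = 0" by (rule fps_ext) (simp add: sk_def hat_def)
  have v: "vscale t V \<in> filiform n" for t using assms(2) by (simp add: horizontal_layer_iff vscale_filiform)
  have "gmult n (\<lambda>k. 0) (vscale t V) = vscale t V" for t
    using gmult_sk[OF assms(1) z v[of t]] of_sk_sk[OF v[of t]] by (simp add: s0)
  then have "left_inv_field n V (\<lambda>k. 0) k = deriv (\<lambda>t. t * V k) 0"
    unfolding left_inv_field_def by (simp add: vscale_def)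
  also have "\<dots> = V k" by (rule DERIV_imp_deriv) (auto intro!: derivative_eq_intros)
  finally show "left_inv_field n V (\<lambda>k. 0) k = V k" .
qed

text \<open>
  The primitive of \<open>(- x)^i / i!\<close>. Thus a horizontal curve along which \<open>x_2\<close> is an affine function of
  \<open>x_1\<close> has all its coordinates of the second kind equal to the slope times \<open>gprim i x_1\<close>, up to a
  constant.
\<close>

definition gprim :: "nat \<Rightarrow> real \<Rightarrow> real" where
  "gprim i x = - ((- x) ^ Suc i / fact (Suc i))"

lemma gprim_deriv: "(gprim i has_real_derivative ((- x) ^ i / fact i)) (at x within S)"
proof -
  have "((\<lambda>x. - x) has_real_derivative - 1) (at x within S)" by (auto intro!: derivative_eq_intros)
  from DERIV_minus[OF DERIV_cdivide[OF DERIV_power_Suc[OF this, of i], of "fact (Suc i)"]]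
  have "(gprim i has_real_derivative - ((1 + real i) * (- 1 * (- x) ^ i) / fact (Suc i))) (at x within S)"
    unfolding gprim_def .
  moreover have "- ((1 + real i) * (- 1 * (- x) ^ i) / fact (Suc i)) = (- x) ^ i / fact i"
    by (simp add: divide_simps)
  ultimately show ?thesis by simp
qed

lemma exp_phi_gprim:
  "fps_nth (fps_exp (- A) * (fps_const s * phi s)) i = gprim i (A + s) - gprim i A"
proof -
  have "fps_X * (fps_exp (- A) * (fps_const s * phi s)) = fps_exp (- A) * (1 - fps_exp (- s))"
    unfolding X_phi[symmetric] by (simp add: mult_ac)
  also have "\<dots> = fps_exp (- A) - fps_exp (- (A + s))"
    by (simp add: algebra_simps flip: fps_exp_add_mult)
  finally have "fps_nth (fps_X * (fps_exp (- A) * (fps_const s * phi s))) (Suc i) 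
     = fps_nth (fps_exp (- A) - fps_exp (- (A + s))) (Suc i)" by (rule arg_cong)
  then show ?thesis by (simp add: gprim_def del: fact_Suc)
qed

text \<open>
  A line with \<open>\<alpha> \<noteq> 0\<close> is a graph over its first coordinate. The base point of a horizontal line sits at
  time 0, which may lie outside the interval on which a curve follows the line; hence the statement
  for all times.
\<close>

lemma horizontal_line_graph:
  assumes "n \<ge> 2" "\<alpha> \<noteq> 0"
  shows "horizontal_line n (\<lambda>t. of_sk n (A + t * \<alpha>) (Abs_fps (\<lambda>i. R i + \<beta> / \<alpha> * gprim i (A + t * \<alpha>))))"
proof -
  define V :: vec where "V = (\<lambda>k. if k = 1 then \<alpha> else if k = 2 then \<beta> else 0)"
  define q where "q = of_sk n A (Abs_fps (\<lambda>i. R i + \<beta> / \<alpha> * gprim i A))"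
  have V: "V \<in> horizontal_layer n" using assms(1) by (auto simp: V_def horizontal_layer_iff filiform_def)
  have q: "q \<in> filiform n" unfolding q_def using assms(1) by (intro of_sk_filiform) simp
  have "gmult n q (vscale t V) = of_sk n (A + t * \<alpha>) (Abs_fps (\<lambda>i. R i + \<beta> / \<alpha> * gprim i (A + t * \<alpha>)))" for t
  proof -
    have "gmult n q (vscale t V) = of_sk n (A + t * \<alpha>) (sk q + fps_exp (- A) * (fps_const (t * \<beta>) * phi (t * \<alpha>)))"
      using gmult_horizontal[OF assms(1) q V, of t] by (simp add: V_def q_def)
    also have "\<dots> = of_sk n (A + t * \<alpha>) (Abs_fps (\<lambda>i. R i + \<beta> / \<alpha> * gprim i (A + t * \<alpha>)))"
    proof (rule of_sk_cong)
      fix i assume i: "i + 2 \<le> n"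
      have "fps_exp (- A) * (fps_const (t * \<beta>) * phi (t * \<alpha>))
         = fps_const (\<beta> / \<alpha>) * (fps_exp (- A) * (fps_const (t * \<alpha>) * phi (t * \<alpha>)))"
      proof -
        have "fps_const (t * \<beta>) = fps_const (\<beta> / \<alpha>) * fps_const (t * \<alpha>)" using assms(2) by simp
        then show ?thesis by (simp only: mult_ac)
      qed
      then have "fps_nth (fps_exp (- A) * (fps_const (t * \<beta>) * phi (t * \<alpha>))) i
         = \<beta> / \<alpha> * (gprim i (A + t * \<alpha>) - gprim i A)"
        by (simp only: fps_mult_left_const_nth exp_phi_gprim)
      then show "fps_nth (sk q + fps_exp (- A) * (fps_const (t * \<beta>) * phi (t * \<alpha>))) i
        = fps_nth (Abs_fps (\<lambda>i. R i + \<beta> / \<alpha> * gprim i (A + t * \<alpha>))) i"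
        using i unfolding q_def by (simp add: sk_of_sk right_diff_distrib)
    qed
    finally show ?thesis .
  qed
  then show ?thesis unfolding horizontal_line_def using q V by (intro bexI[of _ q] bexI[of _ V]) auto
qed

section \<open>Absolutely continuous functions\<close>

text \<open>
  The fundamental theorem of calculus for absolutely continuous functions, in the
  Henstock-Kurzweil sense. A gauge is chosen by differentiability off the exceptional set and by
  inclusion in an open set of small measure on it. A fine tagged division then splits into
  intervals where \<open>f\<close> is almost affine and intervals of small total length, over which \<open>f\<close> has small
  variation.
\<close>

lemma abs_cont_has_integral:
  fixes f f' :: "real \<Rightarrow> real"
  assumes ac: "abs_cont_on a b f" and "a \<le> b" and E: "negligible E"
    and der: "\<And>t. t \<in> {a..b} - E \<Longrightarrow> (f has_real_derivative f' t) (at t within {a..b})"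
  shows "(f' has_integral f b - f a) {a..b}"
proof (rule has_integral_spike[OF E])
  define F where "F = (\<lambda>t. if t \<in> E then 0 else f' t)"
  show "\<And>x. x \<in> {a..b} - E \<Longrightarrow> f' x = F x" by (simp add: F_def)
  show "(F has_integral f b - f a) {a..b}"
    unfolding has_integral_real
  proof (intro allI impI)
    fix e :: real assume "e > 0"
    define e' where "e' = e / (2 * (b - a + 1))"
    have "e' > 0" unfolding e'_def using \<open>e > 0\<close> \<open>a \<le> b\<close> by simp
    have e'_le: "e' * (b - a) \<le> e / 2"
      unfolding e'_def using \<open>e > 0\<close> \<open>a \<le> b\<close> by (simp add: field_simps)
    obtain \<delta> where "\<delta> > 0" and \<delta>: "\<And>D. finite D \<Longrightarrow> \<forall>(c, d)\<in>D. a \<le> c \<and> c \<le> d \<and> d \<le> b \<Longrightarrow>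
        pairwise (\<lambda>p q. disjnt {fst p<..<snd p} {fst q<..<snd q}) D \<Longrightarrow>
        (\<Sum>(c, d)\<in>D. d - c) < \<delta> \<Longrightarrow> (\<Sum>(c, d)\<in>D. \<bar>f d - f c\<bar>) < e / 2"
      using ac[unfolded abs_cont_on_def, THEN spec, THEN mp, OF half_gt_zero[OF \<open>e > 0\<close>]]
      by (elim exE conjE) blast
    obtain U where U: "open U" "E \<subseteq> U" "U \<in> lmeasurable" "measure lebesgue U < \<delta>"
    proof -
      obtain U where U: "open U" "E \<subseteq> U" "U - E \<in> lmeasurable" "emeasure lebesgue (U - E) < ennreal \<delta>"
        using sets_lebesgue_outer_open[OF negligible_imp_sets[OF E] \<open>\<delta> > 0\<close>] by blast
      have "(U - E) \<union> E = U" using U(2) by blast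
      then have "U \<in> lmeasurable" "measure lebesgue U = measure lebesgue (U - E)"
        using U(3) E negligible_imp_measurable[OF E] fmeasurable.Un[of "U - E" lebesgue E]
          measure_Un_null_set[of "U - E" lebesgue E] by (auto simp: negligible_iff_null_sets)
      moreover have "measure lebesgue (U - E) < \<delta>"
        using U(3,4) \<open>\<delta> > 0\<close> by (simp add: emeasure_eq_measure2 ennreal_less_iff)
      ultimately show ?thesis using U(1,2) that by simp
    qed
    have "\<exists>r>0. (x \<in> E \<longrightarrow> ball x r \<subseteq> U) \<and> (x \<in> {a..b} - E \<longrightarrow>
        (\<forall>y\<in>{a..b}. \<bar>y - x\<bar> < r \<longrightarrow> \<bar>f y - f x - (y - x) * f' x\<bar> \<le> e' * \<bar>y - x\<bar>))" for x
    proof (cases "x \<in> E")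
      case True
      then show ?thesis using U by (meson DiffD2 open_contains_ball subsetD)
    next
      case False
      show ?thesis
      proof (cases "x \<in> {a..b}")
        case True
        then have "(f has_derivative (\<lambda>h. h * f' x)) (at x within {a..b})"
          using der[of x] False by (simp add: has_field_derivative_def mult_commute_abs)
        then obtain r where "r > 0" "\<forall>y\<in>{a..b}. norm (y - x) < r \<longrightarrow> norm (f y - f x - (y - x) * f' x) \<le> e' * norm (y - x)"
          using \<open>e' > 0\<close> unfolding has_derivative_within_alt by blast
        then show ?thesis using False by auto
      qed (use False in \<open>auto intro!: exI[of _ 1]\<close>)
    qed
    then obtain r where r: "\<And>x. r x > 0" "\<And>x. x \<in> E \<Longrightarrow> ball x (r x) \<subseteq> U"
      "\<And>x y. x \<in> {a..b} \<Longrightarrow> x \<notin> E \<Longrightarrow> y \<in> {a..b} \<Longrightarrow> \<bar>y - x\<bar> < r x \<Longrightarrow> \<bar>f y - f x - (y - x) * f' x\<bar> \<le> e' * \<bar>y - x\<bar>"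
      by (metis DiffI)
    show "\<exists>\<gamma>. gauge \<gamma> \<and> (\<forall>p. p tagged_division_of {a..b} \<and> \<gamma> fine p \<longrightarrow>
        norm ((\<Sum>(x, K)\<in>p. measure lborel K *\<^sub>R F x) - (f b - f a)) < e)"
    proof (intro exI[of _ "\<lambda>x. ball x (r x)"] conjI allI impI)
      show "gauge (\<lambda>x. ball x (r x))" using r(1) by (simp add: gauge_def)
      fix p assume "p tagged_division_of {a..b} \<and> (\<lambda>x. ball x (r x)) fine p"
      then have p: "p tagged_division_of {a..b}" and fine: "\<And>x K. (x, K) \<in> p \<Longrightarrow> K \<subseteq> ball x (r x)"
        by (auto simp: fine_def)
      note pD = tagged_division_ofD[OF p]
      have itv: "K = {Inf K..Sup K} \<and> a \<le> Inf K \<and> Inf K \<le> x \<and> x \<le> Sup K \<and> Sup K \<le> b" if "(x, K) \<in> p" for x K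
      proof -
        obtain c d where K: "K = {c..d}" using pD(4)[OF \<open>(x, K) \<in> p\<close>] by auto
        have "x \<in> K" "K \<subseteq> {a..b}" using pD(2,3)[OF that] by auto
        then show ?thesis unfolding K by auto
      qed
      define pE where "pE = {(x, K) \<in> p. x \<in> E}"
      define G where "G = (\<lambda>(x, K). measure lborel K *\<^sub>R F x - (f (Sup K) - f (Inf K)))"
      have "(\<Sum>(x, K)\<in>p. measure lborel K *\<^sub>R F x) - (f b - f a) = sum G p"
        unfolding additive_tagged_division_1[OF \<open>a \<le> b\<close> p, symmetric] G_def
        by (simp add: sum_subtractf split_def)
      also have "\<dots> = sum G (p - pE) + sum G pE"
        by (rule sum.subset_diff) (auto simp: pE_def pD(1))
      finally have split: "norm ((\<Sum>(x, K)\<in>p. measure lborel K *\<^sub>R F x) - (f b - f a)) \<le> \<bar>sum G (p - pE)\<bar> + \<bar>sum G pE\<bar>"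
        by simp
      \<comment> \<open>Tags off the exceptional set: the derivative controls the increments.\<close>
      have "\<bar>G z\<bar> \<le> e' * (case z of (x, K) \<Rightarrow> measure lborel K)" if "z \<in> p - pE" for z
      proof -
        obtain x K where z: "z = (x, K)" by (cases z)
        have xK: "(x, K) \<in> p" "x \<notin> E" using that z by (auto simp: pE_def)
        define c d where "c = Inf K" and "d = Sup K"
        have K: "K = {c..d}" "a \<le> c" "c \<le> x" "x \<le> d" "d \<le> b" using itv[OF xK(1)] by (auto simp: c_def d_def)
        have "c \<in> K" "d \<in> K" using K by auto
        then have "\<bar>c - x\<bar> < r x" "\<bar>d - x\<bar> < r x" using fine[OF xK(1)] by (auto simp: dist_real_def)
        then have "\<bar>f c - f x - (c - x) * f' x\<bar> \<le> e' * \<bar>c - x\<bar>" "\<bar>f d - f x - (d - x) * f' x\<bar> \<le> e' * \<bar>d - x\<bar>"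
          using r(3)[of x c] r(3)[of x d] K xK(2) by auto
        moreover have "G z = (f c - f x - (c - x) * f' x) - (f d - f x - (d - x) * f' x)"
          using K xK by (simp add: G_def z F_def flip: c_def d_def) (simp add: algebra_simps)
        ultimately have "\<bar>G z\<bar> \<le> e' * \<bar>c - x\<bar> + e' * \<bar>d - x\<bar>" by linarith
        also have "\<dots> = e' * measure lborel K" using K by (simp add: algebra_simps)
        finally show ?thesis by (simp add: z)
      qed
      then have "\<bar>sum G (p - pE)\<bar> \<le> (\<Sum>z\<in>p - pE. e' * (case z of (x, K) \<Rightarrow> measure lborel K))"
        by (intro sum_norm_le[where f = G, unfolded real_norm_def]) auto
      also have "\<dots> \<le> (\<Sum>z\<in>p. e' * (case z of (x, K) \<Rightarrow> measure lborel K))"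
        using \<open>e' > 0\<close> pD(1) by (intro sum_mono2) auto
      also have "\<dots> = e' * (b - a)"
        using additive_content_tagged_division[of p a b] p \<open>a \<le> b\<close> by (simp add: split_def flip: sum_distrib_left)
      finally have 1: "\<bar>sum G (p - pE)\<bar> \<le> e / 2" using e'_le by linarith
      \<comment> \<open>Tags in the exceptional set: absolute continuity controls the increments.\<close>
      define q where "q = {(x, K) \<in> pE. Inf K < Sup K}"
      define D where "D = (\<lambda>(x, K). (Inf K, Sup K)) ` q"
      have qp: "q \<subseteq> p" "q \<subseteq> pE" "finite q" using pD(1) by (auto simp: q_def pE_def intro: finite_subset[of _ p])
      have disj: "{Inf K<..<Sup K} \<inter> {Inf L<..<Sup L} = {}" if "(x, K) \<in> q" "(y, L) \<in> q" "(x, K) \<noteq> (y, L)" for x y K L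
      proof -
        have "interior K \<inter> interior L = {}" using pD(5) that qp by blast
        moreover have "interior K = {Inf K<..<Sup K}" "interior L = {Inf L<..<Sup L}"
          using itv that qp by (metis interior_atLeastAtMost_real subsetD)+
        ultimately show ?thesis by simp
      qed
      have inj: "inj_on (\<lambda>(x, K). (Inf K, Sup K)) q"
      proof (rule inj_onI)
        fix z w assume zw: "z \<in> q" "w \<in> q" "(case z of (x, K) \<Rightarrow> (Inf K, Sup K)) = (case w of (x, K) \<Rightarrow> (Inf K, Sup K))"
        obtain x K y L where [simp]: "z = (x, K)" "w = (y, L)" by (cases z, cases w)
        have "Inf K = Inf L" "Sup K = Sup L" "Inf K < Sup K" using zw by (auto simp: q_def)
        then show "z = w" using disj[of x K y L] zw by (auto dest: dense)
      qed
      have "\<bar>sum G pE\<bar> \<le> (\<Sum>(c, d)\<in>D. \<bar>f d - f c\<bar>)"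
      proof -
        have "\<bar>sum G pE\<bar> \<le> (\<Sum>(x, K)\<in>pE. \<bar>f (Sup K) - f (Inf K)\<bar>)"
          by (intro sum_norm_le[where f = G, unfolded real_norm_def]) (auto simp: pE_def G_def F_def)
        also have "\<dots> = (\<Sum>(x, K)\<in>q. \<bar>f (Sup K) - f (Inf K)\<bar>)"
        proof (rule sum.mono_neutral_right)
          show "finite pE" using pD(1) by (auto simp: pE_def intro: finite_subset[of _ p])
          show "\<forall>z\<in>pE - q. (case z of (x, K) \<Rightarrow> \<bar>f (Sup K) - f (Inf K)\<bar>) = 0"
          proof
            fix z assume z: "z \<in> pE - q"
            obtain x K where zK: "z = (x, K)" by (cases z)
            have "(x, K) \<in> p" "\<not> Inf K < Sup K" using z zK by (auto simp: q_def pE_def)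
            then have "Inf K = Sup K" using itv[of x K] by linarith
            then show "(case z of (x, K) \<Rightarrow> \<bar>f (Sup K) - f (Inf K)\<bar>) = 0" by (simp add: zK)
          qed
        qed (use qp in auto)
        also have "\<dots> = (\<Sum>(c, d)\<in>D. \<bar>f d - f c\<bar>)"
          unfolding D_def by (subst sum.reindex[OF inj]) (simp add: o_def split_def)
        finally show ?thesis .
      qed
      also have "\<dots> < e / 2"
      proof (rule \<delta>)
        show fD: "finite D" unfolding D_def using qp by simp
        show ab: "\<forall>(c, d)\<in>D. a \<le> c \<and> c \<le> d \<and> d \<le> b"
          unfolding D_def using itv qp by fastforce
        show pw: "pairwise (\<lambda>p q. disjnt {fst p<..<snd p} {fst q<..<snd q}) D"
        proof (rule pairwiseI)
          fix v w assume vw: "v \<in> D" "w \<in> D" "v \<noteq> w"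
          then obtain x K y L where "(x, K) \<in> q" "(y, L) \<in> q" "v = (Inf K, Sup K)" "w = (Inf L, Sup L)"
            by (auto simp: D_def)
          with disj[of x K y L] vw(3) show "disjnt {fst v<..<snd v} {fst w<..<snd w}"
            by (auto simp: disjnt_def)
        qed
        have "(\<Sum>(c, d)\<in>D. d - c) = (\<Sum>z\<in>D. measure lebesgue {fst z<..<snd z})"
          using ab by (intro sum.cong) (auto simp: measure_def)
        also have "\<dots> = measure lebesgue (\<Union>z\<in>D. {fst z<..<snd z})"
          using fD pw ab by (subst measure_finite_Union)
            (auto simp: disjoint_family_on_def pairwise_def disjnt_def)
        also have "\<dots> \<le> measure lebesgue U"
        proof (rule measure_mono_fmeasurable[OF _ _ U(3)])
          show "(\<Union>z\<in>D. {fst z<..<snd z}) \<subseteq> U"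
          proof
            fix t assume "t \<in> (\<Union>z\<in>D. {fst z<..<snd z})"
            then obtain x K where xK: "(x, K) \<in> q" "Inf K < t" "t < Sup K" by (auto simp: D_def)
            then have "K = {Inf K..Sup K}" "t \<in> {Inf K..Sup K}" using itv[of x K] qp by auto
            then have "t \<in> K" by blast
            then show "t \<in> U" using xK r(2)[of x] fine[of x K] qp by (auto simp: pE_def)
          qed
        qed (use fD in auto)
        finally show "(\<Sum>(c, d)\<in>D. d - c) < \<delta>" using U(4) by linarith
      qed
      finally show "norm ((\<Sum>(x, K)\<in>p. measure lborel K *\<^sub>R F x) - (f b - f a)) < e" using split 1 by linarith
    qed
  qed
qed

section \<open>Boundedness of the Carnot-Caratheodory unit ball\<close>

lemma sk_nth_bound:
  assumes "0 \<le> M" "\<bar>x 1\<bar> \<le> M" "\<And>j. j \<le> i + 2 \<Longrightarrow> \<bar>x j\<bar> \<le> M" "i \<le> k"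
  shows "\<bar>fps_nth (sk x) i\<bar> \<le> (\<Sum>j=0..k. M ^ j * M)"
proof -
  have "\<bar>fps_nth (sk x) i\<bar> \<le> (\<Sum>j=0..i. \<bar>fps_nth (phi (x 1)) j * fps_nth (hat x) (i - j)\<bar>)"
    unfolding sk_def fps_mult_nth by (rule sum_abs)
  also have "\<dots> \<le> (\<Sum>j=0..i. M ^ j * M)"
  proof (rule sum_mono)
    fix j assume j: "j \<in> {0..i}"
    have "(1::real) \<le> fact (Suc j)" by (rule fact_ge_1)
    then have "\<bar>x 1\<bar> ^ j / fact (Suc j) \<le> \<bar>x 1\<bar> ^ j / 1"
      by (intro divide_left_mono) (auto simp del: fact_Suc)
    also have "\<dots> \<le> M ^ j" using assms(1,2) by (simp add: power_mono)
    finally have "\<bar>fps_nth (phi (x 1)) j\<bar> \<le> M ^ j"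
      by (simp add: phi_def abs_mult power_abs del: fact_Suc)
    moreover have "\<bar>fps_nth (hat x) (i - j)\<bar> \<le> M" using j assms(3)[of "i - j + 2"] by (simp add: hat_def)
    ultimately show "\<bar>fps_nth (phi (x 1)) j * fps_nth (hat x) (i - j)\<bar> \<le> M ^ j * M"
      unfolding abs_mult using assms(1) by (intro mult_mono) auto
  qed
  also have "\<dots> \<le> (\<Sum>j=0..k. M ^ j * M)"
    using assms(1,4) by (intro sum_mono2) auto
  finally show ?thesis .
qed

text \<open>
  A bound for the coordinate \<open>k\<close> of \<open>sk_field\<close> per unit of control. It uses coordinates of
  the point of index less than \<open>k\<close> only, because in the term \<open>j = 0\<close>, the only one to contain the
  coefficient \<open>k - 2\<close> of \<open>p\<close>, that coefficient is multiplied by 0. This is what allows bounding the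
  coordinates of a horizontal curve one after the other.
\<close>

definition field_bound :: "nat \<Rightarrow> real \<Rightarrow> real \<Rightarrow> real" where
  "field_bound k M S = 1 + (\<Sum>j=0..k - 2. \<bar>inv_phi_coeff j\<bar> * (real j * M ^ (j - 1) * S + M ^ j * M ^ (k - 2 - j)))"

lemma field_bound_ge_1: "0 \<le> M \<Longrightarrow> 0 \<le> S \<Longrightarrow> 1 \<le> field_bound k M S"
  unfolding field_bound_def by (simp add: sum_nonneg)

lemma sk_field_bound:
  assumes "0 \<le> M" "0 \<le> S" "k \<ge> 2 \<Longrightarrow> \<bar>a\<bar> \<le> M" "\<And>i. i + 2 < k \<Longrightarrow> \<bar>fps_nth p i\<bar> \<le> S"
  shows "\<bar>sk_field n a p u1 u2 k\<bar> \<le> field_bound k M S * (\<bar>u1\<bar> + \<bar>u2\<bar>)"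
proof -
  have C: "1 \<le> field_bound k M S" using assms by (intro field_bound_ge_1)
  consider "k = 1" | "2 \<le> k" "k \<le> n" | "k \<noteq> 1" "\<not> (2 \<le> k \<and> k \<le> n)" by blast
  then show ?thesis
  proof cases
    case 1
    have "1 * \<bar>u1\<bar> \<le> field_bound k M S * (\<bar>u1\<bar> + \<bar>u2\<bar>)"
      using C by (intro mult_mono) auto
    then show ?thesis using 1 by (simp add: sk_field_def)
  next
    case 3
    then have "sk_field n a p u1 u2 k = 0" by (auto simp: sk_field_def)
    then show ?thesis using C by simp
  next
    case 2
    have "\<bar>sk_field n a p u1 u2 k\<bar> \<le> (\<Sum>j=0..k - 2. \<bar>inv_phi_coeff j * (real j * a ^ (j - 1) * u1 * fps_nth p (k - 2 - j)
         + a ^ j * (u2 * ((- a) ^ (k - 2 - j) / fact (k - 2 - j))))\<bar>)"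
      using 2 by (simp add: sk_field_def)
    also have "\<dots> \<le> (\<Sum>j=0..k - 2. \<bar>inv_phi_coeff j\<bar> * (real j * M ^ (j - 1) * S + M ^ j * M ^ (k - 2 - j)) * (\<bar>u1\<bar> + \<bar>u2\<bar>))"
    proof (rule sum_mono)
      fix j assume j: "j \<in> {0..k-2}"
      have pw: "\<bar>a ^ m\<bar> \<le> M ^ m" for m using assms(3)[OF 2(1)] by (simp add: power_abs power_mono)
      have 1: "\<bar>real j * a ^ (j - 1) * u1 * fps_nth p (k - 2 - j)\<bar> \<le> real j * M ^ (j - 1) * S * (\<bar>u1\<bar> + \<bar>u2\<bar>)"
      proof (cases "j = 0")
        case False
        then have "k - 2 - j + 2 < k" using j by auto
        then have "\<bar>fps_nth p (k - 2 - j)\<bar> \<le> S" by (rule assms(4))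
        then have "(real j * \<bar>a ^ (j - 1)\<bar>) * \<bar>u1\<bar> * \<bar>fps_nth p (k - 2 - j)\<bar> \<le> (real j * M ^ (j - 1)) * (\<bar>u1\<bar> + \<bar>u2\<bar>) * S"
          using assms(1,2) pw by (intro mult_mono) auto
        then show ?thesis by (simp add: abs_mult mult_ac)
      qed simp
      have f1: "(1::real) \<le> fact (k - 2 - j)" by (rule fact_ge_1)
      have "\<bar>(- a) ^ (k - 2 - j)\<bar> / fact (k - 2 - j) \<le> \<bar>(- a) ^ (k - 2 - j)\<bar> / 1"
        using f1 by (intro divide_left_mono) auto
      also have "\<dots> \<le> M ^ (k - 2 - j)" using pw[of "k - 2 - j"] by (simp add: power_abs)
      finally have "\<bar>(- a) ^ (k - 2 - j) / fact (k - 2 - j)\<bar> \<le> M ^ (k - 2 - j)" by (simp add: power_abs abs_mult)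
      then have "\<bar>a ^ j\<bar> * (\<bar>u2\<bar> * \<bar>(- a) ^ (k - 2 - j) / fact (k - 2 - j)\<bar>) \<le> M ^ j * ((\<bar>u1\<bar> + \<bar>u2\<bar>) * M ^ (k - 2 - j))"
        using assms(1) pw by (intro mult_mono) auto
      then have 2: "\<bar>a ^ j * (u2 * ((- a) ^ (k - 2 - j) / fact (k - 2 - j)))\<bar> \<le> M ^ j * M ^ (k - 2 - j) * (\<bar>u1\<bar> + \<bar>u2\<bar>)"
        by (simp add: abs_mult mult_ac)
      have "\<bar>real j * a ^ (j - 1) * u1 * fps_nth p (k - 2 - j)
         + a ^ j * (u2 * ((- a) ^ (k - 2 - j) / fact (k - 2 - j)))\<bar> \<le> (real j * M ^ (j - 1) * S + M ^ j * M ^ (k - 2 - j)) * (\<bar>u1\<bar> + \<bar>u2\<bar>)"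
        using order_trans[OF abs_triangle_ineq add_mono[OF 1 2]] by (simp only: distrib_right)
      then show "\<bar>inv_phi_coeff j * (real j * a ^ (j - 1) * u1 * fps_nth p (k - 2 - j)
         + a ^ j * (u2 * ((- a) ^ (k - 2 - j) / fact (k - 2 - j))))\<bar>
         \<le> \<bar>inv_phi_coeff j\<bar> * (real j * M ^ (j - 1) * S + M ^ j * M ^ (k - 2 - j)) * (\<bar>u1\<bar> + \<bar>u2\<bar>)"
        unfolding abs_mult[of "inv_phi_coeff j"] mult.assoc[of "\<bar>inv_phi_coeff j\<bar>"] by (rule mult_left_mono) simp
    qed
    also have "\<dots> = (\<Sum>j=0..k - 2. \<bar>inv_phi_coeff j\<bar> * (real j * M ^ (j - 1) * S + M ^ j * M ^ (k - 2 - j))) * (\<bar>u1\<bar> + \<bar>u2\<bar>)"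
      by (rule sum_distrib_right[symmetric])
    also have "\<dots> \<le> field_bound k M S * (\<bar>u1\<bar> + \<bar>u2\<bar>)"
      by (intro mult_right_mono) (auto simp: field_bound_def)
    finally show ?thesis .
  qed
qed

lemma abs_cont_on_subinterval:
  assumes "abs_cont_on a b f" "a \<le> c" "d \<le> b"
  shows "abs_cont_on c d f"
  unfolding abs_cont_on_def
proof (intro allI impI)
  fix e :: real assume "e > 0"
  from assms(1)[unfolded abs_cont_on_def, THEN spec, THEN mp, OF this]
  obtain \<delta> where \<delta>: "\<delta> > 0" "\<And>D. finite D \<Longrightarrow> \<forall>(c, d)\<in>D. a \<le> c \<and> c \<le> d \<and> d \<le> b \<Longrightarrow>
        pairwise (\<lambda>p q. disjnt {fst p<..<snd p} {fst q<..<snd q}) D \<Longrightarrow>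
        (\<Sum>(c, d)\<in>D. d - c) < \<delta> \<Longrightarrow> (\<Sum>(c, d)\<in>D. \<bar>f d - f c\<bar>) < e"
    by (elim exE conjE) blast
  show "\<exists>\<delta>>0. \<forall>D. finite D \<and> (\<forall>(ca, da)\<in>D. c \<le> ca \<and> ca \<le> da \<and> da \<le> d) \<and>
        pairwise (\<lambda>p q. disjnt {fst p<..<snd p} {fst q<..<snd q}) D \<and> (\<Sum>(c, d)\<in>D. d - c) < \<delta> \<longrightarrow>
        (\<Sum>(c, d)\<in>D. \<bar>f d - f c\<bar>) < e"
    using \<delta>(1) assms(2,3) by (intro exI[of _ \<delta>] conjI allI impI \<delta>(2)) fastforce+
qed

lemma speed_integrable:
  assumes "u1 absolutely_integrable_on {a..b}" "u2 absolutely_integrable_on {a..b::real}"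
  shows "(\<lambda>t. sqrt ((u1 t)\<^sup>2 + (u2 t)\<^sup>2)) integrable_on {a..b}"
proof (rule measurable_bounded_by_integrable_imp_integrable)
  have "u1 \<in> borel_measurable (lebesgue_on {a..b})" "u2 \<in> borel_measurable (lebesgue_on {a..b})"
    using assms by (auto intro: integrable_imp_measurable set_lebesgue_integral_eq_integral(1))
  then show "(\<lambda>t. sqrt ((u1 t)\<^sup>2 + (u2 t)\<^sup>2)) \<in> borel_measurable (lebesgue_on {a..b})" by measurable
  show "(\<lambda>t. \<bar>u1 t\<bar> + \<bar>u2 t\<bar>) integrable_on {a..b}"
    using assms by (intro integrable_add) (auto simp: absolutely_integrable_on_def)
  show "norm (sqrt ((u1 t)\<^sup>2 + (u2 t)\<^sup>2)) \<le> \<bar>u1 t\<bar> + \<bar>u2 t\<bar>" for t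
    using sqrt_sum_squares_le_sum_abs by simp
qed auto

lemma integral_controls_le:
  assumes "u1 absolutely_integrable_on {a..b}" "u2 absolutely_integrable_on {a..b::real}" "a \<le> t" "t \<le> b"
  shows "integral {t..b} (\<lambda>s. \<bar>u1 s\<bar> + \<bar>u2 s\<bar>) \<le> 2 * ctrl_length a b u1 u2"
proof -
  have sp: "(\<lambda>t. sqrt ((u1 t)\<^sup>2 + (u2 t)\<^sup>2)) integrable_on {a..b}" using speed_integrable[OF assms(1,2)] .
  have i: "(\<lambda>t. \<bar>u1 t\<bar> + \<bar>u2 t\<bar>) integrable_on {a..b}"
    using assms(1,2) by (intro integrable_add) (auto simp: absolutely_integrable_on_def)
  have "integral {t..b} (\<lambda>s. \<bar>u1 s\<bar> + \<bar>u2 s\<bar>) \<le> integral {a..b} (\<lambda>s. \<bar>u1 s\<bar> + \<bar>u2 s\<bar>)"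
    using assms(3) i by (intro integral_subset_le integrable_on_subinterval[OF i]) auto
  also have "\<dots> \<le> integral {a..b} (\<lambda>t. 2 * sqrt ((u1 t)\<^sup>2 + (u2 t)\<^sup>2))"
  proof (rule integral_le[OF i])
    show "(\<lambda>t. 2 * sqrt ((u1 t)\<^sup>2 + (u2 t)\<^sup>2)) integrable_on {a..b}" using sp by (rule integrable_on_mult_right)
    fix t
    have "\<bar>u1 t\<bar> \<le> sqrt ((u1 t)\<^sup>2 + (u2 t)\<^sup>2)" "\<bar>u2 t\<bar> \<le> sqrt ((u1 t)\<^sup>2 + (u2 t)\<^sup>2)"
      by (auto simp: real_le_rsqrt)
    then show "\<bar>u1 t\<bar> + \<bar>u2 t\<bar> \<le> 2 * sqrt ((u1 t)\<^sup>2 + (u2 t)\<^sup>2)" by linarith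
  qed
  finally show ?thesis by (simp add: ctrl_length_def)
qed

lemma coordinate_increment_bound:
  assumes n: "n \<ge> 2" and h: "horizontal_with n a b \<gamma> u1 u2" and k: "k \<in> {1..n}" and t: "a \<le> t" "t \<le> b"
    and C: "\<And>s. s \<in> {t..b} \<Longrightarrow> \<bar>sk_field n (\<gamma> s 1) (sk (\<gamma> s)) (u1 s) (u2 s) k\<bar> \<le> C * (\<bar>u1 s\<bar> + \<bar>u2 s\<bar>)" and "0 \<le> C"
  shows "\<bar>\<gamma> b k - \<gamma> t k\<bar> \<le> 2 * C * ctrl_length a b u1 u2"
proof -
  let ?f' = "\<lambda>s. sk_field n (\<gamma> s 1) (sk (\<gamma> s)) (u1 s) (u2 s) k"
  have ui: "u1 absolutely_integrable_on {a..b}" "u2 absolutely_integrable_on {a..b}"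
    and ac: "abs_cont_on a b (\<lambda>t. \<gamma> t k)" and fil: "\<And>s. s \<in> {a..b} \<Longrightarrow> \<gamma> s \<in> filiform n"
    using h k by (auto simp: horizontal_with_def)
  have "AE s in lebesgue. s \<in> {a..b} \<longrightarrow> ((\<lambda>s. \<gamma> s k) has_real_derivative ?f' s) (at s within {a..b})"
  proof -
    have "AE t in lebesgue. t \<in> {a..b} \<longrightarrow> (\<forall>k\<in>{1..n}. ((\<lambda>s. \<gamma> s k) has_real_derivative
           u1 t * left_inv_field n (basis_vec 1) (\<gamma> t) k +
           u2 t * left_inv_field n (basis_vec 2) (\<gamma> t) k) (at t within {a..b}))"
      using h by (simp add: horizontal_with_def)
    then show ?thesis
      by (rule AE_mp) (use k left_inv_field_combination[OF n fil] in \<open>auto intro!: AE_I2\<close>)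
  qed
  then obtain N where N: "{s \<in> space lebesgue. \<not> (s \<in> {a..b} \<longrightarrow> ((\<lambda>s. \<gamma> s k) has_real_derivative ?f' s) (at s within {a..b}))} \<subseteq> N"
    "N \<in> null_sets lebesgue" by (auto elim!: AE_E simp: null_sets_def)
  have "(?f' has_integral \<gamma> b k - \<gamma> t k) {t..b}"
  proof (rule abs_cont_has_integral)
    show "abs_cont_on t b (\<lambda>t. \<gamma> t k)" using abs_cont_on_subinterval[OF ac] t by simp
    show "negligible N" using N(2) by (simp add: negligible_iff_null_sets)
    fix s assume "s \<in> {t..b} - N"
    then have "s \<in> {a..b}" "s \<notin> N" using t by auto
    then have "((\<lambda>s. \<gamma> s k) has_real_derivative ?f' s) (at s within {a..b})" using N(1) by (auto simp: subset_iff)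
    then show "((\<lambda>s. \<gamma> s k) has_real_derivative ?f' s) (at s within {t..b})"
      by (rule DERIV_subset) (use t in auto)
  qed (use t in auto)
  then have f': "?f' integrable_on {t..b}" "integral {t..b} ?f' = \<gamma> b k - \<gamma> t k" by (auto simp: has_integral_iff)
  have i: "(\<lambda>s. \<bar>u1 s\<bar> + \<bar>u2 s\<bar>) integrable_on {t..b}"
    by (rule integrable_on_subinterval[of _ "{a..b}"])
      (use ui t in \<open>auto intro!: integrable_add simp: absolutely_integrable_on_def\<close>)
  have "\<bar>\<gamma> b k - \<gamma> t k\<bar> \<le> integral {t..b} (\<lambda>s. C * (\<bar>u1 s\<bar> + \<bar>u2 s\<bar>))"
    using integral_norm_bound_integral[OF f'(1) integrable_on_mult_right[OF i, of C]] C f'(2) by simp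
  also have "\<dots> = C * integral {t..b} (\<lambda>s. \<bar>u1 s\<bar> + \<bar>u2 s\<bar>)" by simp
  also have "\<dots> \<le> C * (2 * ctrl_length a b u1 u2)"
    using integral_controls_le[OF ui t] \<open>0 \<le> C\<close> by (rule mult_left_mono)
  finally show ?thesis by simp
qed

text \<open>
  A point of norm at most 1 is joined to 0 by a curve of length less than 2. By induction on \<open>k\<close>, the
  coordinates of index less than \<open>k\<close> are bounded along all such curves, so the derivative of the
  coordinate \<open>k\<close> is bounded by a constant times the speed, and integration bounds the coordinate.
\<close>

lemma cc_ball_coordinates_bounded:
  assumes n: "n \<ge> 2"
  shows "\<exists>M\<ge>0. \<forall>u. cc_norm n u \<le> 1 \<longrightarrow> (\<forall>k\<le>n. \<bar>u k\<bar> \<le> M)"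
proof -
  define V where "V = {\<gamma> t | \<gamma> t a b u1 u2. horizontal_with n a b \<gamma> u1 u2 \<and> \<gamma> b = (\<lambda>k. 0) \<and>
      ctrl_length a b u1 u2 < 2 \<and> a \<le> t \<and> t \<le> b}"
  have VI: "\<gamma> t \<in> V" if "horizontal_with n a b \<gamma> u1 u2" "\<gamma> b = (\<lambda>k. 0)" "ctrl_length a b u1 u2 < 2" "a \<le> t" "t \<le> b"
    for \<gamma> t a b u1 u2 using that unfolding V_def by blast
  have *: "\<exists>M\<ge>0. \<forall>x\<in>V. \<forall>j<m. \<bar>x j\<bar> \<le> M" for m
  proof (induction m)
    case 0 show ?case by auto
  next
    case (Suc k)
    then obtain M where M: "M \<ge> 0" "\<And>x j. x \<in> V \<Longrightarrow> j < k \<Longrightarrow> \<bar>x j\<bar> \<le> M" by blast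
    define S where "S = (\<Sum>j=0..k. M ^ j * M)"
    have S: "0 \<le> S" unfolding S_def using M(1) by (intro sum_nonneg) auto
    define C where "C = field_bound k M S"
    have C: "1 \<le> C" unfolding C_def using M(1) S by (rule field_bound_ge_1)
    have xk: "\<bar>x k\<bar> \<le> 4 * C" if xV: "x \<in> V" for x
    proof -
      obtain a b \<gamma> u1 u2 t where x: "x = \<gamma> t" and h: "horizontal_with n a b \<gamma> u1 u2" and 0: "\<gamma> b = (\<lambda>k. 0)"
        and l: "ctrl_length a b u1 u2 < 2" and t: "a \<le> t" "t \<le> b"
        using xV unfolding V_def by blast
      show ?thesis
      proof (cases "k \<in> {1..n}")
        case False
        then have "\<gamma> t k = 0" using h t by (auto simp: horizontal_with_def filiform_def)
        then show ?thesis using C x by simp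
      next
        case True
        have "\<bar>\<gamma> b k - \<gamma> t k\<bar> \<le> 2 * C * ctrl_length a b u1 u2"
        proof (rule coordinate_increment_bound[OF n h True t])
          fix s assume s: "s \<in> {t..b}"
          then have sV: "\<gamma> s \<in> V" using h 0 l t by (intro VI) auto
          show "\<bar>sk_field n (\<gamma> s 1) (sk (\<gamma> s)) (u1 s) (u2 s) k\<bar> \<le> C * (\<bar>u1 s\<bar> + \<bar>u2 s\<bar>)"
            unfolding C_def
          proof (rule sk_field_bound[OF M(1) S])
            show "2 \<le> k \<Longrightarrow> \<bar>\<gamma> s 1\<bar> \<le> M" using M(2)[OF sV, of 1] by simp
            fix i assume i: "i + 2 < k"
            show "\<bar>fps_nth (sk (\<gamma> s)) i\<bar> \<le> S"
              unfolding S_def using i by (intro sk_nth_bound[OF M(1)] M(2)[OF sV]) auto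
          qed
        qed (use C in auto)
        also have "\<dots> \<le> 2 * C * 2" using l C by (intro mult_left_mono) auto
        finally show ?thesis using 0 x by simp
      qed
    qed
    have "\<bar>x j\<bar> \<le> max M (4 * C)" if "x \<in> V" "j < Suc k" for x j
      using M(2)[OF that(1), of j] xk[OF that(1)] that(2) by (cases "j = k") auto
    then show ?case using M(1) by (intro exI[of _ "max M (4 * C)"]) auto
  qed
  obtain M where M: "M \<ge> 0" "\<And>x j. x \<in> V \<Longrightarrow> j < Suc n \<Longrightarrow> \<bar>x j\<bar> \<le> M" using *[of "Suc n"] by blast
  show ?thesis
  proof (intro exI[of _ M] conjI allI impI)
    fix u k assume u: "cc_norm n u \<le> 1" and k: "k \<le> n"
    \<comment> \<open>The infimum need not be attained, so a curve of length less than 2 has to do.\<close>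
    have "cc_norm n u < ereal 2" using u by (rule le_less_trans) (simp add: one_ereal_def)
    then obtain a b \<gamma> u1 u2 where "a \<le> b" "horizontal_with n a b \<gamma> u1 u2" "\<gamma> a = u" "\<gamma> b = (\<lambda>k. 0)"
      "ctrl_length a b u1 u2 < 2"
      unfolding cc_norm_def cc_dist_def Inf_less_iff by auto
    then have "u \<in> V" using VI[of a b \<gamma> u1 u2 a] by simp
    then show "\<bar>u k\<bar> \<le> M" using M(2) k by simp
  qed (use M in auto)
qed

section \<open>Piecewise smooth horizontal curves\<close>

lemma lipschitz_abs_cont:
  assumes "\<And>x y. a \<le> x \<Longrightarrow> x \<le> y \<Longrightarrow> y \<le> b \<Longrightarrow> \<bar>f y - f x\<bar> \<le> B * (y - x)" "0 \<le> B"
  shows "abs_cont_on a b f"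
  unfolding abs_cont_on_def
proof (intro allI impI)
  fix e :: real assume "e > 0"
  show "\<exists>\<delta>>0. \<forall>D. finite D \<and> (\<forall>(c, d)\<in>D. a \<le> c \<and> c \<le> d \<and> d \<le> b) \<and>
        pairwise (\<lambda>p q. disjnt {fst p<..<snd p} {fst q<..<snd q}) D \<and> (\<Sum>(c, d)\<in>D. d - c) < \<delta> \<longrightarrow>
        (\<Sum>(c, d)\<in>D. \<bar>f d - f c\<bar>) < e"
  proof (intro exI[of _ "e / (B + 1)"] conjI allI impI)
    show "0 < e / (B + 1)" using \<open>e > 0\<close> assms(2) by simp
    fix D assume D: "finite D \<and> (\<forall>(c, d)\<in>D. a \<le> c \<and> c \<le> d \<and> d \<le> b) \<and>
        pairwise (\<lambda>p q. disjnt {fst p<..<snd p} {fst q<..<snd q}) D \<and> (\<Sum>(c, d)\<in>D. d - c) < e / (B + 1)"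
    then have *: "(\<Sum>(c, d)\<in>D. d - c) < e / (B + 1)" "\<And>z. z \<in> D \<Longrightarrow> a \<le> fst z \<and> fst z \<le> snd z \<and> snd z \<le> b" by auto
    have "(\<Sum>(c, d)\<in>D. \<bar>f d - f c\<bar>) \<le> (\<Sum>(c, d)\<in>D. B * (d - c))"
      unfolding split_def using assms(1) *(2) by (intro sum_mono) auto
    also have "\<dots> = B * (\<Sum>(c, d)\<in>D. d - c)" by (simp add: split_def sum_distrib_left)
    also have "\<dots> \<le> (B + 1) * (\<Sum>(c, d)\<in>D. d - c)"
      using *(2) by (intro mult_right_mono sum_nonneg) (auto simp: split_def)
    also have "\<dots> < e" using *(1) assms(2) by (simp add: field_simps)
    finally show "(\<Sum>(c, d)\<in>D. \<bar>f d - f c\<bar>) < e" .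
  qed
qed

text \<open>
  A curve of speed at most \<open>L\<close>, given in coordinates of the second kind, that is horizontal with
  controls \<open>\<alpha>\<close>, \<open>\<beta>\<close> off the finite set \<open>F\<close>.
\<close>

definition sk_curve :: "nat \<Rightarrow> real \<Rightarrow> (real \<Rightarrow> real) \<Rightarrow> (real \<Rightarrow> real fps) \<Rightarrow> real set \<Rightarrow>
    (real \<Rightarrow> real) \<Rightarrow> (real \<Rightarrow> real) \<Rightarrow> (real \<Rightarrow> vec) \<Rightarrow> bool" where
  "sk_curve n L a p F \<alpha> \<beta> g \<longleftrightarrow> finite F \<and> (\<forall>t. g t = of_sk n (a t) (p t)) \<and>
     continuous_on UNIV a \<and> (\<forall>i. continuous_on UNIV (\<lambda>t. fps_nth (p t) i)) \<and>
     \<alpha> \<in> borel_measurable borel \<and> \<beta> \<in> borel_measurable borel \<and>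
     (\<forall>t. sqrt ((\<alpha> t)\<^sup>2 + (\<beta> t)\<^sup>2) \<le> L) \<and>
     (\<forall>t. t \<notin> F \<longrightarrow> (a has_real_derivative \<alpha> t) (at t) \<and>
        (\<forall>i. ((\<lambda>s. fps_nth (p s) i) has_real_derivative \<beta> t * ((- a t) ^ i / fact i)) (at t)))"

text \<open>
  The distance is defined by curves from the first point to the second, so bounding it for points
  in the opposite order requires the reversed curve.
\<close>

lemma sk_curve_reverse:
  assumes "sk_curve n L a p F \<alpha> \<beta> g"
  shows "sk_curve n L (\<lambda>t. a (- t)) (\<lambda>t. p (- t)) (uminus ` F) (\<lambda>t. - \<alpha> (- t)) (\<lambda>t. - \<beta> (- t)) (\<lambda>t. g (- t))"
proof -
  have c: "continuous_on UNIV (\<lambda>t. f (- t))" if "continuous_on UNIV f" for f :: "real \<Rightarrow> real"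
    using that by (rule continuous_on_compose2) (auto intro!: continuous_intros)
  have d: "((\<lambda>s. f (- s)) has_real_derivative - D) (at t)" if "(f has_real_derivative D) (at (- t))" for f D and t :: real
  proof -
    have "((\<lambda>s. - s) has_real_derivative - 1) (at t)" by (auto intro!: derivative_eq_intros)
    from DERIV_chain2[OF that this] show ?thesis by simp
  qed
  have m: "(\<lambda>t. - f (- t)) \<in> borel_measurable borel" if "f \<in> borel_measurable borel" for f :: "real \<Rightarrow> real"
    using that by measurable
  have F: "- t \<notin> F" if "t \<notin> uminus ` F" for t using that by (metis add.inverse_inverse imageI)
  show ?thesis
    using assms unfolding sk_curve_def
    by (auto intro!: c d m dest!: F)
qed

lemma sk_curve_coordinate_lipschitz:
  assumes n: "n \<ge> 2" and g: "sk_curve n L a p F \<alpha> \<beta> g"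
  shows "\<exists>B\<ge>0. \<forall>x y. s \<le> x \<longrightarrow> x \<le> y \<longrightarrow> y \<le> e \<longrightarrow> \<bar>g y k - g x k\<bar> \<le> B * (y - x)"
proof -
  have gt: "g = (\<lambda>t. of_sk n (a t) (p t))" and ca: "continuous_on UNIV a" and cp: "\<And>i. continuous_on UNIV (\<lambda>t. fps_nth (p t) i)"
    and L: "\<And>t. sqrt ((\<alpha> t)\<^sup>2 + (\<beta> t)\<^sup>2) \<le> L" and F: "finite F"
    and da: "\<And>t. t \<notin> F \<Longrightarrow> (a has_real_derivative \<alpha> t) (at t)"
    and dp: "\<And>t i. t \<notin> F \<Longrightarrow> ((\<lambda>s. fps_nth (p s) i) has_real_derivative \<beta> t * ((- a t) ^ i / fact i)) (at t)"
    using g unfolding sk_curve_def by auto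
  have bdd: "\<exists>M\<ge>0. \<forall>t\<in>{s..e}. \<bar>f t\<bar> \<le> M" if "continuous_on UNIV f" for f :: "real \<Rightarrow> real"
  proof -
    have "bounded (f ` {s..e})"
      using that by (intro compact_imp_bounded compact_continuous_image) (auto intro: continuous_on_subset)
    then obtain M where "\<forall>t\<in>{s..e}. \<bar>f t\<bar> \<le> M" by (auto simp: bounded_iff)
    then show ?thesis by (intro exI[of _ "max M 0"]) auto
  qed
  obtain M where M: "M \<ge> 0" "\<And>t. t \<in> {s..e} \<Longrightarrow> \<bar>a t\<bar> \<le> M" using bdd[OF ca] by blast
  obtain S where S: "\<And>i. S i \<ge> 0" "\<And>i t. t \<in> {s..e} \<Longrightarrow> \<bar>fps_nth (p t) i\<bar> \<le> S i" using bdd[OF cp] by metis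
  define S' where "S' = (\<Sum>i<k. S i)"
  have S'0: "S' \<ge> 0" unfolding S'_def using S(1) by (intro sum_nonneg) auto
  have S': "\<bar>fps_nth (p t) i\<bar> \<le> S'" if "t \<in> {s..e}" "i + 2 < k" for t i
  proof -
    have "S i \<le> S'" unfolding S'_def using S(1) that(2) by (intro member_le_sum) auto
    then show ?thesis using S(2)[OF that(1), of i] by linarith
  qed
  define B where "B = field_bound k M S' * (L + L)"
  have fb: "field_bound k M S' \<ge> 1" using M(1) S'0 by (rule field_bound_ge_1)
  have \<alpha>\<beta>: "\<bar>\<alpha> t\<bar> \<le> L" "\<bar>\<beta> t\<bar> \<le> L" for t
  proof -
    have "\<bar>\<alpha> t\<bar> \<le> sqrt ((\<alpha> t)\<^sup>2 + (\<beta> t)\<^sup>2)" "\<bar>\<beta> t\<bar> \<le> sqrt ((\<alpha> t)\<^sup>2 + (\<beta> t)\<^sup>2)"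
      by (auto simp: real_le_rsqrt)
    then show "\<bar>\<alpha> t\<bar> \<le> L" "\<bar>\<beta> t\<bar> \<le> L" using L[of t] by linarith+
  qed
  have L0: "L \<ge> 0" using \<alpha>\<beta>(1)[of 0] by linarith
  have B0: "B \<ge> 0" unfolding B_def using fb L0 by simp
  have cont: "continuous_on UNIV (\<lambda>t. g t k)"
  proof (cases "2 \<le> k \<and> k \<le> n")
    case True
    then show ?thesis unfolding gt by (auto simp: of_sk_nth intro!: continuous_intros ca cp)
  next
    case False
    then have e: "(\<lambda>t. g t k) = (\<lambda>t. if k = 1 then a t else 0)" by (auto simp: gt of_sk_def ideal_vec_def)
    show ?thesis unfolding e using ca by (cases "k = 1") auto
  qed
  have "\<bar>g y k - g x k\<bar> \<le> B * (y - x)" if xy: "s \<le> x" "x \<le> y" "y \<le> e" for x y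
  proof -
    let ?f' = "\<lambda>t. sk_field n (a t) (p t) (\<alpha> t) (\<beta> t) k"
    have "(?f' has_integral (g y k - g x k)) {x..y}"
    proof (rule fundamental_theorem_of_calculus_interior_strong[OF F xy(2)])
      fix t assume "t \<in> {x<..<y} - F"
      then have "((\<lambda>t. g t k) has_real_derivative ?f' t) (at t)"
        unfolding gt by (intro has_derivative_of_sk da dp) auto
      then show "((\<lambda>t. g t k) has_vector_derivative ?f' t) (at t)"
        by (simp add: has_real_derivative_iff_has_vector_derivative)
    qed (use cont in \<open>auto intro: continuous_on_subset\<close>)
    moreover have "norm (?f' t) \<le> B" if "t \<in> cbox x y" for t
    proof -
      have t: "t \<in> {s..e}" using that xy by auto
      have "\<bar>?f' t\<bar> \<le> field_bound k M S' * (\<bar>\<alpha> t\<bar> + \<bar>\<beta> t\<bar>)"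
        using M t S' S'0 by (intro sk_field_bound) auto
      also have "\<dots> \<le> B" unfolding B_def using fb \<alpha>\<beta>[of t] by (intro mult_left_mono add_mono) auto
      finally show ?thesis by simp
    qed
    ultimately have "norm (g y k - g x k) \<le> B * measure lborel (cbox x y)"
      using B0 by (intro has_integral_bound[where f = ?f']) auto
    then show ?thesis using xy by simp
  qed
  then show ?thesis using B0 by blast
qed

lemma sk_curve_horizontal_with:
  assumes n: "n \<ge> 2" and g: "sk_curve n L a p F \<alpha> \<beta> g"
  shows "horizontal_with n s e g \<alpha> \<beta>"
  unfolding horizontal_with_def
proof (intro conjI ballI)
  have gt: "g = (\<lambda>t. of_sk n (a t) (p t))" and m: "\<alpha> \<in> borel_measurable borel" "\<beta> \<in> borel_measurable borel"
    and L: "\<And>t. sqrt ((\<alpha> t)\<^sup>2 + (\<beta> t)\<^sup>2) \<le> L" and F: "finite F"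
    and da: "\<And>t. t \<notin> F \<Longrightarrow> (a has_real_derivative \<alpha> t) (at t)"
    and dp: "\<And>t i. t \<notin> F \<Longrightarrow> ((\<lambda>s. fps_nth (p s) i) has_real_derivative \<beta> t * ((- a t) ^ i / fact i)) (at t)"
    using g unfolding sk_curve_def by auto
  have fil: "g t \<in> filiform n" for t unfolding gt using n by (intro of_sk_filiform) simp
  then show "g t \<in> filiform n" for t .
  show "abs_cont_on s e (\<lambda>t. g t k)" for k
    using sk_curve_coordinate_lipschitz[OF n g, of s e k] by (auto intro: lipschitz_abs_cont)
  have bnd: "\<bar>\<alpha> t\<bar> \<le> L" "\<bar>\<beta> t\<bar> \<le> L" for t
  proof -
    have "\<bar>\<alpha> t\<bar> \<le> sqrt ((\<alpha> t)\<^sup>2 + (\<beta> t)\<^sup>2)" "\<bar>\<beta> t\<bar> \<le> sqrt ((\<alpha> t)\<^sup>2 + (\<beta> t)\<^sup>2)"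
      by (auto simp: real_le_rsqrt)
    then show "\<bar>\<alpha> t\<bar> \<le> L" "\<bar>\<beta> t\<bar> \<le> L" using L[of t] by linarith+
  qed
  have ai: "f absolutely_integrable_on {s..e}" if "f \<in> borel_measurable borel" "\<And>t. \<bar>f t\<bar> \<le> L" for f :: "real \<Rightarrow> real"
  proof (rule measurable_bounded_by_integrable_imp_absolutely_integrable)
    show "f \<in> borel_measurable (lebesgue_on {s..e})"
      using that(1) by (simp add: measurable_completion measurable_restrict_space1)
    show "(\<lambda>t. L) integrable_on {s..e}" by (rule integrable_const_ivl)
  qed (use that in auto)
  show "\<alpha> absolutely_integrable_on {s..e}" "\<beta> absolutely_integrable_on {s..e}"
    using ai m bnd by auto
  have "((\<lambda>s. g s k) has_real_derivative u) (at t within {s..e})"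
    if "t \<notin> F" "u = \<alpha> t * left_inv_field n (basis_vec 1) (g t) k + \<beta> t * left_inv_field n (basis_vec 2) (g t) k" for t k u
  proof -
    have "((\<lambda>s. g s k) has_real_derivative sk_field n (a t) (p t) (\<alpha> t) (\<beta> t) k) (at t)"
      unfolding gt using that(1) by (intro has_derivative_of_sk da dp)
    moreover have "u = sk_field n (a t) (p t) (\<alpha> t) (\<beta> t) k"
      unfolding that(2) left_inv_field_combination[OF n fil] by (simp add: gt sk_field_of_sk)
    ultimately show ?thesis by (simp add: has_field_derivative_at_within)
  qed
  moreover have "F \<in> null_sets lebesgue"
    using F by (simp add: negligible_finite flip: negligible_iff_null_sets)
  ultimately show "AE t in lebesgue. t \<in> {s..e} \<longrightarrow> (\<forall>k\<in>{1..n}. ((\<lambda>s. g s k) has_real_derivative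
           \<alpha> t * left_inv_field n (basis_vec 1) (g t) k +
           \<beta> t * left_inv_field n (basis_vec 2) (g t) k) (at t within {s..e}))"
    by (intro AE_I'[of F]) auto
qed

lemma sk_curve_cc_dist:
  assumes n: "n \<ge> 2" and g: "sk_curve n L a p F \<alpha> \<beta> g" and "s \<le> e"
  shows "cc_dist n (g s) (g e) \<le> ereal (L * (e - s))"
proof -
  have h: "horizontal_with n s e g \<alpha> \<beta>" using sk_curve_horizontal_with[OF n g] .
  then have ai: "\<alpha> absolutely_integrable_on {s..e}" "\<beta> absolutely_integrable_on {s..e}"
    by (auto simp: horizontal_with_def)
  have "ctrl_length s e \<alpha> \<beta> \<le> integral {s..e} (\<lambda>t. L)"
    unfolding ctrl_length_def using g
    by (intro integral_le speed_integrable ai) (auto simp: sk_curve_def)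
  then have "ereal (ctrl_length s e \<alpha> \<beta>) \<le> ereal (L * (e - s))" using \<open>s \<le> e\<close> by (simp add: mult.commute)
  moreover have "cc_dist n (g s) (g e) \<le> ereal (ctrl_length s e \<alpha> \<beta>)"
    unfolding cc_dist_def using h \<open>s \<le> e\<close> by (intro Inf_lower) blast
  ultimately show ?thesis by (rule order_trans[rotated])
qed

lemma sk_curve_lipschitz:
  assumes n: "n \<ge> 2" and g: "sk_curve n L a p F \<alpha> \<beta> g"
  shows "cc_lipschitz_with n L g"
  unfolding cc_lipschitz_with_def
proof (intro conjI allI)
  have "sqrt ((\<alpha> 0)\<^sup>2 + (\<beta> 0)\<^sup>2) \<le> L" using g by (simp add: sk_curve_def)
  then show "0 \<le> L" by (meson order_trans real_sqrt_ge_zero sum_power2_ge_zero)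
  fix s t
  show "cc_dist n (g s) (g t) \<le> ereal (L * \<bar>s - t\<bar>)"
  proof (cases "s \<le> t")
    case True
    then show ?thesis using sk_curve_cc_dist[OF n g True] by simp
  next
    case False
    then have "- s \<le> - t" by simp
    from sk_curve_cc_dist[OF n sk_curve_reverse[OF g] this] False show ?thesis by (simp add: abs_if)
  qed
qed

lemma sk_curve_horizontal_curve:
  assumes n: "n \<ge> 2" and g: "sk_curve n L a p F \<alpha> \<beta> g"
  shows "horizontal_curve n g"
  unfolding horizontal_curve_def using sk_curve_horizontal_with[OF assms] by blast

section \<open>Weights with prescribed moments\<close>

text \<open>
  The weight of \<open>s\<close> is the linear functional \<open>z^i \<mapsto> m i\<close> applied to the Lagrange polynomial of \<open>s\<close>. It
  has the right moments because interpolation in \<open>n\<close> points reproduces \<open>z^i\<close> for \<open>i < n\<close>.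
\<close>

lemma moment_weights:
  fixes S :: "real set"
  assumes "finite S" "card S = n"
  shows "\<exists>B\<ge>0. \<forall>m. \<exists>\<mu>. (\<forall>i<n. (\<Sum>s\<in>S. \<mu> s * s ^ i) = m i) \<and> (\<forall>s\<in>S. \<bar>\<mu> s\<bar> \<le> B * (\<Sum>i<n. \<bar>m i\<bar>))"
proof -
  define q where "q s = (\<Prod>t\<in>S - {s}. [:- t, 1:])" for s
  define lg where "lg s = smult (1 / poly (q s) s) (q s)" for s
  have q0: "poly (q s) s \<noteq> 0" for s
    using assms(1) by (auto simp: q_def poly_prod)
  have lg: "poly (lg s) t = (if t = s then 1 else 0)" if "s \<in> S" "t \<in> S" for s t
  proof (cases "t = s")
    case True then show ?thesis using q0 by (simp add: lg_def)
  next
    case False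
    have "poly (q s) t = 0" unfolding q_def poly_prod using that False assms(1) by (intro prod_zero) auto
    then show ?thesis using False by (simp add: lg_def)
  qed
  have deg: "degree (lg s) < n" if "s \<in> S" for s
  proof -
    have "degree (q s) \<le> (\<Sum>t\<in>S - {s}. degree [:- t, 1:])" unfolding q_def
      using degree_prod_sum_le[of "S - {s}" "\<lambda>t. [:- t, 1:]"] assms by (simp only: o_def finite_Diff)
    also have "\<dots> = card S - 1" using assms(1) that by simp
    also have "\<dots> < n" using assms that by (metis card_gt_0_iff diff_less empty_iff zero_less_one)
    finally show ?thesis unfolding lg_def using degree_smult_le le_less_trans by blast
  qed
  have interp: "(\<Sum>s\<in>S. smult (s ^ j) (lg s)) = monom 1 j" if "j < n" for j
  proof (rule ccontr)
    let ?r = "(\<Sum>s\<in>S. smult (s ^ j) (lg s)) - monom 1 j"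
    assume "\<not> ?thesis"
    then have r: "?r \<noteq> 0" by simp
    have "degree (\<Sum>s\<in>S. smult (s ^ j) (lg s)) < n"
      using that deg by (intro degree_sum_less) (auto intro: le_less_trans[OF degree_smult_le])
    then have "degree ?r < n" using that by (intro degree_diff_less) (auto simp: degree_monom_eq)
    moreover have "poly ?r t = 0" if "t \<in> S" for t
    proof -
      have "(\<Sum>s\<in>S. s ^ j * poly (lg s) t) = (\<Sum>s\<in>S. if s = t then s ^ j else 0)"
        using that by (intro sum.cong) (auto simp: lg)
      then show ?thesis using that assms(1) by (simp add: poly_sum poly_monom)
    qed
    then have "card S \<le> card {t. poly ?r t = 0}" using poly_roots_finite[OF r] by (intro card_mono) auto
    ultimately show False using card_poly_roots_bound[OF r] assms(2) by simp
  qed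
  define B where "B = (\<Sum>s\<in>S. \<Sum>i<n. \<bar>coeff (lg s) i\<bar>)"
  show ?thesis
  proof (intro exI[of _ B] conjI allI)
    show "0 \<le> B" unfolding B_def by (intro sum_nonneg) auto
    fix m :: "nat \<Rightarrow> real"
    let ?\<mu> = "\<lambda>s. \<Sum>i<n. coeff (lg s) i * m i"
    show "\<exists>\<mu>. (\<forall>i<n. (\<Sum>s\<in>S. \<mu> s * s ^ i) = m i) \<and> (\<forall>s\<in>S. \<bar>\<mu> s\<bar> \<le> B * (\<Sum>i<n. \<bar>m i\<bar>))"
    proof (intro exI[of _ ?\<mu>] conjI allI impI ballI)
      fix j assume j: "j < n"
      have "(\<Sum>s\<in>S. ?\<mu> s * s ^ j) = (\<Sum>i<n. m i * coeff (\<Sum>s\<in>S. smult (s ^ j) (lg s)) i)"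
        by (simp add: coeff_sum sum_distrib_left sum_distrib_right mult_ac) (rule sum.swap)
      also have "\<dots> = (\<Sum>i<n. if i = j then m i else 0)" unfolding interp[OF j] by (intro sum.cong) auto
      also have "\<dots> = m j" using j by simp
      finally show "(\<Sum>s\<in>S. ?\<mu> s * s ^ j) = m j" .
    next
      fix s assume s: "s \<in> S"
      have "\<bar>?\<mu> s\<bar> \<le> (\<Sum>i<n. \<bar>coeff (lg s) i\<bar> * \<bar>m i\<bar>)" by (rule order_trans[OF sum_abs]) (simp add: abs_mult)
      also have "\<dots> \<le> (\<Sum>i<n. B * \<bar>m i\<bar>)"
      proof (intro sum_mono mult_right_mono)
        fix i assume "i \<in> {..<n}"
        then have "\<bar>coeff (lg s) i\<bar> \<le> (\<Sum>i<n. \<bar>coeff (lg s) i\<bar>)" by (intro member_le_sum) auto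
        also have "\<dots> \<le> B" unfolding B_def using s assms(1)
          by (intro member_le_sum[where f = "\<lambda>s. \<Sum>i<n. \<bar>coeff (lg s) i\<bar>"]) (auto intro: sum_nonneg)
        finally show "\<bar>coeff (lg s) i\<bar> \<le> B" .
      qed auto
      finally show "\<bar>?\<mu> s\<bar> \<le> B * (\<Sum>i<n. \<bar>m i\<bar>)" by (simp add: sum_distrib_left)
    qed
  qed
qed

text \<open>
  The form in which moments enter the construction: total weight 0 means that the slope is back to
  its original value after the last jump, and the other sums are, up to the sign, the changes of
  the coordinates of the second kind. The bound is uniform in \<open>a1\<close> as long as \<open>\<bar>a1\<bar>\<close> stays away from 0.
\<close>

lemma kink_weights:
  fixes S :: "real set" and c :: real
  assumes "finite S" "card S = n" "0 < c" "c \<le> 1"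
  shows "\<exists>B\<ge>0. \<forall>a1 m \<delta>. c \<le> \<bar>a1\<bar> \<longrightarrow> (\<forall>i. i + 2 \<le> n \<longrightarrow> \<bar>m i\<bar> \<le> \<delta>) \<longrightarrow> 0 \<le> \<delta> \<longrightarrow>
     (\<exists>w. (n > 0 \<longrightarrow> (\<Sum>s\<in>S. w s) = 0) \<and> (\<forall>i. i + 2 \<le> n \<longrightarrow> (\<Sum>s\<in>S. w s * ((- a1) ^ i * s ^ Suc i / fact (Suc i))) = m i)
        \<and> (\<forall>s\<in>S. \<bar>w s\<bar> \<le> B * \<delta>))"
proof -
  obtain B where B: "B \<ge> 0" "\<And>m. \<exists>\<mu>. (\<forall>i<n. (\<Sum>s\<in>S. \<mu> s * s ^ i) = m i) \<and> (\<forall>s\<in>S. \<bar>\<mu> s\<bar> \<le> B * (\<Sum>i<n. \<bar>m i\<bar>))"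
    using moment_weights[OF assms(1,2)] by blast
  define B' where "B' = B * (real n * (fact n / c ^ n))"
  show ?thesis
  proof (intro exI[of _ B'] conjI allI impI)
    show "0 \<le> B'" unfolding B'_def using B(1) assms(3) by simp
    fix a1 \<delta> :: real and m :: "nat \<Rightarrow> real"
    assume a1: "c \<le> \<bar>a1\<bar>" and m: "\<forall>i. i + 2 \<le> n \<longrightarrow> \<bar>m i\<bar> \<le> \<delta>" and \<delta>: "0 \<le> \<delta>"
    define m' where "m' i = (case i of 0 \<Rightarrow> 0 | Suc j \<Rightarrow> m j * fact (Suc j) / (- a1) ^ j)" for i
    from B(2)[of m'] obtain w where w: "\<And>i. i < n \<Longrightarrow> (\<Sum>s\<in>S. w s * s ^ i) = m' i"
      "\<And>s. s \<in> S \<Longrightarrow> \<bar>w s\<bar> \<le> B * (\<Sum>i<n. \<bar>m' i\<bar>)" by blast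
    have "a1 \<noteq> 0" using a1 assms(3) by auto
    have "\<bar>m' i\<bar> \<le> fact n / c ^ n * \<delta>" if "i < n" for i
    proof (cases i)
      case 0 then show ?thesis using \<delta> assms(3) by (simp add: m'_def)
    next
      case (Suc j)
      have "c ^ n \<le> c ^ j" using Suc that assms(3,4) by (intro power_decreasing) auto
      also have "\<dots> \<le> \<bar>a1\<bar> ^ j" using a1 assms(3) by (intro power_mono) auto
      finally have c: "c ^ n \<le> \<bar>a1\<bar> ^ j" .
      have "\<bar>m' i\<bar> = \<bar>m j\<bar> * fact (Suc j) / \<bar>a1\<bar> ^ j"
        using Suc by (simp add: m'_def abs_mult power_abs del: fact_Suc)
      also have "\<dots> \<le> \<delta> * fact n / c ^ n"
        using c m Suc that assms(3) \<delta> by (intro frac_le mult_mono fact_mono) (auto simp del: fact_Suc)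
      finally show ?thesis by (simp add: mult.commute)
    qed
    then have "(\<Sum>i<n. \<bar>m' i\<bar>) \<le> (\<Sum>i<n. fact n / c ^ n * \<delta>)" by (intro sum_mono) auto
    then have "B * (\<Sum>i<n. \<bar>m' i\<bar>) \<le> B * (\<Sum>i<n. fact n / c ^ n * \<delta>)" using B(1) by (rule mult_left_mono)
    also have "\<dots> = B' * \<delta>" by (simp add: B'_def)
    finally have bnd: "B * (\<Sum>i<n. \<bar>m' i\<bar>) \<le> B' * \<delta>" .
    show "\<exists>w. (n > 0 \<longrightarrow> (\<Sum>s\<in>S. w s) = 0) \<and> (\<forall>i. i + 2 \<le> n \<longrightarrow> (\<Sum>s\<in>S. w s * ((- a1) ^ i * s ^ Suc i / fact (Suc i))) = m i)
        \<and> (\<forall>s\<in>S. \<bar>w s\<bar> \<le> B' * \<delta>)"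
    proof (intro exI[of _ w] conjI allI impI ballI)
      show "(\<Sum>s\<in>S. w s) = 0" if "n > 0" using w(1)[of 0] that by (simp add: m'_def)
      show "\<bar>w s\<bar> \<le> B' * \<delta>" if "s \<in> S" for s using w(2)[OF that] bnd by linarith
      fix i assume i: "i + 2 \<le> n"
      have "(\<Sum>s\<in>S. w s * ((- a1) ^ i * s ^ Suc i / fact (Suc i))) = (- a1) ^ i / fact (Suc i) * (\<Sum>s\<in>S. w s * s ^ Suc i)"
        unfolding sum_distrib_left by (intro sum.cong refl) (simp add: mult_ac del: fact_Suc power_Suc)
      also have "\<dots> = (- a1) ^ i / fact (Suc i) * m' (Suc i)" using w(1)[of "Suc i"] i by simp
      also have "\<dots> = m i" using \<open>a1 \<noteq> 0\<close> by (simp add: m'_def del: fact_Suc)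
      finally show "(\<Sum>s\<in>S. w s * ((- a1) ^ i * s ^ Suc i / fact (Suc i))) = m i" .
    qed
  qed
qed

section \<open>Kinked horizontal lines\<close>

text \<open>
  A line of direction \<open>(a1, a2)\<close> whose slope jumps by \<open>w s / a1\<close> at the position \<open>l s\<close>, for each \<open>s\<close> in
  \<open>K\<close>. Positions are values of \<open>x_1 / a1\<close>. As a function of the position \<open>x\<close>, the quantity
  \<open>max x (l s) - l s\<close> is a ramp starting at \<open>l s\<close>, so that all quantities belonging to the curve are
  explicit sums over \<open>K\<close>. Smallness of \<open>w\<close> makes the component along \<open>(a1, a2)\<close> increase with the position.
\<close>

locale kinked_line =
  fixes n :: nat and a1 a2 l :: real and K :: "real set" and w :: "real \<Rightarrow> real"
  assumes n: "n \<ge> 2" and a1: "a1 \<noteq> 0" and unit: "a1\<^sup>2 + a2\<^sup>2 = 1" and finK: "finite K"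
    and small: "(\<Sum>s\<in>K. \<bar>w s\<bar>) \<le> 1 / 2"
begin

text \<open>
  The component of the planar projection along \<open>(a1, a2)\<close> at position \<open>x\<close>. The curve is parametrised by
  it, so \<open>T\<close> is also the time at which the position \<open>x\<close> is reached.
\<close>

definition T :: "real \<Rightarrow> real" where
  "T x = x + a2 * (\<Sum>s\<in>K. w s * (max x (l * s) - l * s))"

definition below :: "real \<Rightarrow> real set" where
  "below x = {s \<in> K. l * s < x}"

definition turn :: "real set \<Rightarrow> real" where
  "turn A = (\<Sum>s\<in>A. w s)"

lemma below_subset: "below x \<subseteq> K" by (auto simp: below_def)

lemma abs_a: "\<bar>a1\<bar> \<le> 1" "\<bar>a2\<bar> \<le> 1"
proof -
  have "a1\<^sup>2 \<le> 1" "a2\<^sup>2 \<le> 1" using unit zero_le_power2[of a1] zero_le_power2[of a2] by linarith+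
  then show "\<bar>a1\<bar> \<le> 1" "\<bar>a2\<bar> \<le> 1" by (simp_all add: abs_square_le_1)
qed

lemma abs_turn_le: "A \<subseteq> K \<Longrightarrow> \<bar>turn A\<bar> \<le> (\<Sum>s\<in>K. \<bar>w s\<bar>)"
  unfolding turn_def using finK by (intro order_trans[OF sum_abs] sum_mono2) auto

lemma abs_a2_turn_le: "A \<subseteq> K \<Longrightarrow> \<bar>a2 * turn A\<bar> \<le> 1 / 2"
proof -
  assume A: "A \<subseteq> K"
  have "\<bar>turn A\<bar> \<le> 1 / 2" using abs_turn_le[OF A] small by linarith
  then have "\<bar>a2\<bar> * \<bar>turn A\<bar> \<le> 1 * (1 / 2)" using abs_a by (intro mult_mono) auto
  then show ?thesis by (simp add: abs_mult)
qed

lemma sum_below: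
  assumes "\<And>s. s \<in> K \<Longrightarrow> x \<le> l * s \<Longrightarrow> f s (l * s) = 0"
  shows "(\<Sum>s\<in>K. f s (max x (l * s))) = (\<Sum>s\<in>below x. f s x :: real)"
  using assms finK by (intro sum.mono_neutral_cong_right) (auto simp: below_def max_def)

lemma T_below: "T x = x + a2 * (\<Sum>s\<in>below x. w s * (x - l * s))"
  unfolding T_def using sum_below[of x "\<lambda>s y. w s * (y - l * s)"] by simp

lemma T_increase:
  assumes "x \<le> y" shows "y - x \<le> 2 * (T y - T x)"
proof -
  define \<Sigma> where "\<Sigma> = (\<Sum>s\<in>K. w s * (max y (l * s) - max x (l * s)))"
  have "\<bar>\<Sigma>\<bar> \<le> (\<Sum>s\<in>K. \<bar>w s\<bar> * (y - x))"
    unfolding \<Sigma>_def using assms by (intro order_trans[OF sum_abs] sum_mono) (auto simp: abs_mult intro!: mult_left_mono)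
  also have "\<dots> \<le> 1 / 2 * (y - x)"
    unfolding sum_distrib_right[symmetric] using assms small by (intro mult_right_mono) auto
  finally have "\<bar>a2\<bar> * \<bar>\<Sigma>\<bar> \<le> 1 * (1 / 2 * (y - x))" using abs_a by (intro mult_mono) auto
  then have "\<bar>a2 * \<Sigma>\<bar> \<le> (y - x) / 2" by (simp add: abs_mult)
  then have "- ((y - x) / 2) \<le> a2 * \<Sigma>" by (simp only: abs_le_iff minus_le_iff)
  then have "(y - x) + - ((y - x) / 2) \<le> (y - x) + a2 * \<Sigma>" by (rule add_left_mono)
  also have "\<dots> = T y - T x"
    by (simp add: T_def \<Sigma>_def algebra_simps sum_subtractf sum.distrib)
  finally show ?thesis by (simp add: field_simps)
qed

lemma T_continuous: "continuous_on S T"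
  unfolding T_def by (intro continuous_intros)

lemma T_surj: "\<exists>x. T x = t"
proof -
  obtain u v where uv: "0 \<le> u" "0 \<le> v" "t \<le> u" "- t \<le> u" "T 0 \<le> v" "- T 0 \<le> v"
    using abs_ge_zero abs_ge_self abs_ge_minus_self by metis
  define c where "c = 2 * (u + v)"
  have c: "- c \<le> 0" "0 \<le> c" using uv by (auto simp: c_def)
  have "c \<le> 2 * (T 0 - T (- c))" "c \<le> 2 * (T c - T 0)" using T_increase[OF c(1)] T_increase[OF c(2)] by simp_all
  then have "T (- c) \<le> t" "t \<le> T c" using uv by (auto simp: c_def)
  then show ?thesis using IVT'[of T "- c" t c] T_continuous c by auto
qed

lemma T_strict_mono: "strict_mono T"
proof (rule strict_monoI)
  fix x y :: real assume "x < y"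
  then show "T x < T y" using T_increase[of x y] by simp
qed

lemma T_inj: "inj T"
  using T_strict_mono by (rule strict_mono_imp_inj_on)

definition pos :: "real \<Rightarrow> real" where "pos = inv T"

lemma T_pos [simp]: "T (pos t) = t"
  unfolding pos_def using T_surj by (metis f_inv_into_f rangeI)

lemma pos_T [simp]: "pos (T x) = x"
  unfolding pos_def using T_inj by simp

lemma pos_mono: "s \<le> t \<Longrightarrow> pos s \<le> pos t"
  using strict_mono_less_eq[OF T_strict_mono, of "pos s" "pos t"] by simp

lemma pos_increase: "s \<le> t \<Longrightarrow> pos t - pos s \<le> 2 * (t - s)"
  using T_increase[OF pos_mono] by simp

lemma pos_lipschitz: "\<bar>pos t - pos s\<bar> \<le> 2 * \<bar>t - s\<bar>"
proof (cases "s \<le> t")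
  case True
  then show ?thesis using pos_mono[OF True] pos_increase[OF True] by simp
next
  case False
  then have "t \<le> s" by simp
  then show ?thesis using pos_mono[of t s] pos_increase[of t s] by simp
qed

lemma pos_continuous: "continuous_on S pos"
proof -
  have "2-lipschitz_on UNIV pos"
    using pos_lipschitz by (intro lipschitz_onI) (auto simp: dist_real_def abs_minus_commute)
  then show ?thesis using lipschitz_on_continuous_on continuous_on_subset by blast
qed

text \<open>
  As a function of the position, the coordinate \<open>i\<close> of the second kind along a curve with \<open>x_2' = 1\<close>.
\<close>

definition Q :: "nat \<Rightarrow> real \<Rightarrow> real" where "Q i x = gprim i (a1 * x) / a1"

definition P :: "nat \<Rightarrow> real \<Rightarrow> real" where
  "P i x = a2 * Q i x + (\<Sum>s\<in>K. w s * (Q i (max x (l * s)) - Q i (l * s)))"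

lemma P_below: "P i x = (a2 + turn (below x)) * Q i x - (\<Sum>s\<in>below x. w s * Q i (l * s))"
  unfolding P_def using sum_below[of x "\<lambda>s y. w s * (Q i y - Q i (l * s))"]
  by (simp add: turn_def algebra_simps sum_subtractf sum_distrib_left)

definition curve :: "real \<Rightarrow> vec" where
  "curve t = of_sk n (a1 * pos t) (Abs_fps (\<lambda>i. P i (pos t)))"

text \<open>
  The controls after the kinks in \<open>A\<close>. The velocity with respect to the position is
  \<open>(a1, a2 + turn A)\<close>; the common denominator normalises the component along \<open>(a1, a2)\<close> to 1.
\<close>

definition ctrl1 :: "real set \<Rightarrow> real" where "ctrl1 A = a1 / (1 + a2 * turn A)"

definition ctrl2 :: "real set \<Rightarrow> real" where "ctrl2 A = (a2 + turn A) / (1 + a2 * turn A)"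

definition start :: "real set \<Rightarrow> real" where
  "start A = a1 * (a2 * (\<Sum>s\<in>A. w s * (l * s))) / (1 + a2 * turn A)"

lemma turn_denom: "A \<subseteq> K \<Longrightarrow> 1 / 2 \<le> 1 + a2 * turn A"
  using abs_a2_turn_le[of A] by linarith

lemma ctrl1_nonzero: "A \<subseteq> K \<Longrightarrow> ctrl1 A \<noteq> 0"
  using turn_denom[of A] a1 by (auto simp: ctrl1_def)

lemma ctrl_ratio: "A \<subseteq> K \<Longrightarrow> ctrl2 A / ctrl1 A = (a2 + turn A) / a1"
  using turn_denom[of A] a1 by (simp add: ctrl1_def ctrl2_def)

lemma pos_affine:
  assumes "below (pos t) = A"
  shows "a1 * pos t = start A + t * ctrl1 A"
proof -
  have A: "1 / 2 \<le> 1 + a2 * turn A" using turn_denom below_subset assms by blast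
  have "t = pos t + a2 * (\<Sum>s\<in>A. w s * (pos t - l * s))"
    using T_below[of "pos t"] assms by simp
  also have "\<dots> = (1 + a2 * turn A) * pos t - a2 * (\<Sum>s\<in>A. w s * (l * s))"
    by (simp add: turn_def algebra_simps sum_subtractf sum_distrib_left)
  finally have "(1 + a2 * turn A) * pos t = t + a2 * (\<Sum>s\<in>A. w s * (l * s))" by linarith
  then have "pos t = (t + a2 * (\<Sum>s\<in>A. w s * (l * s))) / (1 + a2 * turn A)"
    using A by (simp add: field_simps)
  then show ?thesis by (simp add: start_def ctrl1_def add_divide_distrib distrib_left)
qed

definition shift :: "real set \<Rightarrow> nat \<Rightarrow> real" where
  "shift A i = - (\<Sum>s\<in>A. w s * Q i (l * s))"

lemma P_affine:
  assumes "below (pos t) = A"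
  shows "P i (pos t) = shift A i + ctrl2 A / ctrl1 A * gprim i (start A + t * ctrl1 A)"
proof -
  have A: "A \<subseteq> K" using below_subset assms by blast
  show ?thesis
    unfolding P_below assms shift_def ctrl_ratio[OF A] Q_def pos_affine[OF assms] by simp
qed

lemma curve_eq_line:
  assumes "below (pos t) = A"
  shows "curve t = of_sk n (start A + t * ctrl1 A)
     (Abs_fps (\<lambda>i. shift A i + ctrl2 A / ctrl1 A * gprim i (start A + t * ctrl1 A)))"
  unfolding curve_def P_affine[OF assms] pos_affine[OF assms] ..

text \<open>
  The set of kinks already passed determines the line that the curve follows. Its level sets are
  intervals, since the position increases with time.
\<close>

lemma joins_lines: "joins_horizontal_lines n (2 ^ card K) curve"
  unfolding joins_horizontal_lines_def
proof (intro exI conjI)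
  let ?c = "\<lambda>A. {t. below (pos t) = A}"
  let ?P = "?c ` range (\<lambda>t. below (pos t))"
  have sub: "range (\<lambda>t. below (pos t)) \<subseteq> Pow K" using below_subset by auto
  show fP: "finite ?P" using finite_subset[OF sub] finK by auto
  have "card ?P \<le> card (range (\<lambda>t. below (pos t)))" using finite_subset[OF sub] finK by (intro card_image_le) auto
  also have "\<dots> \<le> card (Pow K)" using finK sub by (intro card_mono) auto
  finally show "card ?P \<le> 2 ^ card K" using finK by (simp add: card_Pow)
  show "partition_on UNIV ?P"
    by (intro partition_onI) (auto simp: disjnt_def)
  show "\<forall>I\<in>?P. is_interval I \<and> (\<exists>h. horizontal_line n h \<and> (\<forall>t\<in>I. curve t = h t))"
  proof
    fix I assume "I \<in> ?P"
    then obtain A where I: "I = ?c A" and A: "A \<subseteq> K" using below_subset by auto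
    have "is_interval I"
      unfolding is_interval_1 I
    proof (intro ballI allI impI)
      fix s t u assume st: "s \<in> ?c A" "t \<in> ?c A" "s \<le> u \<and> u \<le> t"
      then have "pos s \<le> pos u" "pos u \<le> pos t" using pos_mono by auto
      then have "below (pos s) \<subseteq> below (pos u)" "below (pos u) \<subseteq> below (pos t)" by (auto simp: below_def)
      then show "u \<in> ?c A" using st by auto
    qed
    moreover have "\<forall>t\<in>I. curve t = of_sk n (start A + t * ctrl1 A)
        (Abs_fps (\<lambda>i. shift A i + ctrl2 A / ctrl1 A * gprim i (start A + t * ctrl1 A)))"
      using curve_eq_line I by blast
    ultimately show "is_interval I \<and> (\<exists>h. horizontal_line n h \<and> (\<forall>t\<in>I. curve t = h t))"
      using horizontal_line_graph[OF n ctrl1_nonzero[OF A]] by blast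
  qed
qed

definition breaks :: "real set" where "breaks = (\<lambda>s. T (l * s)) ` K"

lemma eventually_below_const:
  assumes "t \<notin> breaks"
  shows "\<forall>\<^sub>F t' in nhds t. below (pos t') = below (pos t)"
proof -
  have c: "(pos \<longlongrightarrow> pos t) (nhds t)"
    using pos_continuous[of UNIV] by (simp add: continuous_on_eq_continuous_at continuous_at tendsto_nhds_iff)
  have "\<forall>\<^sub>F t' in nhds t. l * s < pos t' \<longleftrightarrow> l * s < pos t" if s: "s \<in> K" for s
  proof -
    have "pos t \<noteq> l * s" using assms s T_pos[of t] unfolding breaks_def by (metis imageI)
    then consider "l * s < pos t" | "pos t < l * s" by linarith
    then show ?thesis
    proof cases
      case 1 from order_tendstoD(1)[OF c this] show ?thesis by eventually_elim (use 1 in auto)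
    next
      case 2 from order_tendstoD(2)[OF c this] show ?thesis by eventually_elim (use 2 in auto)
    qed
  qed
  then have "\<forall>\<^sub>F t' in nhds t. \<forall>s\<in>K. l * s < pos t' \<longleftrightarrow> l * s < pos t"
    using finK by (simp add: eventually_ball_finite)
  then show ?thesis by eventually_elim (auto simp: below_def)
qed

lemma curve_derivatives:
  assumes "t \<notin> breaks"
  defines "A \<equiv> below (pos t)"
  shows "((\<lambda>t. a1 * pos t) has_real_derivative ctrl1 A) (at t)"
    and "((\<lambda>t. P i (pos t)) has_real_derivative ctrl2 A * ((- (a1 * pos t)) ^ i / fact i)) (at t)"
proof -
  have ev: "\<forall>\<^sub>F t' in nhds t. below (pos t') = A" using eventually_below_const[OF assms(1)] by (simp add: A_def)
  have A: "A \<subseteq> K" using below_subset by (simp add: A_def)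
  have d: "((\<lambda>t. start A + t * ctrl1 A) has_real_derivative ctrl1 A) (at t)"
    by (auto intro!: derivative_eq_intros)
  have "\<forall>\<^sub>F t' in nhds t. a1 * pos t' = start A + t' * ctrl1 A"
    using ev by eventually_elim (rule pos_affine)
  from DERIV_cong_ev[OF refl this refl] show "((\<lambda>t. a1 * pos t) has_real_derivative ctrl1 A) (at t)"
    using d by simp
  have "\<forall>\<^sub>F t' in nhds t. P i (pos t') = shift A i + ctrl2 A / ctrl1 A * gprim i (start A + t' * ctrl1 A)"
    using ev by eventually_elim (rule P_affine)
  note e = DERIV_cong_ev[OF refl this refl]
  have "((\<lambda>t. gprim i (start A + t * ctrl1 A)) has_real_derivative
     ((- (start A + t * ctrl1 A)) ^ i / fact i) * ctrl1 A) (at t)"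
    using DERIV_chain2[OF gprim_deriv d] .
  from DERIV_cmult[OF this, of "ctrl2 A / ctrl1 A"]
  have "((\<lambda>t. ctrl2 A / ctrl1 A * gprim i (start A + t * ctrl1 A)) has_real_derivative
     ctrl2 A * ((- (a1 * pos t)) ^ i / fact i)) (at t)"
    using ctrl1_nonzero[OF A] pos_affine[of t A] by (simp add: A_def mult_ac)
  from DERIV_add[OF DERIV_const[of "shift A i"] this]
  show "((\<lambda>t. P i (pos t)) has_real_derivative ctrl2 A * ((- (a1 * pos t)) ^ i / fact i)) (at t)"
    unfolding e by simp
qed

lemma ctrl_deviation:
  assumes "A \<subseteq> K"
  shows "\<bar>ctrl1 A - a1\<bar> \<le> 2 * \<bar>turn A\<bar>" "\<bar>ctrl2 A - a2\<bar> \<le> 2 * \<bar>turn A\<bar>"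
proof -
  let ?d = "1 + a2 * turn A"
  have d: "1 / 2 \<le> ?d" using turn_denom[OF assms] .
  have b: "\<bar>c * turn A / ?d\<bar> \<le> 2 * \<bar>turn A\<bar>" if "\<bar>c\<bar> \<le> 1" for c
  proof -
    have "\<bar>c * turn A / ?d\<bar> = \<bar>c\<bar> * \<bar>turn A\<bar> / ?d" using d by (simp add: abs_mult)
    also have "\<dots> \<le> 1 * \<bar>turn A\<bar> / (1 / 2)"
      using d that by (intro frac_le mult_right_mono) auto
    finally show ?thesis by simp
  qed
  have "ctrl1 A - a1 = (- (a1 * a2)) * turn A / ?d" using d by (simp add: ctrl1_def field_simps)
  moreover have "\<bar>- (a1 * a2)\<bar> \<le> 1"
    using mult_mono[of "\<bar>a1\<bar>" 1 "\<bar>a2\<bar>" 1] abs_a by (simp add: abs_mult)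
  ultimately show "\<bar>ctrl1 A - a1\<bar> \<le> 2 * \<bar>turn A\<bar>" using b by metis
  have "ctrl2 A - a2 = (1 - a2\<^sup>2) * turn A / ?d" using d by (simp add: ctrl2_def field_simps power2_eq_square)
  moreover have "\<bar>1 - a2\<^sup>2\<bar> \<le> 1" using unit abs_a(1) zero_le_power2[of a1] zero_le_power2[of a2] by linarith
  ultimately show "\<bar>ctrl2 A - a2\<bar> \<le> 2 * \<bar>turn A\<bar>" using b by metis
qed

text \<open>
  The deviation of the velocity from the unit vector \<open>(a1, a2)\<close> is orthogonal to it, whence the speed
  exceeds 1 by a term that is quadratic in the weights only.
\<close>

lemma speed_bound:
  assumes "A \<subseteq> K"
  shows "sqrt ((ctrl1 A)\<^sup>2 + (ctrl2 A)\<^sup>2) \<le> 1 + 2 * (\<Sum>s\<in>K. \<bar>w s\<bar>)\<^sup>2"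
proof -
  let ?d = "1 + a2 * turn A" and ?k = "\<Sum>s\<in>K. \<bar>w s\<bar>"
  have d: "1 / 2 \<le> ?d" using turn_denom[OF assms] .
  have "(ctrl1 A)\<^sup>2 + (ctrl2 A)\<^sup>2 = (a1\<^sup>2 + (a2 + turn A)\<^sup>2) / ?d\<^sup>2"
    by (simp only: ctrl1_def ctrl2_def power_divide add_divide_distrib[symmetric])
  also have "a1\<^sup>2 + (a2 + turn A)\<^sup>2 = ?d\<^sup>2 + (a1 * turn A)\<^sup>2"
  proof -
    have "a1\<^sup>2 = 1 - a2\<^sup>2" using unit by simp
    then show ?thesis by (simp add: power_mult_distrib) (simp add: power2_eq_square algebra_simps)
  qed
  also have "(?d\<^sup>2 + (a1 * turn A)\<^sup>2) / ?d\<^sup>2 = 1 + (a1 * turn A / ?d)\<^sup>2"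
    using d by (simp add: add_divide_distrib power_divide)
  also have "\<dots> \<le> 1 + (2 * ?k)\<^sup>2"
  proof -
    have "\<bar>a1 * turn A / ?d\<bar> = \<bar>a1\<bar> * \<bar>turn A\<bar> / ?d" using d by (simp add: abs_mult)
    also have "\<dots> \<le> 1 * ?k / (1 / 2)"
      using d abs_a abs_turn_le[OF assms] by (intro frac_le mult_mono) auto
    finally have "\<bar>a1 * turn A / ?d\<bar> \<le> \<bar>2 * ?k\<bar>" by simp
    then show ?thesis by (intro add_left_mono) (rule abs_le_square_iff[THEN iffD1])
  qed
  also have "\<dots> \<le> (1 + 2 * ?k\<^sup>2)\<^sup>2"
    by (simp add: power2_eq_square algebra_simps)
  finally have "sqrt ((ctrl1 A)\<^sup>2 + (ctrl2 A)\<^sup>2) \<le> sqrt ((1 + 2 * ?k\<^sup>2)\<^sup>2)" by (rule real_sqrt_le_mono)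
  then show ?thesis by (simp add: add_nonneg_nonneg)
qed

lemma sk_curve_curve:
  "sk_curve n (1 + 2 * (\<Sum>s\<in>K. \<bar>w s\<bar>)\<^sup>2) (\<lambda>t. a1 * pos t) (\<lambda>t. Abs_fps (\<lambda>i. P i (pos t))) breaks
     (\<lambda>t. ctrl1 (below (pos t))) (\<lambda>t. ctrl2 (below (pos t))) curve"
  unfolding sk_curve_def
proof (intro conjI allI impI)
  show "finite breaks" using finK by (simp add: breaks_def)
  show "curve t = of_sk n (a1 * pos t) (Abs_fps (\<lambda>i. P i (pos t)))" for t by (simp add: curve_def)
  show "continuous_on UNIV (\<lambda>t. a1 * pos t)" by (intro continuous_intros pos_continuous)
  have Q: "continuous_on UNIV (Q i)" for i unfolding Q_def gprim_def by (intro continuous_intros) (auto simp: a1)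
  have "continuous_on UNIV (\<lambda>t. Q i (max (pos t) c))" for i c
    by (rule continuous_on_compose2[OF Q]) (intro continuous_intros pos_continuous, simp)
  moreover have "continuous_on UNIV (\<lambda>t. Q i (pos t))" for i
    by (rule continuous_on_compose2[OF Q]) (intro continuous_intros pos_continuous, simp)
  ultimately show "continuous_on UNIV (\<lambda>t. fps_nth (Abs_fps (\<lambda>i. P i (pos t))) i)" for i
    unfolding P_def fps_nth_Abs_fps by (intro continuous_intros) auto
  have pos_m [measurable]: "pos \<in> borel_measurable borel" using pos_continuous by (rule borel_measurable_continuous_onI)
  have "turn (below (pos t)) = (\<Sum>s\<in>K. if l * s < pos t then w s else 0)" for t
    unfolding turn_def below_def using finK by (simp add: sum.inter_filter)
  then have [measurable]: "(\<lambda>t. turn (below (pos t))) \<in> borel_measurable borel" by simp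
  show "(\<lambda>t. ctrl1 (below (pos t))) \<in> borel_measurable borel" "(\<lambda>t. ctrl2 (below (pos t))) \<in> borel_measurable borel"
    unfolding ctrl1_def ctrl2_def by measurable
  show "sqrt ((ctrl1 (below (pos t)))\<^sup>2 + (ctrl2 (below (pos t)))\<^sup>2) \<le> 1 + 2 * (\<Sum>s\<in>K. \<bar>w s\<bar>)\<^sup>2" for t
    by (rule speed_bound[OF below_subset])
  show "((\<lambda>t. a1 * pos t) has_real_derivative ctrl1 (below (pos t))) (at t)" if "t \<notin> breaks" for t
    using curve_derivatives(1)[OF that] .
  show "((\<lambda>s. fps_nth (Abs_fps (\<lambda>i. P i (pos s))) i) has_real_derivative
      ctrl2 (below (pos t)) * ((- (a1 * pos t)) ^ i / fact i)) (at t)" if "t \<notin> breaks" for t i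
    using curve_derivatives(2)[OF that] by simp
qed

lemma curve_2: "curve t 2 = P 0 (pos t)"
  using n by (simp add: curve_def of_sk_nth inv_phi_coeff_def)

lemma hproj_curve_derivative:
  assumes "t \<notin> breaks" "E 1 = a1" "E 2 = a2"
  shows "\<exists>D. ((\<lambda>s. hproj (curve s)) has_vector_derivative D) (at t) \<and> norm (D - hproj E) \<le> 4 * (\<Sum>s\<in>K. \<bar>w s\<bar>)"
proof (intro exI conjI)
  let ?A = "below (pos t)"
  have h: "hproj (curve s) = (a1 * pos s, P 0 (pos s))" for s
    unfolding hproj_def curve_2 by (simp add: curve_def)
  show "((\<lambda>s. hproj (curve s)) has_vector_derivative (ctrl1 ?A, ctrl2 ?A)) (at t)"
    unfolding h using curve_derivatives(1)[OF assms(1)] curve_derivatives(2)[OF assms(1), of 0]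
    by (intro has_vector_derivative_Pair) (simp_all add: has_real_derivative_iff_has_vector_derivative)
  have "norm ((ctrl1 ?A, ctrl2 ?A) - hproj E) \<le> \<bar>ctrl1 ?A - a1\<bar> + \<bar>ctrl2 ?A - a2\<bar>"
    using norm_Pair_le[of "ctrl1 ?A - a1" "ctrl2 ?A - a2"] assms by (simp add: hproj_def)
  also have "\<dots> \<le> 4 * (\<Sum>s\<in>K. \<bar>w s\<bar>)"
    using ctrl_deviation[OF below_subset] abs_turn_le[OF below_subset, of "pos t"] by (smt (verit))
  finally show "norm ((ctrl1 ?A, ctrl2 ?A) - hproj E) \<le> 4 * (\<Sum>s\<in>K. \<bar>w s\<bar>)" .
qed

text \<open>
  Before all kinks nothing has changed. After all kinks the two vanishing sums say that the slope
  and the component along \<open>(a1, a2)\<close> are those of the straight line again.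
\<close>

lemma T_outside:
  assumes "l > 0" "\<And>s. s \<in> K \<Longrightarrow> \<bar>s\<bar> \<le> 1" "(\<Sum>s\<in>K. w s) = 0" "(\<Sum>s\<in>K. w s * s) = 0" "l \<le> \<bar>t\<bar>"
  shows "pos t = t"
proof -
  have ls: "- l \<le> l * s" "l * s \<le> l" if "s \<in> K" for s
    using assms(1) assms(2)[OF that] mult_left_mono[of s 1 l] mult_left_mono[of "- 1" s l] by auto
  have "T t = t"
  proof (cases "0 \<le> t")
    case True
    then have "l \<le> t" using assms(5) by simp
    then have "max t (l * s) = t" if "s \<in> K" for s using ls[OF that] by simp
    then have "(\<Sum>s\<in>K. w s * (max t (l * s) - l * s)) = (\<Sum>s\<in>K. w s * (t - l * s))"
      by (intro sum.cong) auto
    also have "\<dots> = t * (\<Sum>s\<in>K. w s) - l * (\<Sum>s\<in>K. w s * s)"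
      by (simp add: sum_distrib_left sum_subtractf algebra_simps)
    finally show ?thesis unfolding T_def using assms(3,4) by simp
  next
    case False
    then have "t \<le> - l" using assms(5) by simp
    then have "max t (l * s) = l * s" if "s \<in> K" for s using ls[OF that] by simp
    then show ?thesis unfolding T_def by simp
  qed
  then show ?thesis using pos_T[of t] by simp
qed

lemma P_outside:
  assumes "l > 0" "\<And>s. s \<in> K \<Longrightarrow> \<bar>s\<bar> \<le> 1" "(\<Sum>s\<in>K. w s) = 0" "(\<Sum>s\<in>K. w s * Q i (l * s)) = 0" "l \<le> \<bar>t\<bar>"
  shows "P i t = a2 * Q i t"
proof -
  have ls: "- l \<le> l * s" "l * s \<le> l" if "s \<in> K" for s
    using assms(1) assms(2)[OF that] mult_left_mono[of s 1 l] mult_left_mono[of "- 1" s l] by auto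
  show ?thesis
  proof (cases "0 \<le> t")
    case True
    then have "l \<le> t" using assms(5) by simp
    then have "max t (l * s) = t" if "s \<in> K" for s using ls[OF that] by simp
    then have "(\<Sum>s\<in>K. w s * (Q i (max t (l * s)) - Q i (l * s))) = (\<Sum>s\<in>K. w s * (Q i t - Q i (l * s)))"
      by (intro sum.cong) auto
    also have "\<dots> = (\<Sum>s\<in>K. w s) * Q i t - (\<Sum>s\<in>K. w s * Q i (l * s))"
      by (simp add: right_diff_distrib sum_subtractf sum_distrib_right)
    finally show ?thesis unfolding P_def using assms(3,4) by simp
  next
    case False
    then have "t \<le> - l" using assms(5) by simp
    then have "max t (l * s) = l * s" if "s \<in> K" for s using ls[OF that] by simp
    then show ?thesis unfolding P_def by simp
  qed
qed

lemma Q_eq: "Q i x = (- a1) ^ i * x ^ Suc i / fact (Suc i)"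
proof -
  have "- (a1 * x) = (- a1) * x" by simp
  then have "(- (a1 * x)) ^ Suc i = (- a1) ^ Suc i * x ^ Suc i" by (simp only: power_mult_distrib)
  then have "- ((- (a1 * x)) ^ Suc i) = a1 * ((- a1) ^ i * x ^ Suc i)" by simp
  then have "gprim i (a1 * x) = a1 * ((- a1) ^ i * x ^ Suc i) / fact (Suc i)"
    unfolding gprim_def by (metis minus_divide_left)
  then show ?thesis unfolding Q_def using a1 by simp
qed

lemma Q_scale: "Q i (c * x) = c ^ Suc i * Q i x"
  unfolding Q_eq by (simp only: power_mult_distrib) (simp add: mult_ac)

lemma Q_0: "Q 0 x = x" by (simp add: Q_eq)

lemma vscale_horizontal:
  assumes "V \<in> horizontal_layer n" "V 1 = a1" "V 2 = a2"
  shows "vscale t V = of_sk n (a1 * t) (Abs_fps (\<lambda>i. a2 * Q i t))"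
proof -
  have v: "vscale t V \<in> filiform n" using assms(1) by (simp add: horizontal_layer_iff vscale_filiform)
  have "sk (vscale t V) = Abs_fps (\<lambda>i. a2 * Q i t)"
  proof (rule fps_ext)
    fix i
    have "- (t * a1) = (- a1) * t" by simp
    then have "(- (t * a1)) ^ i = (- a1) ^ i * t ^ i" by (simp only: power_mult_distrib)
    then have "t * (- (t * a1)) ^ i = (- a1) ^ i * t ^ Suc i" by simp
    then show "fps_nth (sk (vscale t V)) i = fps_nth (Abs_fps (\<lambda>i. a2 * Q i t)) i"
      unfolding sk_horizontal[OF assms(1)] using assms(2,3)
      by (simp add: phi_def Q_eq del: fact_Suc power_Suc)
  qed
  then show ?thesis using of_sk_sk[OF v] assms(2) by (simp add: vscale_def mult.commute)
qed

end

lemma sk_dilation: "fps_nth (sk (dilation r x)) i = r ^ Suc i * fps_nth (sk x) i"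
proof -
  have "fps_nth (sk (dilation r x)) i = (\<Sum>j=0..i. (- (r * x 1)) ^ j / fact (Suc j) * (r ^ (i - j + 1) * x (i - j + 2)))"
    by (simp add: sk_def fps_mult_nth phi_def hat_def dilation_def del: fact_Suc power_Suc)
  also have "\<dots> = (\<Sum>j=0..i. r ^ Suc i * ((- x 1) ^ j / fact (Suc j) * x (i - j + 2)))"
  proof (intro sum.cong refl)
    fix j assume "j \<in> {0..i}"
    then have "r ^ Suc i = r ^ j * r ^ (i - j + 1)" by (simp flip: power_add)
    moreover have "(- (r * x 1)) ^ j = r ^ j * (- x 1) ^ j"
      by (simp only: mult_minus_right[symmetric] power_mult_distrib)
    ultimately show "(- (r * x 1)) ^ j / fact (Suc j) * (r ^ (i - j + 1) * x (i - j + 2))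
       = r ^ Suc i * ((- x 1) ^ j / fact (Suc j) * x (i - j + 2))"
      by (simp del: fact_Suc power_Suc)
  qed
  also have "\<dots> = r ^ Suc i * fps_nth (sk x) i"
    by (simp add: sk_def fps_mult_nth phi_def hat_def sum_distrib_left del: fact_Suc power_Suc)
  finally show ?thesis .
qed

lemma cc_ball_sk_bounded:
  assumes "n \<ge> 2"
  shows "\<exists>M\<ge>0. \<forall>u. cc_norm n u \<le> 1 \<longrightarrow> \<bar>u 1\<bar> \<le> M \<and> (\<forall>i. i + 2 \<le> n \<longrightarrow> \<bar>fps_nth (sk u) i\<bar> \<le> M)"
proof -
  obtain M where M: "M \<ge> 0" "\<And>u k. cc_norm n u \<le> 1 \<Longrightarrow> k \<le> n \<Longrightarrow> \<bar>u k\<bar> \<le> M"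
    using cc_ball_coordinates_bounded[OF assms] by blast
  let ?S = "\<Sum>j=0..n. M ^ j * M"
  have S: "?S \<ge> 0" using M(1) by (intro sum_nonneg) auto
  have "\<bar>u 1\<bar> \<le> M + ?S" "\<And>i. i + 2 \<le> n \<Longrightarrow> \<bar>fps_nth (sk u) i\<bar> \<le> M + ?S" if u: "cc_norm n u \<le> 1" for u
  proof -
    have u1: "\<bar>u 1\<bar> \<le> M" using M(2)[OF u, of 1] assms by simp
    then show "\<bar>u 1\<bar> \<le> M + ?S" using S by linarith
    fix i assume i: "i + 2 \<le> n"
    have "\<bar>fps_nth (sk u) i\<bar> \<le> ?S" using i by (intro sk_nth_bound[where x = u, OF M(1) u1] M(2)[OF u]) auto
    then show "\<bar>fps_nth (sk u) i\<bar> \<le> M + ?S" using M(1) by linarith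
  qed
  then show ?thesis using M(1) S by (intro exI[of _ "M + ?S"]) auto
qed

section \<open>Deformability\<close>

text \<open>
  Half of the kinks lie at positions in \<open>[- l, - l / 2]\<close>, half in \<open>[l / 2, l]\<close>, and the target is
  at a position in between. The kinks on the left steer to the target, those on the right undo the
  effect of those on the left, so that the curve ends on the original line.
\<close>

lemma uniformly_deformable:
  assumes n: "n \<ge> 3" and c: "0 < c" "c \<le> 1"
  shows "\<exists>C N \<Delta>E. \<forall>E. E \<in> horizontal_layer n \<longrightarrow> hnorm E = 1 \<longrightarrow> c \<le> \<bar>E 1\<bar> \<longrightarrow> deformable_with n E C N \<Delta>E"
proof -
  have n2: "n \<ge> 2" using n by simp
  define SR where "SR = (\<lambda>j. 1 / 2 + real j / (2 * real n)) ` {..<n}"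
  define SL where "SL = uminus ` SR"
  define K where "K = SL \<union> SR"
  have SR: "finite SR" "card SR = n" "\<And>s. s \<in> SR \<Longrightarrow> 1 / 2 \<le> s \<and> s \<le> 1"
  proof -
    have "inj_on (\<lambda>j. 1 / 2 + real j / (2 * real n)) {..<n}" using n by (auto simp: inj_on_def)
    then show "card SR = n" by (simp add: SR_def card_image)
    show "1 / 2 \<le> s \<and> s \<le> 1" if "s \<in> SR" for s
      using that n by (auto simp: SR_def field_simps)
  qed (simp add: SR_def)
  have SL: "finite SL" "card SL = n" "\<And>s. s \<in> SL \<Longrightarrow> - 1 \<le> s \<and> s \<le> - 1 / 2"
    using SR by (auto simp: SL_def card_image)
  have disj: "SL \<inter> SR = {}" using SL(3) SR(3) by fastforce
  have K: "finite K" "card K = 2 * n" "\<And>s. s \<in> K \<Longrightarrow> \<bar>s\<bar> \<le> 1"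
    using SL SR card_Un_disjoint[OF SL(1) SR(1) disj] by (auto simp: K_def abs_le_iff) force+
  obtain BL where BL: "BL \<ge> 0" "\<And>a1 m \<delta>. c \<le> \<bar>a1\<bar> \<Longrightarrow> (\<forall>i. i + 2 \<le> n \<longrightarrow> \<bar>m i\<bar> \<le> \<delta>) \<Longrightarrow> 0 \<le> \<delta> \<Longrightarrow>
     (\<exists>w. (n > 0 \<longrightarrow> (\<Sum>s\<in>SL. w s) = 0) \<and> (\<forall>i. i + 2 \<le> n \<longrightarrow> (\<Sum>s\<in>SL. w s * ((- a1) ^ i * s ^ Suc i / fact (Suc i))) = m i)
        \<and> (\<forall>s\<in>SL. \<bar>w s\<bar> \<le> BL * \<delta>))" using kink_weights[OF SL(1,2) c] by blast
  obtain BR where BR: "BR \<ge> 0" "\<And>a1 m \<delta>. c \<le> \<bar>a1\<bar> \<Longrightarrow> (\<forall>i. i + 2 \<le> n \<longrightarrow> \<bar>m i\<bar> \<le> \<delta>) \<Longrightarrow> 0 \<le> \<delta> \<Longrightarrow>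
     (\<exists>w. (n > 0 \<longrightarrow> (\<Sum>s\<in>SR. w s) = 0) \<and> (\<forall>i. i + 2 \<le> n \<longrightarrow> (\<Sum>s\<in>SR. w s * ((- a1) ^ i * s ^ Suc i / fact (Suc i))) = m i)
        \<and> (\<forall>s\<in>SR. \<bar>w s\<bar> \<le> BR * \<delta>))" using kink_weights[OF SR(1,2) c] by blast
  obtain M where M: "M \<ge> 0" "\<And>u. cc_norm n u \<le> 1 \<Longrightarrow> \<bar>u 1\<bar> \<le> M"
    "\<And>u i. cc_norm n u \<le> 1 \<Longrightarrow> i + 2 \<le> n \<Longrightarrow> \<bar>fps_nth (sk u) i\<bar> \<le> M"
    using cc_ball_sk_bounded[OF n2] by blast
  define C0 where "C0 = M + M / c"
  define C1 where "C1 = real n * ((BL + BR) * C0)"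
  have C0: "C0 \<ge> 0" unfolding C0_def using M(1) c by simp
  have C1: "C1 \<ge> 0" unfolding C1_def using C0 BL(1) BR(1) by simp
  define \<Delta>E where "\<Delta>E = (\<lambda>\<eta>. min (min 1 (1 / (2 * (C1 + 1)))) (min (c / (2 * (M + 1))) (\<eta> / (2 * C1\<^sup>2 + 1))))"
  have "deformable_with n E (4 * C1 + 1) (2 ^ (2 * n)) \<Delta>E"
    if E: "E \<in> horizontal_layer n" "hnorm E = 1" "c \<le> \<bar>E 1\<bar>" for E
    unfolding deformable_with_def
  proof (intro conjI allI impI E(1,2))
    show "0 < 4 * C1 + 1" using C1 by simp
    show "0 < (2::nat) ^ (2 * n)" by simp
    have pos: "2 * C1\<^sup>2 + 1 > 0" by (simp add: add_nonneg_pos)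
    show "0 < \<Delta>E \<eta>" if "0 < \<eta>" for \<eta>
      unfolding \<Delta>E_def using that C1 M(1) c pos by simp
    fix l \<eta> \<Delta> :: real and u :: vec
    assume "0 < l \<and> l < 1 \<and> 0 < \<eta> \<and> 0 < \<Delta> \<and> \<Delta> < \<Delta>E \<eta> \<and> u \<in> filiform n \<and> cc_norm n u \<le> 1"
    then have l: "0 < l" "l < 1" and \<eta>: "0 < \<eta>" and \<Delta>: "0 < \<Delta>" "\<Delta> < 1" "\<Delta> < 1 / (2 * (C1 + 1))"
        "\<Delta> < c / (2 * (M + 1))" "\<Delta> < \<eta> / (2 * C1\<^sup>2 + 1)"
      and u: "u \<in> filiform n" "cc_norm n u \<le> 1" by (auto simp: \<Delta>E_def)
    define a1 a2 where "a1 = E 1" and "a2 = E 2"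
    have a: "a1 \<noteq> 0" "a1\<^sup>2 + a2\<^sup>2 = 1" "c \<le> \<bar>a1\<bar>" using E c by (auto simp: a1_def a2_def hnorm_def)
    have a2: "\<bar>a2\<bar> \<le> 1"
    proof -
      have "a2\<^sup>2 \<le> 1" using a(2) zero_le_power2[of a1] by linarith
      then show ?thesis by (simp add: abs_square_le_1)
    qed
    have a1: "\<bar>a1\<bar> \<le> 1"
    proof -
      have "a1\<^sup>2 \<le> 1" using a(2) zero_le_power2[of a2] by linarith
      then show ?thesis by (simp add: abs_square_le_1)
    qed
    \<comment> \<open>The position of the target for \<open>l = 1\<close>. The bound on \<open>\<Delta>\<close> keeps it strictly between the kinks.\<close>
    define r where "r = \<Delta> * u 1 / a1"
    have r\<Delta>: "\<bar>r\<bar> \<le> \<Delta> * (M / c)"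
    proof -
      have "\<bar>r\<bar> = \<Delta> * (\<bar>u 1\<bar> / \<bar>a1\<bar>)" using \<Delta>(1) by (simp add: r_def abs_mult)
      also have "\<dots> \<le> \<Delta> * (M / c)"
        using \<Delta>(1) M(1) M(2)[OF u(2)] a(3) c by (intro mult_left_mono frac_le) auto
      finally show ?thesis .
    qed
    have r: "\<bar>r\<bar> < 1 / 2"
    proof -
      have "\<Delta> * (2 * (M + 1)) < c" using \<Delta>(4) M(1) by (simp add: pos_less_divide_eq)
      then have "\<Delta> * M < c / 2" using \<Delta>(1) by (simp add: algebra_simps)
      then have "\<Delta> * (M / c) < 1 / 2" using c by (simp add: field_simps)
      then show ?thesis using r\<Delta> by linarith
    qed
    define q where "q i x = (- a1) ^ i * x ^ Suc i / fact (Suc i)" for i and x :: real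
    \<comment> \<open>The straight line reaches the position \<open>r\<close>, for \<open>l = 1\<close>, with coordinates \<open>a2 * q i r\<close>;
      the kinks on the left have to supply the difference to the target.\<close>
    define m where "m i = \<Delta> ^ Suc i * fps_nth (sk u) i - a2 * q i r" for i
    have m: "\<bar>m i\<bar> \<le> C0 * \<Delta>" if "i + 2 \<le> n" for i
    proof -
      have "\<Delta> ^ Suc i \<le> \<Delta>" using \<Delta>(1,2) power_decreasing[of 1 "Suc i" \<Delta>] by simp
      then have "\<bar>\<Delta> ^ Suc i * fps_nth (sk u) i\<bar> \<le> \<Delta> * M"
        unfolding abs_mult using M(3)[OF u(2) that] \<Delta>(1) by (intro mult_mono) (auto simp del: power_Suc)
      moreover have "\<bar>a2 * q i r\<bar> \<le> \<Delta> * (M / c)"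
      proof -
        have "\<bar>a1\<bar> ^ i \<le> 1" using a1 by (simp add: power_le_one)
        moreover have "\<bar>r\<bar> ^ Suc i \<le> \<bar>r\<bar>" using r power_decreasing[of 1 "Suc i" "\<bar>r\<bar>"] by simp
        moreover have "(1::real) \<le> fact (Suc i)" by (rule fact_ge_1)
        ultimately have "\<bar>a1\<bar> ^ i * \<bar>r\<bar> ^ Suc i / fact (Suc i) \<le> 1 * \<bar>r\<bar> / 1"
          by (intro frac_le mult_mono) (auto simp del: fact_Suc power_Suc)
        then have "\<bar>q i r\<bar> \<le> \<bar>r\<bar>" by (simp add: q_def abs_mult power_abs del: fact_Suc power_Suc)
        then have "\<bar>a2\<bar> * \<bar>q i r\<bar> \<le> 1 * \<bar>r\<bar>" using a2 by (intro mult_mono) auto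
        then show ?thesis using r\<Delta> by (simp add: abs_mult)
      qed
      ultimately have "\<bar>m i\<bar> \<le> \<Delta> * M + \<Delta> * (M / c)"
        unfolding m_def by (intro order_trans[OF abs_triangle_ineq4] add_mono)
      then show ?thesis unfolding C0_def by (simp only: distrib_left mult.commute[of _ \<Delta>])
    qed
    have C0\<Delta>: "0 \<le> C0 * \<Delta>" using C0 \<Delta>(1) by simp
    have "\<forall>i. i + 2 \<le> n \<longrightarrow> \<bar>- m i\<bar> \<le> C0 * \<Delta>" using m by simp
    \<comment> \<open>The sign is reversed because a kink at \<open>s\<close> of weight \<open>w\<close> adds \<open>w (Q i x - Q i s)\<close> to the coordinate
      \<open>i\<close>, and the weights sum up to 0.\<close>
    from BL(2)[OF a(3) this C0\<Delta>] obtain wL where wL: "(\<Sum>s\<in>SL. wL s) = 0"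
      "\<And>i. i + 2 \<le> n \<Longrightarrow> (\<Sum>s\<in>SL. wL s * q i s) = - m i" "\<And>s. s \<in> SL \<Longrightarrow> \<bar>wL s\<bar> \<le> BL * (C0 * \<Delta>)"
      using n unfolding q_def by auto
    have "\<forall>i. i + 2 \<le> n \<longrightarrow> \<bar>m i\<bar> \<le> C0 * \<Delta>" using m by simp
    from BR(2)[OF a(3) this C0\<Delta>] obtain wR where wR: "(\<Sum>s\<in>SR. wR s) = 0"
      "\<And>i. i + 2 \<le> n \<Longrightarrow> (\<Sum>s\<in>SR. wR s * q i s) = m i" "\<And>s. s \<in> SR \<Longrightarrow> \<bar>wR s\<bar> \<le> BR * (C0 * \<Delta>)"
      using n unfolding q_def by auto
    define w where "w s = (if s \<in> SL then wL s else wR s)" for s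
    have wR_eq: "w s = wR s" if "s \<in> SR" for s using that disj by (auto simp: w_def)
    have sumL: "(\<Sum>s\<in>SL. w s * f s) = (\<Sum>s\<in>SL. wL s * f s)" for f by (simp add: w_def)
    have sumR: "(\<Sum>s\<in>SR. w s * f s) = (\<Sum>s\<in>SR. wR s * f s)" for f by (simp add: wR_eq)
    have sumK: "(\<Sum>s\<in>K. f s) = (\<Sum>s\<in>SL. f s) + (\<Sum>s\<in>SR. f s)" for f :: "real \<Rightarrow> real"
      unfolding K_def by (rule sum.union_disjoint[OF SL(1) SR(1) disj])
    have w_abs: "(\<Sum>s\<in>K. \<bar>w s\<bar>) \<le> C1 * \<Delta>"
    proof -
      have "(\<Sum>s\<in>SL. \<bar>w s\<bar>) \<le> real n * (BL * (C0 * \<Delta>))"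
        using sum_bounded_above[of SL "\<lambda>s. \<bar>w s\<bar>" "BL * (C0 * \<Delta>)"] wL(3) SL(2) by (simp add: w_def)
      moreover have "(\<Sum>s\<in>SR. \<bar>w s\<bar>) \<le> real n * (BR * (C0 * \<Delta>))"
        using sum_bounded_above[of SR "\<lambda>s. \<bar>w s\<bar>" "BR * (C0 * \<Delta>)"] wR(3) SR(2) by (simp add: wR_eq)
      ultimately show ?thesis unfolding sumK C1_def by (simp add: algebra_simps)
    qed
    have C1\<Delta>: "C1 * \<Delta> \<le> 1 / 2"
    proof -
      have "\<Delta> * (2 * (C1 + 1)) < 1" using \<Delta>(3) C1 by (simp add: pos_less_divide_eq)
      then show ?thesis using \<Delta>(1) by (simp add: algebra_simps)
    qed
    interpret kinked_line n a1 a2 l K w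
      using n2 a K(1) w_abs C1\<Delta> by unfold_locales auto
    have Qq: "Q i x = q i x" for i x by (simp only: Q_eq q_def)
    have sum_w: "(\<Sum>s\<in>K. w s) = 0" 
    proof -
      have "(\<Sum>s\<in>SL. w s) = 0" using wL(1) by (simp add: w_def)
      moreover have "(\<Sum>s\<in>SR. w s) = (\<Sum>s\<in>SR. wR s)" by (intro sum.cong refl wR_eq)
      ultimately show ?thesis unfolding sumK using wR(1) by simp
    qed
    have sum_wQ: "(\<Sum>s\<in>K. w s * Q i (l * s)) = 0" if i: "i + 2 \<le> n" for i
    proof -
      have "(\<Sum>s\<in>K. w s * Q i (l * s)) = l ^ Suc i * (\<Sum>s\<in>K. w s * q i s)"
        unfolding Q_scale unfolding Qq by (simp add: sum_distrib_left mult_ac del: power_Suc)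
      also have "(\<Sum>s\<in>K. w s * q i s) = 0" unfolding sumK sumL sumR using wL(2)[OF i] wR(2)[OF i] by simp
      finally show ?thesis by simp
    qed
    have sum_ws: "(\<Sum>s\<in>K. w s * s) = 0"
      using sum_wQ[of 0] n l by (simp add: Q_0 mult.left_commute flip: sum_distrib_left)
    \<comment> \<open>The position of the target at the scale \<open>l\<close>.\<close>
    define x where "x = l * r"
    have below_x: "below x = SL"
    proof -
      have "l * s < x" if "s \<in> SL" for s
      proof -
        have "s < r" using SL(3)[OF that] r by (auto simp: abs_less_iff)
        then show ?thesis using l(1) by (simp add: x_def)
      qed
      moreover have "\<not> l * s < x" if "s \<in> SR" for s
      proof -
        have "r < s" using SR(3)[OF that] r by (auto simp: abs_less_iff)
        then show ?thesis using l(1) by (simp add: x_def)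
      qed
      ultimately show ?thesis unfolding below_def by (auto simp: K_def)
    qed
    have P_x: "P i x = (\<Delta> * l) ^ Suc i * fps_nth (sk u) i" if i: "i + 2 \<le> n" for i
    proof -
      have "P i x = (a2 + turn SL) * Q i x - (\<Sum>s\<in>SL. w s * Q i (l * s))" unfolding P_below below_x ..
      also have "turn SL = 0" unfolding turn_def using wL(1) by (simp add: w_def)
      also have "(\<Sum>s\<in>SL. w s * Q i (l * s)) = l ^ Suc i * (\<Sum>s\<in>SL. w s * q i s)"
        unfolding Q_scale unfolding Qq by (simp add: sum_distrib_left mult_ac del: power_Suc)
      also have "(\<Sum>s\<in>SL. w s * q i s) = - m i" unfolding sumL using wL(2)[OF i] .
      also have "Q i x = l ^ Suc i * q i r" unfolding x_def Q_scale unfolding Qq ..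
      finally show ?thesis by (simp add: m_def power_mult_distrib algebra_simps)
    qed
    have a1x: "a1 * x = \<Delta> * l * u 1" using a(1) by (simp add: x_def r_def)
    have u2: "fps_nth (sk u) 0 = u 2" by (simp add: sk_def hat_def numeral_2_eq_2)
    let ?dil = "dilation (\<Delta> * l) u"
    have T_x: "T x = vinner n ?dil (left_inv_field n E (\<lambda>k. 0))"
    proof -
      have "T x = x + a2 * (\<Sum>s\<in>SL. w s * (x - l * s))" unfolding T_below below_x ..
      also have "(\<Sum>s\<in>SL. w s * (x - l * s)) = x * (\<Sum>s\<in>SL. w s) - l * (\<Sum>s\<in>SL. w s * q 0 s)"
        by (simp add: q_def algebra_simps sum_subtractf sum_distrib_left)
      also have "\<dots> = l * m 0" unfolding sumL using wL(1) wL(2)[of 0] n by (simp add: w_def)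
      also have "m 0 = \<Delta> * u 2 - a2 * r" by (simp add: m_def u2 q_def)
      finally have "T x = (1 - a2\<^sup>2) * x + a2 * (\<Delta> * l * u 2)"
        by (simp add: x_def power2_eq_square algebra_simps)
      also have "1 - a2\<^sup>2 = a1\<^sup>2" using a(2) by simp
      finally have "T x = \<Delta> * l * u 1 * a1 + \<Delta> * l * u 2 * a2"
        using a1x by (simp add: power2_eq_square mult_ac)
      also have "\<dots> = (\<Sum>k\<in>{1, 2}. ?dil k * E k)" by (simp add: dilation_def a1_def a2_def)
      also have "\<dots> = (\<Sum>k = 1..n. ?dil k * E k)"
        using n E(1) unfolding horizontal_layer_iff by (intro sum.mono_neutral_left) auto
      finally show ?thesis unfolding left_inv_field_0[OF n2 E(1)] vinner_def .
    qed
    have dil: "?dil \<in> filiform n" using u(1) by (simp add: filiform_def dilation_def)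
    have hit: "curve (T x) = ?dil"
    proof -
      have "curve (T x) = of_sk n (?dil 1) (Abs_fps (\<lambda>i. P i x))"
        unfolding curve_def pos_T a1x by (simp add: dilation_def)
      also have "\<dots> = of_sk n (?dil 1) (sk ?dil)"
        by (rule of_sk_cong) (simp add: P_x sk_dilation del: power_Suc)
      finally show ?thesis using of_sk_sk[OF dil] by simp
    qed
    have out: "curve t = vscale t E" if "l \<le> \<bar>t\<bar>" for t
    proof -
      have "pos t = t" using T_outside[OF l(1) K(3) sum_w sum_ws that] .
      then have "curve t = of_sk n (a1 * t) (Abs_fps (\<lambda>i. P i t))" by (simp add: curve_def)
      also have "\<dots> = of_sk n (a1 * t) (Abs_fps (\<lambda>i. a2 * Q i t))"
        by (rule of_sk_cong) (simp add: P_outside[OF l(1) K(3) sum_w sum_wQ that])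
      also have "\<dots> = vscale t E" using vscale_horizontal[OF E(1)] by (simp add: a1_def a2_def)
      finally show ?thesis .
    qed
    let ?L = "1 + 2 * (\<Sum>s\<in>K. \<bar>w s\<bar>)\<^sup>2"
    have lip: "cc_lipschitz_with n ?L curve" by (rule sk_curve_lipschitz[OF n2 sk_curve_curve])
    have L: "?L \<le> 1 + \<eta> * \<Delta>"
    proof -
      have "(\<Sum>s\<in>K. \<bar>w s\<bar>)\<^sup>2 \<le> (C1 * \<Delta>)\<^sup>2" using w_abs by (intro power_mono sum_nonneg) auto
      then have "2 * (\<Sum>s\<in>K. \<bar>w s\<bar>)\<^sup>2 \<le> (2 * C1\<^sup>2 * \<Delta>) * \<Delta>" by (simp add: power2_eq_square mult_ac)
      also have "2 * C1\<^sup>2 * \<Delta> \<le> (2 * C1\<^sup>2 + 1) * \<Delta>" using \<Delta>(1) by simp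
      also have "\<dots> \<le> \<eta>" using \<Delta>(5) pos by (simp add: pos_less_divide_eq mult.commute)
      finally show ?thesis using \<Delta>(1) by simp
    qed
    show "\<exists>g. (\<exists>L. cc_lipschitz_with n L g) \<and> horizontal_curve n g \<and>
           joins_horizontal_lines n (2 ^ (2 * n)) g \<and>
           (\<forall>t. \<bar>t\<bar> \<ge> l \<longrightarrow> g t = vscale t E) \<and>
           g (vinner n ?dil (left_inv_field n E (\<lambda>k. 0))) = ?dil \<and>
           cc_Lip n g \<le> ereal (1 + \<eta> * \<Delta>) \<and>
           finite {t. \<not> (\<exists>D. ((\<lambda>s. hproj (g s)) has_vector_derivative D) (at t) \<and>
                            norm (D - hproj E) \<le> (4 * C1 + 1) * \<Delta>)}"
    proof (intro exI[of _ curve] conjI allI impI)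
      show "\<exists>L. cc_lipschitz_with n L curve" using lip by blast
      show "horizontal_curve n curve" by (rule sk_curve_horizontal_curve[OF n2 sk_curve_curve])
      show "joins_horizontal_lines n (2 ^ (2 * n)) curve" using joins_lines unfolding K(2) .
      show "curve t = vscale t E" if "l \<le> \<bar>t\<bar>" for t using out[OF that] .
      show "curve (vinner n ?dil (left_inv_field n E (\<lambda>k. 0))) = ?dil" using hit unfolding T_x .
      have "cc_Lip n curve \<le> ereal ?L" unfolding cc_Lip_def using lip by (intro Inf_lower) blast
      also have "\<dots> \<le> ereal (1 + \<eta> * \<Delta>)" using L by simp
      finally show "cc_Lip n curve \<le> ereal (1 + \<eta> * \<Delta>)" .
      show "finite {t. \<not> (\<exists>D. ((\<lambda>s. hproj (curve s)) has_vector_derivative D) (at t) \<and>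
                            norm (D - hproj E) \<le> (4 * C1 + 1) * \<Delta>)}"
      proof (rule finite_subset[of _ breaks])
        show "finite breaks" using K(1) by (simp add: breaks_def)
        have "4 * (\<Sum>s\<in>K. \<bar>w s\<bar>) \<le> (4 * C1 + 1) * \<Delta>" using w_abs \<Delta>(1) by (simp add: distrib_right)
        then have "\<exists>D. ((\<lambda>s. hproj (curve s)) has_vector_derivative D) (at t) \<and>
             norm (D - hproj E) \<le> (4 * C1 + 1) * \<Delta>" if "t \<notin> breaks" for t
          using hproj_curve_derivative[OF that, of E] unfolding a1_def a2_def by (meson order_trans)
        then show "{t. \<not> (\<exists>D. ((\<lambda>s. hproj (curve s)) has_vector_derivative D) (at t) \<and>
                            norm (D - hproj E) \<le> (4 * C1 + 1) * \<Delta>)} \<subseteq> breaks" by blast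
      qed
    qed
  qed
  then show ?thesis by blast
qed

text \<open>
  Among the unit vectors of the horizontal layer, \<open>X_2\<close> and \<open>- X_2\<close> are those with \<open>E 1 = 0\<close>. For the
  others, \<open>\<bar>E 1\<bar> / 2\<close> is a lower bound for \<open>\<bar>E' 1\<bar>\<close> near \<open>E\<close>.
\<close>

theorem theorem4p4:
  fixes n :: nat and E :: "nat \<Rightarrow> real"
  assumes "n \<ge> 3"
    and "E \<in> horizontal_layer n" and "hnorm E = 1"
    and "E \<noteq> basis_vec 2" and "E \<noteq> (\<lambda>k. - basis_vec 2 k)"
  shows "deformable n E \<and>
    (\<exists>C N \<Delta>E. deformable_with n E C N \<Delta>E \<and>
       (\<exists>\<epsilon>>0. \<forall>E'. E' \<in> horizontal_layer n \<and> hnorm E' = 1 \<and> hnorm (\<lambda>k. E' k - E k) < \<epsilon> \<longrightarrow>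
          deformable_with n E' C N \<Delta>E))"
proof -
  have "E 1 \<noteq> 0"
  proof
    assume 0: "E 1 = 0"
    then have "\<bar>E 2\<bar> = 1" using assms(3) by (simp add: hnorm_def)
    then consider "E 2 = 1" | "E 2 = - 1" by linarith
    note E2 = this
    have eq: "E k = E 2 * basis_vec 2 k" for k
      using assms(2) 0 by (cases "k = 1") (auto simp: horizontal_layer_iff basis_vec_def)
    show False
    proof (cases rule: E2)
      case 1
      have "E k = basis_vec 2 k" for k using eq[of k] unfolding 1 by simp
      then show False using assms(4) by blast
    next
      case 2
      have "E k = - basis_vec 2 k" for k using eq[of k] unfolding 2 by simp
      then show False using assms(5) by blast
    qed
  qed
  moreover have "\<bar>E 1\<bar> \<le> 1"
  proof -
    have "(E 1)\<^sup>2 + (E 2)\<^sup>2 = 1" using assms(3) by (simp add: hnorm_def)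
    then have "(E 1)\<^sup>2 \<le> 1" using zero_le_power2[of "E 2"] by linarith
    then show ?thesis by (simp add: abs_square_le_1)
  qed
  ultimately have c: "0 < \<bar>E 1\<bar> / 2" "\<bar>E 1\<bar> / 2 \<le> 1" by auto
  obtain C N \<Delta>E where *: "\<And>E'. E' \<in> horizontal_layer n \<Longrightarrow> hnorm E' = 1 \<Longrightarrow> \<bar>E 1\<bar> / 2 \<le> \<bar>E' 1\<bar> \<Longrightarrow> deformable_with n E' C N \<Delta>E"
    using uniformly_deformable[OF assms(1) c] by blast
  have E: "deformable_with n E C N \<Delta>E" using *[OF assms(2,3)] by simp
  have "deformable_with n E' C N \<Delta>E"
    if "E' \<in> horizontal_layer n" "hnorm E' = 1" "hnorm (\<lambda>k. E' k - E k) < \<bar>E 1\<bar> / 2" for E'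
  proof (rule *[OF that(1,2)])
    have "\<bar>E' 1 - E 1\<bar> \<le> hnorm (\<lambda>k. E' k - E k)" by (simp add: hnorm_def real_le_rsqrt)
    then show "\<bar>E 1\<bar> / 2 \<le> \<bar>E' 1\<bar>" using that(3) by linarith
  qed
  then show ?thesis using E c(1) unfolding deformable_def by blast
qed

end
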